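(* Let $(A,\mathfrak m)$ be a Noetherian local ring with infinite residue field, $M$ a finitely generated Cohen-Macaulay $A$-module of positive dimension, and $I$ an $\mathfrak m$-primary ideal such that $IM\subseteq\mathfrak m^bM$ for some integer $b\ge2$. Then $$e_1(I,M)\le\binom{e_0(I,M)-b}{2}.$$
   Context: $\ell$ denotes length. For an $\mathfrak m$-primary ideal $I$ and a finitely generated $A$-module $M$ of dimension $d$, the Hilbert coefficients $e_0(I,M),\dots,e_d(I,M)$ are the integers with $\ell(M/I^{n+1}M)=\sum_{i=0}^d(-1)^ie_i(I,M)\binom{n+d-i}{d-i}$ for all $n\gg0$. *)

theory Defs
  imports "HOL-Algebra.Algebra" "HOL-Library.Extended_Nat"
begin

section \<open>Modules: generated submodules, quotients, length\<close>

definition module_span ::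
    "('a, 'r) ring_scheme \<Rightarrow> ('a, 'b, 'm) module_scheme \<Rightarrow> 'b set \<Rightarrow> 'b set" where
  "module_span A M S = \<Inter> {N. submodule N A M \<and> S \<subseteq> N}"

definition fin_gen_module ::
    "('a, 'r) ring_scheme \<Rightarrow> ('a, 'b, 'm) module_scheme \<Rightarrow> bool" where
  "fin_gen_module A M \<longleftrightarrow>
     module A M \<and> (\<exists>S \<subseteq> carrier M. finite S \<and> module_span A M S = carrier M)"

text \<open>The product \<open>I M\<close>.\<close>

definition ideal_times_module ::
    "('a, 'r) ring_scheme \<Rightarrow> 'a set \<Rightarrow> ('a, 'b, 'm) module_scheme \<Rightarrow> 'b set" where
  "ideal_times_module A I M = module_span A M {a \<odot>\<^bsub>M\<^esub> v | a v. a \<in> I \<and> v \<in> carrier M}"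

text \<open>
  Powers are taken in the library's multiplicative monoid of ideals, so \<open>I\<^sup>0\<close> is the unit ideal.
\<close>

abbreviation ideal_power :: "('a, 'r) ring_scheme \<Rightarrow> 'a set \<Rightarrow> nat \<Rightarrow> 'a set" where
  "ideal_power A I n \<equiv> I [^]\<^bsub>ideals_set A\<^esub> n"

text \<open>
  The quotient \<open>M / N\<close>, built like the library's \<^const>\<open>FactRing\<close>. A module record extends a ring
  record, but the locale \<^locale>\<open>module\<close> ignores the fields \<open>mult\<close> and \<open>one\<close> of the module.
\<close>

definition quotient_module ::
    "('a, 'b, 'm) module_scheme \<Rightarrow> 'b set \<Rightarrow> ('a, 'b set) module" where
  "quotient_module M N =
     \<lparr>carrier = a_rcosets\<^bsub>M\<^esub> N, monoid.mult = undefined, one = undefined,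
      ring.zero = N, ring.add = set_add M,
      smult = (\<lambda>a C. \<Union>v\<in>C. N +>\<^bsub>M\<^esub> (a \<odot>\<^bsub>M\<^esub> v))\<rparr>"

text \<open>
  The supremum of all \<open>n\<close> for which there is a strict chain \<open>C\<^sub>0 \<subset> C\<^sub>1 \<subset> \<dots> \<subset> C\<^sub>n\<close> in a family of
  sets. It is \<open>0\<close> for the empty family.
\<close>

definition chain_sup :: "'a set set \<Rightarrow> enat" where
  "chain_sup F =
     Sup {enat n | n. \<exists>C :: nat \<Rightarrow> 'a set. (\<forall>i\<le>n. C i \<in> F) \<and> (\<forall>i<n. C i \<subset> C (Suc i))}"

definition module_length ::
    "('a, 'r) ring_scheme \<Rightarrow> ('a, 'b, 'm) module_scheme \<Rightarrow> enat" where
  "module_length A M = chain_sup {N. submodule N A M}"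


section \<open>Local rings and primary ideals\<close>

definition local_ring :: "('a, 'r) ring_scheme \<Rightarrow> 'a set \<Rightarrow> bool" where
  "local_ring A \<mm> \<longleftrightarrow>
     cring A \<and> maximalideal \<mm> A \<and> (\<forall>J. maximalideal J A \<longrightarrow> J = \<mm>)"

definition radical_ideal :: "('a, 'r) ring_scheme \<Rightarrow> 'a set \<Rightarrow> 'a set" where
  "radical_ideal A I = {a \<in> carrier A. \<exists>n::nat. a [^]\<^bsub>A\<^esub> n \<in> I}"

definition primary_ideal :: "('a, 'r) ring_scheme \<Rightarrow> 'a set \<Rightarrow> bool" where
  "primary_ideal A I \<longleftrightarrow> ideal I A \<and> I \<noteq> carrier A \<and>
     (\<forall>a\<in>carrier A. \<forall>b\<in>carrier A. a \<otimes>\<^bsub>A\<^esub> b \<in> I \<longrightarrow> a \<in> I \<or> b \<in> radical_ideal A I)"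

text \<open>\<open>I\<close> is \<open>\<pp>\<close>-primary.\<close>

definition primary_to :: "('a, 'r) ring_scheme \<Rightarrow> 'a set \<Rightarrow> 'a set \<Rightarrow> bool" where
  "primary_to A \<pp> I \<longleftrightarrow> primary_ideal A I \<and> radical_ideal A I = \<pp>"


section \<open>Dimension, depth, Cohen--Macaulay modules\<close>

definition krull_dim :: "('a, 'r) ring_scheme \<Rightarrow> enat" where
  "krull_dim A = chain_sup {P. primeideal P A}"

definition annihilator ::
    "('a, 'r) ring_scheme \<Rightarrow> ('a, 'b, 'm) module_scheme \<Rightarrow> 'a set" where
  "annihilator A M = {a \<in> carrier A. \<forall>v\<in>carrier M. a \<odot>\<^bsub>M\<^esub> v = \<zero>\<^bsub>M\<^esub>}"

text \<open>For \<open>M = 0\<close> this gives dimension \<open>0\<close>, so positive dimension implies \<open>M \<noteq> 0\<close>.\<close>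

definition module_dim ::
    "('a, 'r) ring_scheme \<Rightarrow> ('a, 'b, 'm) module_scheme \<Rightarrow> enat" where
  "module_dim A M = krull_dim (A Quot (annihilator A M))"

definition nonzerodivisor_on :: "('a, 'b, 'm) module_scheme \<Rightarrow> 'a \<Rightarrow> bool" where
  "nonzerodivisor_on M a \<longleftrightarrow> (\<forall>v\<in>carrier M. a \<odot>\<^bsub>M\<^esub> v = \<zero>\<^bsub>M\<^esub> \<longrightarrow> v = \<zero>\<^bsub>M\<^esub>)"

text \<open>
  With 0-based list indexing, \<open>xs ! i\<close> acts on the quotient of \<open>M\<close> by the first \<open>i\<close> elements.
\<close>

definition regular_sequence ::
    "('a, 'r) ring_scheme \<Rightarrow> ('a, 'b, 'm) module_scheme \<Rightarrow> 'a list \<Rightarrow> bool" where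
  "regular_sequence A M xs \<longleftrightarrow> set xs \<subseteq> carrier A \<and>
     (\<forall>i<length xs. nonzerodivisor_on
        (quotient_module M (ideal_times_module A (Idl\<^bsub>A\<^esub> (set (take i xs))) M)) (xs ! i)) \<and>
     ideal_times_module A (Idl\<^bsub>A\<^esub> (set xs)) M \<noteq> carrier M"

definition depth ::
    "('a, 'r) ring_scheme \<Rightarrow> 'a set \<Rightarrow> ('a, 'b, 'm) module_scheme \<Rightarrow> enat" where
  "depth A \<mm> M = Sup {enat (length xs) | xs. set xs \<subseteq> \<mm> \<and> regular_sequence A M xs}"

text \<open>For finitely generated modules over a Noetherian local ring \<open>(A, \<mm>)\<close>.\<close>

definition cohen_macaulay ::
    "('a, 'r) ring_scheme \<Rightarrow> 'a set \<Rightarrow> ('a, 'b, 'm) module_scheme \<Rightarrow> bool" where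
  "cohen_macaulay A \<mm> M \<longleftrightarrow> depth A \<mm> M = module_dim A M"


section \<open>Hilbert coefficients\<close>

text \<open>
  \<open>e i\<close> for \<open>i > d\<close> has no mathematical meaning; it is set to \<open>0\<close> so that \<open>e\<close> is determined by
  the polynomial. The length is required to be finite for all large \<open>n\<close>.
\<close>

definition is_hilbert_coeffs ::
    "('a, 'r) ring_scheme \<Rightarrow> 'a set \<Rightarrow> ('a, 'b, 'm) module_scheme \<Rightarrow> (nat \<Rightarrow> int) \<Rightarrow> bool" where
  "is_hilbert_coeffs A I M e \<longleftrightarrow>
     (\<exists>d. module_dim A M = enat d \<and>
        (\<forall>i>d. e i = 0) \<and>
        (\<forall>\<^sub>F n in sequentially. \<exists>l.
           module_length A
             (quotient_module M (ideal_times_module A (ideal_power A I (n + 1)) M)) = enat l \<and>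
           int l = (\<Sum>i\<le>d. (- 1) ^ i * e i * int ((n + d - i) choose (d - i)))))"

definition hilbert_coeff ::
    "('a, 'r) ring_scheme \<Rightarrow> nat \<Rightarrow> 'a set \<Rightarrow> ('a, 'b, 'm) module_scheme \<Rightarrow> int" where
  "hilbert_coeff A i I M = (THE e. is_hilbert_coeffs A I M e) i"

end

theory Submission
  imports Defs
begin

text \<open>
  Quotients \<open>M / U\<close> are represented by the submodules \<open>U\<close> of the fixed module \<open>M\<close>. Superficial elements
  \<open>x\<^sub>1, \<dots>, x\<^sub>d \<in> I\<close> forming a regular sequence lower the degree of the Hilbert polynomial one step at
  a time without changing \<open>e\<^sub>0\<close> and \<open>e\<^sub>1\<close>, which reduces the bound to dimension one. They exist because
  the residue field is infinite: \<open>x\<close> only has to avoid finitely many proper subideals of \<open>I\<close>, coming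
  from an irreducible decomposition in the Rees module.

  In dimension one, let \<open>H n\<close> be the length of \<open>I\<^sup>n M / I\<^sup>n\<^sup>+\<^sup>1 M\<close>, so that \<open>e\<^sub>1\<close> is the sum of all
  \<open>e\<^sub>0 - H n\<close>. It suffices that \<open>H n \<ge> e\<^sub>0\<close> or \<open>H n \<ge> n + b + 1\<close> for each \<open>n\<close>. Put \<open>N = I\<^sup>n M\<close>. Since
  \<open>I N \<subseteq> \<mm>\<^sup>b N\<close>, \<open>H n\<close> is at least the length of \<open>N / \<mm> N\<close>, plus that of \<open>\<mm> N / \<mm>\<^sup>2 N\<close>, plus \<open>b - 2\<close>.
  If the first length is at most \<open>n\<close>, then \<open>N = x I\<^sup>n\<^sup>-\<^sup>1 M\<close> for some \<open>x \<in> I\<close>, so \<open>H\<close> does not increase from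
  \<open>n\<close> on. If the second is one, the powers \<open>I\<^sup>i N\<close> are the \<open>\<mm>\<^sup>i\<^sup>c N\<close> for some \<open>c\<close>, whence
  \<open>e\<^sub>0 \<le> c \<le> H n\<close>. Otherwise the sum is at least \<open>(n + 1) + 2 + (b - 2)\<close>.
\<close>

section \<open>Ascending chains and lengths of chains\<close>

text \<open>The threshold \<open>n + b + 1\<close> is what the binomial coefficient asks for: a
  degree with \<open>H n < e\<^sub>0\<close> then contributes at most
  \<open>e\<^sub>0 - b - 1 - n\<close> to \<open>e\<^sub>1\<close>, and the positive ones among
  these numbers add up to a triangular number. Cohen-Macaulayness enters twice. Depth is given only
  as a supremum over regular sequences, while a superficial element is chosen without regard to any
  of them; an exchange argument shows that every regular element of \<mm> leaves a quotient with one
  less depth. Moreover, a regular sequence as long as the dimension has a quotient of finite length,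
  because each regular element forces a prime ideal strictly below. Zero divisors are controlled
  without associated primes: those of degree one modulo an irreducible graded submodule form an
  ideal, and over an infinite residue field finitely many proper subideals never cover an ideal,
  prime or not. Being general therefore always means lying outside a finite set \<open>\<B>\<close>
  of ideals, and several such conditions are imposed together by uniting the sets.\<close>

definition acc :: "('x::order \<Rightarrow> bool) \<Rightarrow> bool" where
  "acc P \<longleftrightarrow> (\<forall>f::nat \<Rightarrow> 'x. (\<forall>n. P (f n)) \<longrightarrow> (\<forall>n. f n \<le> f (Suc n)) \<longrightarrow> (\<exists>N. \<forall>n\<ge>N. f n = f N))"

lemma accD:
  assumes "acc P" "\<And>n. P (f n)" "\<And>n. f n \<le> f (Suc n)"
  shows "\<exists>N. \<forall>n\<ge>N. f n = f N"
  using assms unfolding acc_def by simp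

lemma accI:
  assumes "\<And>f::nat \<Rightarrow> 'x::order. (\<And>n. P (f n)) \<Longrightarrow> (\<And>m n. m \<le> n \<Longrightarrow> f m \<le> f n) \<Longrightarrow> \<exists>N. \<forall>n\<ge>N. f n = f N"
  shows "acc P"
  unfolding acc_def
proof (intro allI impI)
  fix f :: "nat \<Rightarrow> 'x"
  assume P: "\<forall>n. P (f n)" and "\<forall>n. f n \<le> f (Suc n)"
  then have "\<And>m n. m \<le> n \<Longrightarrow> f m \<le> f n"
    using lift_Suc_mono_le[of f] by blast
  with P show "\<exists>N. \<forall>n\<ge>N. f n = f N" using assms by blast
qed

text \<open>\<open>Q\<close> varies while \<open>acc P\<close> stays fixed, so the chain conditions
  on ideals and on submodules yield all maximal objects used below, by dependent choice in place of
  Zorn's lemma.\<close>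

lemma acc_maximal:
  assumes "acc P" and ex: "Q z" and QP: "\<And>x. Q x \<Longrightarrow> P x"
  shows "\<exists>x. Q x \<and> (\<forall>y. Q y \<longrightarrow> x \<le> y \<longrightarrow> y = x)"
proof (rule ccontr)
  assume "\<not> ?thesis"
  then have step: "\<exists>y. Q y \<and> x < y" if "Q x" for x
    using that by (metis order.not_eq_order_implies_strict)
  obtain f where f: "\<And>n. Q (f n)" "\<And>n. f n < f (Suc n)"
    using dependent_nat_choice[of "\<lambda>_ x. Q x" "\<lambda>_ x y. x < y"] ex step by metis
  have inc: "f n \<le> f (Suc n)" for n using f(2)[of n] by (rule less_imp_le)
  obtain N where "\<forall>n\<ge>N. f n = f N"
    using accD[of P f, OF assms(1) QP[OF f(1)] inc] by blast
  then have "f (Suc N) = f N" using le_SucI[OF order_refl] by blast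
  with f(2)[of N] show False by simp
qed

text \<open>Along a chain both invariants become constant, and together they detect every strict
  step. Injectivity is asked only for comparable pairs, because for submodules it rests on the
  modular law.\<close>

lemma acc_joint_injective:
  fixes P :: "'x::order \<Rightarrow> bool" and Qa :: "'y::order \<Rightarrow> bool" and Qb :: "'z::order \<Rightarrow> bool"
  assumes "acc Qa" "acc Qb"
    and Q1: "\<And>x. P x \<Longrightarrow> Qa (\<phi> x)" and Q2: "\<And>x. P x \<Longrightarrow> Qb (\<psi> x)"
    and m1: "\<And>x y. P x \<Longrightarrow> P y \<Longrightarrow> x \<le> y \<Longrightarrow> \<phi> x \<le> \<phi> y"
    and m2: "\<And>x y. P x \<Longrightarrow> P y \<Longrightarrow> x \<le> y \<Longrightarrow> \<psi> x \<le> \<psi> y"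
    and inj: "\<And>x y. P x \<Longrightarrow> P y \<Longrightarrow> x \<le> y \<Longrightarrow> \<phi> x = \<phi> y \<Longrightarrow> \<psi> x = \<psi> y \<Longrightarrow> x = y"
  shows "acc P"
proof (rule accI)
  fix f :: "nat \<Rightarrow> 'x" assume P: "\<And>n. P (f n)" and mono: "\<And>m n. m \<le> n \<Longrightarrow> f m \<le> f n"
  have "\<exists>N. \<forall>n\<ge>N. \<phi> (f n) = \<phi> (f N)"
    by (rule accD[of Qa "\<lambda>n. \<phi> (f n)", OF assms(1)]) (intro Q1 m1 P mono lessI less_imp_le)+
  then obtain N1 where N1: "\<forall>n\<ge>N1. \<phi> (f n) = \<phi> (f N1)" ..
  have "\<exists>N. \<forall>n\<ge>N. \<psi> (f n) = \<psi> (f N)"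
    by (rule accD[of Qb "\<lambda>n. \<psi> (f n)", OF assms(2)]) (intro Q2 m2 P mono lessI less_imp_le)+
  then obtain N2 where N2: "\<forall>n\<ge>N2. \<psi> (f n) = \<psi> (f N2)" ..
  have "f n = f (max N1 N2)" if "n \<ge> max N1 N2" for n
  proof (rule inj[symmetric])
    show "\<phi> (f (max N1 N2)) = \<phi> (f n)" using N1 that by (metis max.bounded_iff max.cobounded1)
    show "\<psi> (f (max N1 N2)) = \<psi> (f n)" using N2 that by (metis max.bounded_iff max.cobounded2)
  qed (use P mono that in auto)
  then show "\<exists>N. \<forall>n\<ge>N. f n = f N" by blast
qed

text \<open>A greatest element of \<open>P\<close> counts as irreducible, so the whole Rees module
  has to be treated as a separate case later.\<close>

definition meet_irreducible :: "('x::lattice \<Rightarrow> bool) \<Rightarrow> 'x \<Rightarrow> bool" where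
  "meet_irreducible P q \<longleftrightarrow> P q \<and> (\<forall>a b. P a \<longrightarrow> P b \<longrightarrow> q = inf a b \<longrightarrow> q = a \<or> q = b)"

text \<open>Noetherian induction on a maximal element without a decomposition. The last clause makes
  \<open>z\<close> the infimum of \<open>Q\<close> in the whole lattice and not only among the
  elements satisfying \<open>P\<close>; this permits tests against families that are not graded
  submodules.\<close>

lemma irreducible_decomposition:
  fixes P :: "'x::lattice \<Rightarrow> bool"
  assumes "acc P" and "P z"
  shows "\<exists>Q. finite Q \<and> (\<forall>q\<in>Q. meet_irreducible P q \<and> z \<le> q) \<and>
    (\<forall>y. (\<forall>q\<in>Q. y \<le> q) \<longrightarrow> y \<le> z)"
proof -
  define dec where "dec z \<longleftrightarrow> (\<exists>Q. finite Q \<and> (\<forall>q\<in>Q. meet_irreducible P q \<and> z \<le> q) \<and>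
    (\<forall>y. (\<forall>q\<in>Q. y \<le> q) \<longrightarrow> y \<le> z))" for z
  have "dec z"
  proof (rule ccontr)
    assume "\<not> dec z"
    then obtain x where x: "P x" "\<not> dec x" and max: "\<forall>y. P y \<and> \<not> dec y \<longrightarrow> x \<le> y \<longrightarrow> y = x"
      using acc_maximal[OF assms(1), of "\<lambda>x. P x \<and> \<not> dec x" z] assms(2) by auto
    have "\<not> meet_irreducible P x"
    proof
      assume "meet_irreducible P x"
      then have "dec x" unfolding dec_def by (intro exI[of _ "{x}"]) auto
      with x show False by simp
    qed
    then obtain a b where ab: "P a" "P b" "x = inf a b" "x \<noteq> a" "x \<noteq> b"
      using x unfolding meet_irreducible_def by blast
    have "x \<le> a" "x \<le> b" using ab(3) by simp_all
    then have "dec a" "dec b" using max[THEN spec, of a] max[THEN spec, of b] ab by blast+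
    then obtain Qa Qb where
      Qa: "finite Qa" "\<forall>q\<in>Qa. meet_irreducible P q \<and> a \<le> q" "\<forall>y. (\<forall>q\<in>Qa. y \<le> q) \<longrightarrow> y \<le> a"
      and Qb: "finite Qb" "\<forall>q\<in>Qb. meet_irreducible P q \<and> b \<le> q" "\<forall>y. (\<forall>q\<in>Qb. y \<le> q) \<longrightarrow> y \<le> b"
      unfolding dec_def by blast
    have "dec x" unfolding dec_def
    proof (intro exI[of _ "Qa \<union> Qb"] conjI allI impI ballI)
      fix q assume "q \<in> Qa \<union> Qb"
      then show "meet_irreducible P q" "x \<le> q"
        using Qa(2) Qb(2) ab(3) le_infI1[of a q b] le_infI2[of b q a] by blast+
    next
      fix y assume "\<forall>q\<in>Qa \<union> Qb. y \<le> q"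
      then show "y \<le> x" using Qa(3) Qb(3) ab(3) by simp
    qed (use Qa(1) Qb(1) in simp)
    with x show False by simp
  qed
  then show ?thesis unfolding dec_def .
qed

section \<open>Lengths as suprema of chains\<close>

definition has_chain :: "'a set set \<Rightarrow> nat \<Rightarrow> bool" where
  "has_chain F n \<longleftrightarrow> (\<exists>C. (\<forall>i\<le>n. C i \<in> F) \<and> (\<forall>i<n. C i \<subset> C (Suc i)))"

lemma chain_sup_eq: "chain_sup F = Sup (enat ` Collect (has_chain F))"
  unfolding chain_sup_def has_chain_def by (rule arg_cong[where f = Sup]) auto

lemma chain_sup_ge:
  assumes "\<And>i. i \<le> n \<Longrightarrow> C i \<in> F" "\<And>i. i < n \<Longrightarrow> C i \<subset> C (Suc i)"
  shows "enat n \<le> chain_sup F"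
proof -
  have "has_chain F n" unfolding has_chain_def
    by (intro exI[of _ C] conjI allI impI assms)
  then show ?thesis unfolding chain_sup_eq by (intro Sup_upper) simp
qed

lemma chain_sup_le:
  assumes "\<And>n C. (\<And>i. i \<le> n \<Longrightarrow> C i \<in> F) \<Longrightarrow> (\<And>i. i < n \<Longrightarrow> C i \<subset> C (Suc i)) \<Longrightarrow> enat n \<le> k"
  shows "chain_sup F \<le> k"
  unfolding chain_sup_eq
proof (rule Sup_least)
  fix x assume "x \<in> enat ` Collect (has_chain F)"
  then obtain n C where "x = enat n" "\<forall>i\<le>n. C i \<in> F" "\<forall>i<n. C i \<subset> C (Suc i)"
    unfolding has_chain_def by auto
  then show "x \<le> k" using assms[of n C] by simp
qed

lemma has_chain_0: "F \<noteq> {} \<Longrightarrow> has_chain F 0"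
  unfolding has_chain_def by (intro exI[of _ "\<lambda>_. SOME N. N \<in> F"]) (simp add: some_in_eq)

lemma chain_sup_map:
  assumes "\<And>N. N \<in> F \<Longrightarrow> f N \<in> G"
    and "\<And>N N'. N \<in> F \<Longrightarrow> N' \<in> F \<Longrightarrow> N \<subset> N' \<Longrightarrow> f N \<subset> f N'"
  shows "chain_sup F \<le> chain_sup G"
proof (rule chain_sup_le)
  fix n C assume "\<And>i. i \<le> n \<Longrightarrow> C i \<in> F" "\<And>i. i < n \<Longrightarrow> C i \<subset> C (Suc i)"
  then show "enat n \<le> chain_sup G"
    by (intro chain_sup_ge[of n "\<lambda>i. f (C i)"]) (auto simp: assms)
qed

lemma enat_Sup_attained:
  fixes S :: "enat set"
  assumes "S \<noteq> {}" "Sup S = enat k"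
  shows "enat k \<in> S"
  using assms by (metis Max_in Sup_enat_def enat.distinct(1))

text \<open>If \<open>k\<close> is finite, both suprema are finite and hence attained, and the
  hypothesis applies to the two maximal elements.\<close>

lemma Sup_enat_add_le:
  fixes S T :: "enat set"
  assumes "S \<noteq> {}" "T \<noteq> {}" "\<And>s t. s \<in> S \<Longrightarrow> t \<in> T \<Longrightarrow> s + t \<le> k"
  shows "Sup S + Sup T \<le> k"
proof (cases k)
  case (enat k')
  obtain s0 t0 where "s0 \<in> S" "t0 \<in> T" using assms by blast
  then have "s \<le> k" if "s \<in> S" for s
    using assms(3)[OF that] by (meson le_iff_add order_trans)
  moreover have "t \<le> k" if "t \<in> T" for t
    using assms(3)[OF \<open>s0 \<in> S\<close> that] by (metis add.commute le_iff_add order_trans)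
  ultimately have "Sup S \<le> k" "Sup T \<le> k"
    by (simp_all add: Sup_least)
  then obtain s t where st: "Sup S = enat s" "Sup T = enat t"
    using enat by (metis enat_ile)
  then have "enat s \<in> S" "enat t \<in> T" using assms enat_Sup_attained by blast+
  then show ?thesis using assms(3) st by metis
qed auto

lemma chain_sup_add_le:
  assumes "\<And>N. N \<in> F \<Longrightarrow> N \<in> H" "\<And>N. N \<in> G \<Longrightarrow> N \<in> H"
    and below: "\<And>N N'. N \<in> F \<Longrightarrow> N' \<in> G \<Longrightarrow> N \<subseteq> N'" and "F \<noteq> {}" "G \<noteq> {}"
  shows "chain_sup F + chain_sup G \<le> chain_sup H"
  unfolding chain_sup_eq[of F] chain_sup_eq[of G]
proof (rule Sup_enat_add_le)
  show "enat ` Collect (has_chain F) \<noteq> {}" "enat ` Collect (has_chain G) \<noteq> {}"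
    using has_chain_0 assms by blast+
  fix s t
  assume "s \<in> enat ` Collect (has_chain F)" "t \<in> enat ` Collect (has_chain G)"
  then obtain n C m D where s: "s = enat n" and C: "\<And>i. i \<le> n \<Longrightarrow> C i \<in> F" "\<And>i. i < n \<Longrightarrow> C i \<subset> C (Suc i)"
    and t: "t = enat m" and D: "\<And>i. i \<le> m \<Longrightarrow> D i \<in> G" "\<And>i. i < m \<Longrightarrow> D i \<subset> D (Suc i)"
    unfolding has_chain_def by auto
  have "enat (n + m) \<le> chain_sup H"
  proof (rule chain_sup_ge)
    \<comment> \<open>\<open>D 0\<close> is dropped at the junction, since it may equal
      \<open>C n\<close>; the strict step there is
      \<open>C n \<subseteq> D 0 \<subset> D (Suc 0)\<close>.\<close>
    let ?E = "\<lambda>i. if i \<le> n then C i else D (i - n)"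
    show "?E i \<in> H" if "i \<le> n + m" for i using that C D assms by auto
    show "?E i \<subset> ?E (Suc i)" if "i < n + m" for i
    proof -
      consider "i < n" | "i = n" | "i > n" by linarith
      then show ?thesis
      proof cases
        case 2
        then have "m > 0" using that by simp
        then have "C n \<subseteq> D 0" "D 0 \<subset> D (Suc 0)"
          using below[OF C(1)[of n] D(1)[of 0]] D(2)[of 0] by simp_all
        then show ?thesis using 2 by auto
      next
        case 3
        then show ?thesis using D(2)[of "i - n"] that by (auto simp: Suc_diff_le)
      qed (use C in auto)
    qed
  qed
  then show "s + t \<le> chain_sup H" using s t by simp
qed

section \<open>Submodules\<close>

context module
begin

abbreviation madd (infixl \<open>+\<^sub>M\<close> 65) where "u +\<^sub>M v \<equiv> u \<oplus>\<^bsub>M\<^esub> v"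
abbreviation msub (infixl \<open>-\<^sub>M\<close> 65) where "u -\<^sub>M v \<equiv> u \<ominus>\<^bsub>M\<^esub> v"
abbreviation msc (infixr \<open>*\<^sub>M\<close> 70) where "a *\<^sub>M v \<equiv> a \<odot>\<^bsub>M\<^esub> v"
abbreviation sm where "sm V \<equiv> submodule V R M"

lemma sm_carrier: "sm V \<Longrightarrow> v \<in> V \<Longrightarrow> v \<in> carrier M"
  using submoduleE(1) by blast

lemma sm_subset: "sm V \<Longrightarrow> V \<subseteq> carrier M"
  using submoduleE(1) by blast

lemma sm_zero: "sm V \<Longrightarrow> \<zero>\<^bsub>M\<^esub> \<in> V"
  using submoduleE(2,3,5)[of V] sm_carrier[of V] M.r_neg by (metis all_not_in_conv)

lemma sm_add: "sm V \<Longrightarrow> u \<in> V \<Longrightarrow> v \<in> V \<Longrightarrow> u +\<^sub>M v \<in> V"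
  using submoduleE(5) by blast

lemma sm_neg: "sm V \<Longrightarrow> v \<in> V \<Longrightarrow> \<ominus>\<^bsub>M\<^esub> v \<in> V"
  using submoduleE(3) by blast

lemma sm_diff: "sm V \<Longrightarrow> u \<in> V \<Longrightarrow> v \<in> V \<Longrightarrow> u -\<^sub>M v \<in> V"
  by (simp add: a_minus_def sm_add sm_neg)

lemma sm_smult: "sm V \<Longrightarrow> a \<in> carrier R \<Longrightarrow> v \<in> V \<Longrightarrow> a *\<^sub>M v \<in> V"
  using submoduleE(4) by blast

lemma sm_addD1: "sm V \<Longrightarrow> u \<in> carrier M \<Longrightarrow> v \<in> V \<Longrightarrow> u +\<^sub>M v \<in> V \<Longrightarrow> u \<in> V"
  using sm_diff[of V "u +\<^sub>M v" v] sm_carrier[of V v]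
  by (simp add: a_minus_def M.a_assoc M.r_neg)

lemma sm_addD2: "sm V \<Longrightarrow> u \<in> carrier M \<Longrightarrow> v \<in> V \<Longrightarrow> v +\<^sub>M u \<in> V \<Longrightarrow> u \<in> V"
  using sm_addD1[of V u v] sm_carrier[of V v] by (simp add: M.a_comm)

lemma sm_diffD: "sm V \<Longrightarrow> u \<in> carrier M \<Longrightarrow> v \<in> V \<Longrightarrow> u -\<^sub>M v \<in> V \<Longrightarrow> u \<in> V"
  using sm_addD1[of V u "\<ominus>\<^bsub>M\<^esub> v"] sm_neg[of V v] by (simp add: a_minus_def)

lemma diff_add_cancel: "u \<in> carrier M \<Longrightarrow> v \<in> carrier M \<Longrightarrow> (u -\<^sub>M v) +\<^sub>M v = u"
  by (simp add: a_minus_def M.a_assoc M.l_neg)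

lemma smult_diff: "a \<in> carrier R \<Longrightarrow> u \<in> carrier M \<Longrightarrow> v \<in> carrier M \<Longrightarrow>
    a *\<^sub>M (u -\<^sub>M v) = a *\<^sub>M u -\<^sub>M a *\<^sub>M v"
  by (simp add: a_minus_def smult_r_distr smult_r_minus)

lemma smult_left_commute: "a \<in> carrier R \<Longrightarrow> b \<in> carrier R \<Longrightarrow> v \<in> carrier M \<Longrightarrow>
    a *\<^sub>M b *\<^sub>M v = b *\<^sub>M a *\<^sub>M v"
  by (metis smult_assoc1 m_comm)

lemma sm_carrier_set: "sm (carrier M)"
  by (rule carrier_is_submodule)

lemma sm_zero_set: "sm {\<zero>\<^bsub>M\<^esub>}"
  by (rule submoduleI) auto

lemma sm_Int: "sm V \<Longrightarrow> sm W \<Longrightarrow> sm (V \<inter> W)"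
  by (rule submoduleI) (auto simp: sm_carrier sm_zero sm_neg sm_add sm_smult)

lemma sm_Inter:
  assumes "\<And>V. V \<in> F \<Longrightarrow> sm V" "F \<noteq> {}"
  shows "sm (\<Inter>F)"
proof (rule submoduleI)
  show "\<Inter>F \<subseteq> carrier M" using assms sm_subset by blast
qed (use assms in \<open>auto simp: sm_zero sm_neg sm_add sm_smult\<close>)

section \<open>Sums, multiples and colons of submodules\<close>

definition join :: "'c set \<Rightarrow> 'c set \<Rightarrow> 'c set" (infixl \<open>\<uplus>\<close> 65) where
  "V \<uplus> W = {v +\<^sub>M w | v w. v \<in> V \<and> w \<in> W}"

lemma joinI: "v \<in> V \<Longrightarrow> w \<in> W \<Longrightarrow> v +\<^sub>M w \<in> V \<uplus> W"
  unfolding join_def by blast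

lemma joinE:
  assumes "u \<in> V \<uplus> W"
  obtains v w where "u = v +\<^sub>M w" "v \<in> V" "w \<in> W"
  using assms unfolding join_def by blast

lemma sm_join:
  assumes V: "sm V" and W: "sm W"
  shows "sm (V \<uplus> W)"
proof (rule submoduleI)
  show "V \<uplus> W \<subseteq> carrier M" unfolding join_def using sm_carrier V W by auto
  show "\<zero>\<^bsub>M\<^esub> \<in> V \<uplus> W" using joinI[OF sm_zero[OF V] sm_zero[OF W]] by simp
next
  fix u assume "u \<in> V \<uplus> W"
  then obtain v w where u: "u = v +\<^sub>M w" "v \<in> V" "w \<in> W" by (rule joinE)
  moreover have "\<ominus>\<^bsub>M\<^esub> u = \<ominus>\<^bsub>M\<^esub> v +\<^sub>M \<ominus>\<^bsub>M\<^esub> w"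
    using u sm_carrier V W by (simp add: M.minus_add)
  ultimately show "\<ominus>\<^bsub>M\<^esub> u \<in> V \<uplus> W" using V W by (simp add: joinI sm_neg)
  fix a assume "a \<in> carrier R"
  moreover have "a *\<^sub>M u = a *\<^sub>M v +\<^sub>M a *\<^sub>M w"
    using u sm_carrier V W calculation by (simp add: smult_r_distr)
  ultimately show "a *\<^sub>M u \<in> V \<uplus> W" using u V W by (simp add: joinI sm_smult)
next
  fix u u' assume "u \<in> V \<uplus> W" "u' \<in> V \<uplus> W"
  then obtain v w v' w' where u: "u = v +\<^sub>M w" "v \<in> V" "w \<in> W" "u' = v' +\<^sub>M w'" "v' \<in> V" "w' \<in> W"
    by (metis joinE)
  moreover have "u +\<^sub>M u' = (v +\<^sub>M v') +\<^sub>M (w +\<^sub>M w')"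
    using u sm_carrier V W by (simp add: M.a_ac)
  ultimately show "u +\<^sub>M u' \<in> V \<uplus> W" using V W by (simp add: joinI sm_add)
qed

lemma join_upper1: "sm V \<Longrightarrow> sm W \<Longrightarrow> V \<subseteq> V \<uplus> W"
proof
  fix v assume "sm V" "sm W" "v \<in> V"
  then show "v \<in> V \<uplus> W" using joinI[of v V "\<zero>\<^bsub>M\<^esub>" W] sm_carrier by (simp add: sm_zero)
qed

lemma join_upper2: "sm V \<Longrightarrow> sm W \<Longrightarrow> W \<subseteq> V \<uplus> W"
proof
  fix v assume "sm V" "sm W" "v \<in> W"
  then show "v \<in> V \<uplus> W" using joinI[of "\<zero>\<^bsub>M\<^esub>" V v W] sm_carrier by (simp add: sm_zero)
qed

lemma join_least: "sm Y \<Longrightarrow> V \<subseteq> Y \<Longrightarrow> W \<subseteq> Y \<Longrightarrow> V \<uplus> W \<subseteq> Y"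
  unfolding join_def using sm_add by blast

lemma join_mono: "V \<subseteq> V' \<Longrightarrow> W \<subseteq> W' \<Longrightarrow> V \<uplus> W \<subseteq> V' \<uplus> W'"
  unfolding join_def by blast

lemma join_absorb1: "sm V \<Longrightarrow> sm W \<Longrightarrow> W \<subseteq> V \<Longrightarrow> V \<uplus> W = V"
  using join_least[of V V W] join_upper1[of V W] by blast

lemma join_absorb2: "sm V \<Longrightarrow> sm W \<Longrightarrow> V \<subseteq> W \<Longrightarrow> V \<uplus> W = W"
  using join_least[of W V W] join_upper2[of V W] by blast

lemma join_commute: "sm V \<Longrightarrow> sm W \<Longrightarrow> V \<uplus> W = W \<uplus> V"
  by (intro equalityI join_least sm_join join_upper1 join_upper2)

lemma join_assoc:
  assumes "sm U" "sm V" "sm W"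
  shows "(U \<uplus> V) \<uplus> W = U \<uplus> (V \<uplus> W)"
proof
  have s: "sm (U \<uplus> V)" "sm (V \<uplus> W)" "sm (U \<uplus> V \<uplus> W)" "sm (U \<uplus> (V \<uplus> W))"
    using assms by (simp_all add: sm_join)
  have "V \<subseteq> U \<uplus> (V \<uplus> W)" "W \<subseteq> U \<uplus> (V \<uplus> W)"
    using join_upper2[OF assms(1) s(2)] join_upper1[OF assms(2,3)] join_upper2[OF assms(2,3)] by blast+
  then show "(U \<uplus> V) \<uplus> W \<subseteq> U \<uplus> (V \<uplus> W)"
    using join_upper1[OF assms(1) s(2)] s by (intro join_least)
  have "U \<subseteq> (U \<uplus> V) \<uplus> W" "V \<subseteq> (U \<uplus> V) \<uplus> W"
    using join_upper1[OF s(1) assms(3)] join_upper1[OF assms(1,2)] join_upper2[OF assms(1,2)] by blast+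
  then show "U \<uplus> (V \<uplus> W) \<subseteq> (U \<uplus> V) \<uplus> W"
    using join_upper2[OF s(1) assms(3)] s by (intro join_least)
qed

lemma join_zero: "sm V \<Longrightarrow> V \<uplus> {\<zero>\<^bsub>M\<^esub>} = V"
  by (rule join_absorb1) (auto simp: sm_zero sm_zero_set)

text \<open>Dedekind's modular law, the source of the additivity of length.\<close>

lemma join_modular: "sm V \<Longrightarrow> sm W \<Longrightarrow> sm Y \<Longrightarrow> W \<subseteq> Y \<Longrightarrow> (V \<uplus> W) \<inter> Y = (V \<inter> Y) \<uplus> W"
proof
  assume as: "sm V" "sm W" "sm Y" "W \<subseteq> Y"
  show "(V \<uplus> W) \<inter> Y \<subseteq> (V \<inter> Y) \<uplus> W"
  proof
    fix u assume u: "u \<in> (V \<uplus> W) \<inter> Y"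
    then obtain v w where vw: "u = v +\<^sub>M w" "v \<in> V" "w \<in> W" by (auto elim: joinE)
    then have "v \<in> Y" using sm_addD1[of Y v w] as u sm_carrier by auto
    then show "u \<in> (V \<inter> Y) \<uplus> W" using vw by (auto intro: joinI)
  qed
  show "(V \<inter> Y) \<uplus> W \<subseteq> (V \<uplus> W) \<inter> Y"
    using as join_least[of Y "V \<inter> Y" W] join_mono[of "V \<inter> Y" V W W] by auto
qed

definition sc :: "'a \<Rightarrow> 'c set \<Rightarrow> 'c set" where "sc x V = (\<lambda>v. x *\<^sub>M v) ` V"

lemma scI: "v \<in> V \<Longrightarrow> x *\<^sub>M v \<in> sc x V"
  unfolding sc_def by blast

lemma sm_sc:
  assumes x: "x \<in> carrier R" and V: "sm V"
  shows "sm (sc x V)"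
proof (rule submoduleI)
  show "sc x V \<subseteq> carrier M" unfolding sc_def using x V sm_carrier by auto
  show "\<zero>\<^bsub>M\<^esub> \<in> sc x V" using scI[OF sm_zero[OF V], of x] x by simp
next
  fix u assume "u \<in> sc x V"
  then obtain v where v: "v \<in> V" "u = x *\<^sub>M v" unfolding sc_def by blast
  show "\<ominus>\<^bsub>M\<^esub> u \<in> sc x V"
    using scI[OF sm_neg[OF V v(1)], of x] x v sm_carrier[OF V] by (simp add: smult_r_minus)
  fix a assume "a \<in> carrier R"
  then show "a *\<^sub>M u \<in> sc x V"
    using scI[OF sm_smult[OF V _ v(1)], of a x] x v sm_carrier[OF V] by (simp add: smult_left_commute)
next
  fix u u' assume "u \<in> sc x V" "u' \<in> sc x V"
  then obtain v v' where v: "v \<in> V" "u = x *\<^sub>M v" "v' \<in> V" "u' = x *\<^sub>M v'" unfolding sc_def by blast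
  then show "u +\<^sub>M u' \<in> sc x V"
    using scI[OF sm_add[OF V v(1,3)], of x] x sm_carrier[OF V] by (simp add: smult_r_distr)
qed

lemma sc_mono: "V \<subseteq> W \<Longrightarrow> sc x V \<subseteq> sc x W"
  unfolding sc_def by blast

lemma sc_subset: "x \<in> carrier R \<Longrightarrow> sm V \<Longrightarrow> sc x V \<subseteq> V"
  unfolding sc_def using sm_smult by blast

lemma sc_sc: "x \<in> carrier R \<Longrightarrow> y \<in> carrier R \<Longrightarrow> sm V \<Longrightarrow> sc x (sc y V) = sc (x \<otimes> y) V"
  unfolding sc_def using sm_carrier[of V] by (force simp: smult_assoc1 image_iff)

lemma sc_commute: "x \<in> carrier R \<Longrightarrow> y \<in> carrier R \<Longrightarrow> sm V \<Longrightarrow> sc x (sc y V) = sc y (sc x V)"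
  by (simp add: sc_sc m_comm)

lemma sc_one: "sm V \<Longrightarrow> sc \<one> V = V"
  unfolding sc_def using sm_carrier[of V] by (force simp: image_iff)

lemma sc_zero_set: "x \<in> carrier R \<Longrightarrow> sc x {\<zero>\<^bsub>M\<^esub>} = {\<zero>\<^bsub>M\<^esub>}"
  unfolding sc_def by simp

lemma sc_join: "x \<in> carrier R \<Longrightarrow> sm V \<Longrightarrow> sm W \<Longrightarrow> sc x (V \<uplus> W) = sc x V \<uplus> sc x W"
proof (intro equalityI subsetI)
  assume as: "x \<in> carrier R" "sm V" "sm W"
  { fix u assume "u \<in> sc x (V \<uplus> W)"
    then obtain v w where "u = x *\<^sub>M (v +\<^sub>M w)" "v \<in> V" "w \<in> W" unfolding sc_def join_def by blast
    then show "u \<in> sc x V \<uplus> sc x W" using as sm_carrier by (simp add: smult_r_distr joinI scI) }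
  { fix u assume "u \<in> sc x V \<uplus> sc x W"
    then obtain v w where vw: "u = x *\<^sub>M v +\<^sub>M x *\<^sub>M w" "v \<in> V" "w \<in> W" unfolding sc_def join_def by blast
    then have "u = x *\<^sub>M (v +\<^sub>M w)" using as sm_carrier by (simp add: smult_r_distr)
    then show "u \<in> sc x (V \<uplus> W)" using vw by (simp add: joinI scI) }
qed

definition colon :: "'c set \<Rightarrow> 'a \<Rightarrow> 'c set" where
  "colon V x = {v \<in> carrier M. x *\<^sub>M v \<in> V}"

lemma sm_colon: "x \<in> carrier R \<Longrightarrow> sm V \<Longrightarrow> sm (colon V x)"
  unfolding colon_def
  by (rule submoduleI)
    (auto simp: sm_zero smult_r_minus sm_neg smult_r_distr sm_add smult_left_commute[of x] sm_smult)

lemma colon_mono: "V \<subseteq> W \<Longrightarrow> colon V x \<subseteq> colon W x"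
  unfolding colon_def by blast

text \<open>The adjunction between multiplication by \<open>x\<close> and the colon. When
  \<open>V\<close> is a generated submodule, the right-hand side can be checked on its
  generators.\<close>

lemma sc_le_iff: "sm V \<Longrightarrow> sc x V \<subseteq> W \<longleftrightarrow> V \<subseteq> colon W x"
  unfolding sc_def colon_def using sm_carrier[of V] by blast

lemma sm_span: "S \<subseteq> carrier M \<Longrightarrow> sm (module_span R M S)"
  unfolding module_span_def using sm_carrier_set by (intro sm_Inter) auto

lemma span_superset: "S \<subseteq> module_span R M S"
  unfolding module_span_def by blast

lemma span_least: "sm W \<Longrightarrow> S \<subseteq> W \<Longrightarrow> module_span R M S \<subseteq> W"
  unfolding module_span_def by blast

section \<open>Products and powers of ideals acting on submodules\<close>

definition act :: "'a set \<Rightarrow> 'c set \<Rightarrow> 'c set" where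
  "act J V = module_span R M {a *\<^sub>M v | a v. a \<in> J \<and> v \<in> V}"

lemma ideal_times_module_eq: "ideal_times_module R J M = act J (carrier M)"
  unfolding ideal_times_module_def act_def ..

lemma sm_act: "J \<subseteq> carrier R \<Longrightarrow> sm V \<Longrightarrow> sm (act J V)"
  unfolding act_def using sm_carrier[of V] by (intro sm_span) auto

lemma actI: "a \<in> J \<Longrightarrow> v \<in> V \<Longrightarrow> a *\<^sub>M v \<in> act J V"
  unfolding act_def by (rule subsetD[OF span_superset]) blast

lemma act_least:
  assumes "sm W" "\<And>a v. a \<in> J \<Longrightarrow> v \<in> V \<Longrightarrow> a *\<^sub>M v \<in> W"
  shows "act J V \<subseteq> W"
  unfolding act_def using assms(2) by (intro span_least[OF assms(1)]) auto

lemma act_mono: "J \<subseteq> carrier R \<Longrightarrow> sm V' \<Longrightarrow> V \<subseteq> V' \<Longrightarrow> act J V \<subseteq> act J V'"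
  by (rule act_least) (auto simp: sm_act intro: actI)

lemma act_mono1: "K \<subseteq> carrier R \<Longrightarrow> sm V \<Longrightarrow> J \<subseteq> K \<Longrightarrow> act J V \<subseteq> act K V"
  by (rule act_least) (auto simp: sm_act intro: actI)

lemma act_subset: "J \<subseteq> carrier R \<Longrightarrow> sm V \<Longrightarrow> act J V \<subseteq> V"
  by (rule act_least) (auto intro: sm_smult)

lemma sc_subset_act: "a \<in> J \<Longrightarrow> sc a V \<subseteq> act J V"
  unfolding sc_def by (auto intro: actI)

lemma act_join:
  assumes J: "J \<subseteq> carrier R" and V: "sm V" and W: "sm W"
  shows "act J (V \<uplus> W) = act J V \<uplus> act J W"
proof
  show "act J (V \<uplus> W) \<subseteq> act J V \<uplus> act J W"
  proof (rule act_least)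
    fix a u assume a: "a \<in> J" and "u \<in> V \<uplus> W"
    then obtain v w where "u = v +\<^sub>M w" "v \<in> V" "w \<in> W" by (auto elim: joinE)
    moreover have "a \<in> carrier R" using a J by blast
    ultimately show "a *\<^sub>M u \<in> act J V \<uplus> act J W"
      using a V W sm_carrier by (simp add: smult_r_distr joinI actI)
  qed (use assms in \<open>simp add: sm_join sm_act\<close>)
  show "act J V \<uplus> act J W \<subseteq> act J (V \<uplus> W)"
    using assms by (intro join_least act_mono sm_act sm_join join_upper1 join_upper2)
qed

lemma act_sc:
  assumes J: "J \<subseteq> carrier R" and x: "x \<in> carrier R" and V: "sm V"
  shows "act J (sc x V) = sc x (act J V)"
proof
  show "act J (sc x V) \<subseteq> sc x (act J V)"
  proof (rule act_least)
    fix a u assume a: "a \<in> J" and "u \<in> sc x V"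
    then obtain v where "v \<in> V" "u = x *\<^sub>M v" unfolding sc_def by blast
    then show "a *\<^sub>M u \<in> sc x (act J V)"
      using a J x sm_carrier[OF V] scI[OF actI[of a J v V], of x]
      by (simp add: smult_left_commute[of a x] subsetD)
  qed (use assms in \<open>simp add: sm_sc sm_act\<close>)
  have "act J V \<subseteq> colon (act J (sc x V)) x"
  proof (rule act_least)
    fix a v assume "a \<in> J" "v \<in> V"
    then show "a *\<^sub>M v \<in> colon (act J (sc x V)) x"
      unfolding colon_def using J x sm_carrier[OF V] actI[OF _ scI, of a J v V x]
      by (auto simp: smult_left_commute[of x a] subsetD)
  qed (use assms in \<open>simp add: sm_colon sm_sc sm_act\<close>)
  then show "sc x (act J V) \<subseteq> act J (sc x V)" using assms by (simp add: sc_le_iff sm_act)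
qed

lemma act_commute_le:
  assumes J: "J \<subseteq> carrier R" and K: "K \<subseteq> carrier R" and V: "sm V"
  shows "act J (act K V) \<subseteq> act K (act J V)"
proof -
  have *: "act K V \<subseteq> colon (act K (act J V)) a" if "a \<in> J" for a
  proof (rule act_least)
    fix k v assume "k \<in> K" "v \<in> V"
    then show "k *\<^sub>M v \<in> colon (act K (act J V)) a"
      unfolding colon_def using J K that sm_carrier[OF V] actI[OF _ actI, of k K a J v V]
      by (auto simp: smult_left_commute[of a k] subsetD)
  next
    show "sm (colon (act K (act J V)) a)" using assms that by (intro sm_colon sm_act) auto
  qed
  show ?thesis
  proof (rule act_least)
    show "sm (act K (act J V))" using assms by (intro sm_act)
    show "a *\<^sub>M u \<in> act K (act J V)" if "a \<in> J" "u \<in> act K V" for a u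
      using *[OF that(1)] that(2) unfolding colon_def by blast
  qed
qed

lemma act_commute:
  assumes "J \<subseteq> carrier R" "K \<subseteq> carrier R" "sm V"
  shows "act J (act K V) = act K (act J V)"
  using act_commute_le assms by blast

lemma ideal_into:
  assumes W: "sm W" and V: "V \<subseteq> carrier M"
  shows "ideal {a \<in> carrier R. \<forall>v\<in>V. a *\<^sub>M v \<in> W} R"
proof (rule idealI[OF R.ring_axioms])
  show "subgroup {a \<in> carrier R. \<forall>v\<in>V. a *\<^sub>M v \<in> W} (add_monoid R)"
    by (rule R.add.subgroupI)
      (use assms V in \<open>auto simp: smult_l_distr sm_add sm_zero subsetD smult_l_minus sm_neg
        simp flip: a_inv_def intro!: exI[of _ "\<zero>"]\<close>)
next
  fix a x assume ax: "a \<in> {a \<in> carrier R. \<forall>v\<in>V. a *\<^sub>M v \<in> W}" "x \<in> carrier R"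
  then show "x \<otimes> a \<in> {a \<in> carrier R. \<forall>v\<in>V. a *\<^sub>M v \<in> W}"
    using assms by (auto simp: smult_assoc1 subsetD sm_smult)
  then show "a \<otimes> x \<in> {a \<in> carrier R. \<forall>v\<in>V. a *\<^sub>M v \<in> W}"
    using ax by (simp add: m_comm)
qed

text \<open>The multipliers that carry \<open>V\<close> into \<open>W\<close> form an ideal, so it
  is enough to test the generators.\<close>

lemma act_genideal_least:
  assumes "S \<subseteq> carrier R" "sm V" "sm W" "\<And>g. g \<in> S \<Longrightarrow> sc g V \<subseteq> W"
  shows "act (Idl S) V \<subseteq> W"
proof -
  have "Idl S \<subseteq> {a \<in> carrier R. \<forall>v\<in>V. a *\<^sub>M v \<in> W}"
    using assms unfolding sc_def by (intro genideal_minimal ideal_into) (auto simp: sm_carrier)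
  then show ?thesis using assms by (intro act_least) auto
qed

primrec pw :: "'a set \<Rightarrow> nat \<Rightarrow> 'c set \<Rightarrow> 'c set" where
  "pw J 0 V = V"
| "pw J (Suc n) V = act J (pw J n V)"

lemma sm_pw: "J \<subseteq> carrier R \<Longrightarrow> sm V \<Longrightarrow> sm (pw J n V)"
  by (induction n) (auto simp: sm_act)

lemma pw_add: "pw J (m + n) V = pw J m (pw J n V)"
  by (induction m) auto

lemma pw_Suc2: "pw J (Suc n) V = pw J n (act J V)"
  using pw_add[of J n 1 V] by simp

lemma pw_subset: "J \<subseteq> carrier R \<Longrightarrow> sm V \<Longrightarrow> pw J n V \<subseteq> V"
proof (induction n)
  case (Suc n)
  then show ?case using act_subset[of J "pw J n V"] by (simp add: sm_pw)
qed simp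

lemma pw_antimono: "J \<subseteq> carrier R \<Longrightarrow> sm V \<Longrightarrow> m \<le> n \<Longrightarrow> pw J n V \<subseteq> pw J m V"
  using pw_subset[of J "pw J m V" "n - m"] pw_add[of J "n - m" m V] by (simp add: sm_pw)

lemma pw_mono: "J \<subseteq> carrier R \<Longrightarrow> sm V \<Longrightarrow> sm W \<Longrightarrow> V \<subseteq> W \<Longrightarrow> pw J n V \<subseteq> pw J n W"
  by (induction n) (simp_all add: act_mono sm_pw)

lemma pw_join: "J \<subseteq> carrier R \<Longrightarrow> sm V \<Longrightarrow> sm W \<Longrightarrow> pw J n (V \<uplus> W) = pw J n V \<uplus> pw J n W"
  by (induction n) (auto simp: sm_pw act_join)

lemma pw_sc: "J \<subseteq> carrier R \<Longrightarrow> x \<in> carrier R \<Longrightarrow> sm V \<Longrightarrow> pw J n (sc x V) = sc x (pw J n V)"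
  by (induction n) (auto simp: sm_pw act_sc)

lemma act_pw_commute: "J \<subseteq> carrier R \<Longrightarrow> K \<subseteq> carrier R \<Longrightarrow> sm V \<Longrightarrow> act J (pw K n V) = pw K n (act J V)"
proof (induction n)
  case (Suc n)
  then show ?case using act_commute[of J K "pw K n V"] by (simp add: sm_pw)
qed simp

lemma pw_commute: "J \<subseteq> carrier R \<Longrightarrow> K \<subseteq> carrier R \<Longrightarrow> sm V \<Longrightarrow> pw J m (pw K n V) = pw K n (pw J m V)"
  by (induction m) (auto simp: sm_pw act_pw_commute)

lemma act_pw: "J \<subseteq> carrier R \<Longrightarrow> sm V \<Longrightarrow> act J (pw J n V) = pw J n (act J V)"
  by (rule act_pw_commute)

lemma sc_pw: "x \<in> J \<Longrightarrow> sc x (pw J n V) \<subseteq> pw J (Suc n) V"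
  by (simp add: sc_subset_act)

lemma ideal_subset: "ideal J R \<Longrightarrow> J \<subseteq> carrier R"
  by (rule subsetI) (rule ideal.Icarr)

text \<open>Powers are computed below by iterating \<open>act\<close>, which stays inside the
  submodules of \<open>M\<close>; this is the bridge to powers in the monoid of ideals. There the
  new factor stands on the right, so the commutation of \<open>act\<close> is needed. That the power
  is an ideal is carried along for the induction.\<close>

lemma ideal_power_times_module:
  assumes "ideal J R"
  shows "ideal_times_module R (ideal_power R J n) M = pw J n (carrier M) \<and> ideal (ideal_power R J n) R"
proof (induction n)
  case 0
  have "act (carrier R) (carrier M) = carrier M"
    using act_subset[of "carrier R" "carrier M"] actI[of \<one> "carrier R" _ "carrier M"] sm_carrier_set
    by force
  then show ?case
    by (simp add: ideal_times_module_eq ideals_set_def oneideal)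
next
  case (Suc n)
  let ?P = "ideal_power R J n"
  have P: "ideal ?P R" and IH: "act ?P (carrier M) = pw J n (carrier M)"
    using Suc[unfolded ideal_times_module_eq] by (rule conjunct2, rule conjunct1)
  have J: "J \<subseteq> carrier R" and Pc: "?P \<subseteq> carrier R"
    using ideal_subset assms P by simp_all
  have eq: "ideal_power R J (Suc n) = ideal_prod R ?P J"
    by (simp add: ideals_set_def)
  have PJ: "ideal (ideal_prod R ?P J) R" using ideal_prod_is_ideal[OF P assms] .
  then have PJc: "ideal_prod R ?P J \<subseteq> carrier R" by (rule ideal_subset)
  have "act (ideal_prod R ?P J) (carrier M) = act ?P (act J (carrier M))"
  proof
    let ?W = "act ?P (act J (carrier M))"
    have W: "sm ?W" using J Pc by (simp add: sm_act sm_carrier_set)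
    have "ideal_prod R ?P J \<subseteq> {a \<in> carrier R. \<forall>v\<in>carrier M. a *\<^sub>M v \<in> ?W}"
    proof -
      have id: "ideal {a \<in> carrier R. \<forall>v\<in>carrier M. a *\<^sub>M v \<in> ?W} R"
        using W by (intro ideal_into) auto
      have "x \<in> {a \<in> carrier R. \<forall>v\<in>carrier M. a *\<^sub>M v \<in> ?W}" if "x \<in> ideal_prod R ?P J" for x
        using that
      proof induction
        case (prod i j)
        then show ?case using J Pc actI[OF _ actI, of i ?P j J _ "carrier M"]
          by (auto simp: smult_assoc1 subsetD)
      next
        case (sum a b)
        then show ?case using additive_subgroup.a_closed[OF ideal.axioms(1)[OF id]] by blast
      qed
      then show ?thesis by blast
    qed
    then show "act (ideal_prod R ?P J) (carrier M) \<subseteq> ?W" using W by (intro act_least) auto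
    show "?W \<subseteq> act (ideal_prod R ?P J) (carrier M)"
    proof -
      have s: "sm (act (ideal_prod R ?P J) (carrier M))" using PJc by (simp add: sm_act sm_carrier_set)
      have *: "act J (carrier M) \<subseteq> colon (act (ideal_prod R ?P J) (carrier M)) i" if "i \<in> ?P" for i
      proof (rule act_least)
        fix j v assume "j \<in> J" "v \<in> carrier M"
        then show "j *\<^sub>M v \<in> colon (act (ideal_prod R ?P J) (carrier M)) i"
          unfolding colon_def using J Pc that actI[OF ideal_prod.prod[OF that], of j J v "carrier M" R]
          by (auto simp: smult_assoc1 subsetD)
      next
        show "sm (colon (act (ideal_prod R ?P J) (carrier M)) i)" using s that Pc by (intro sm_colon) auto
      qed
      show ?thesis
      proof (rule act_least[OF s])
        show "a *\<^sub>M u \<in> act (ideal_prod R ?P J) (carrier M)" if "a \<in> ?P" "u \<in> act J (carrier M)" for a u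
          using *[OF that(1)] that(2) unfolding colon_def by blast
      qed
    qed
  qed
  also have "\<dots> = pw J (Suc n) (carrier M)"
    using IH act_commute[OF Pc J sm_carrier_set] by simp
  finally show ?case using eq PJ by (simp add: ideal_times_module_eq)
qed

end

section \<open>Length\<close>

context module
begin

text \<open>The length of \<open>V / W\<close>, read off from the submodules in between, so that no
  quotient has to be formed.\<close>

definition len :: "'c set \<Rightarrow> 'c set \<Rightarrow> enat" where
  "len W V = chain_sup {N. sm N \<and> W \<subseteq> N \<and> N \<subseteq> V}"

lemma len_add_ge:
  assumes "sm W" "sm Y" "sm V" "W \<subseteq> Y" "Y \<subseteq> V"
  shows "len W Y + len Y V \<le> len W V"
  unfolding len_def using assms by (intro chain_sup_add_le) auto

lemma len_mono: "V \<subseteq> V' \<Longrightarrow> len W V \<le> len W V'"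
  unfolding len_def by (rule chain_sup_map[where f = id]) auto

lemma len_antimono: "W \<subseteq> W' \<Longrightarrow> len W' V \<le> len W V"
  unfolding len_def by (rule chain_sup_map[where f = id]) auto

lemma len_pos:
  assumes "sm W" "sm V" "W \<subset> V"
  shows "1 \<le> len W V"
proof -
  have "enat 1 \<le> len W V" unfolding len_def
    by (rule chain_sup_ge[where C = "\<lambda>i. if i = 0 then W else V"]) (use assms in auto)
  then show ?thesis by (simp add: one_enat_def)
qed

lemma len_self: "len W W = 0"
proof -
  have "len W W \<le> enat 0" unfolding len_def
  proof (rule chain_sup_le)
    fix n :: nat and C assume C: "\<And>i. i \<le> n \<Longrightarrow> C i \<in> {N. sm N \<and> W \<subseteq> N \<and> N \<subseteq> W}"
      and s: "\<And>i. i < n \<Longrightarrow> C i \<subset> C (Suc i)"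
    have "n = 0"
    proof (rule ccontr)
      assume "n \<noteq> 0"
      then have "C 0 \<subset> C (Suc 0)" "C 0 = W" "C (Suc 0) = W" using s[of 0] C[of 0] C[of 1] by auto
      then show False by simp
    qed
    then show "enat n \<le> enat 0" by simp
  qed
  then show ?thesis by (simp add: zero_enat_def[symmetric])
qed

lemma len_strict_mono:
  assumes "sm W" "sm V" "sm V'" "W \<subseteq> V" "V \<subset> V'"
  shows "len W V + 1 \<le> len W V'"
proof -
  have "len W V + 1 \<le> len W V + len V V'" using len_pos[of V V'] assms by (intro add_left_mono)
  also have "\<dots> \<le> len W V'" using assms by (intro len_add_ge) auto
  finally show ?thesis .
qed

text \<open>Along a chain from \<open>W\<close> to \<open>V\<close>, each strict step is strict in the intersections with \<open>Y\<close> or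
  in the sums with \<open>Y\<close>, by modularity.\<close>

lemma len_add_le:
  assumes "sm W" "sm Y" "sm V" "W \<subseteq> Y" "Y \<subseteq> V"
  shows "len W V \<le> len W Y + len Y V"
  unfolding len_def[of W V]
proof (rule chain_sup_le)
  fix n :: nat and C assume C: "\<And>i. i \<le> n \<Longrightarrow> C i \<in> {N. sm N \<and> W \<subseteq> N \<and> N \<subseteq> V}"
    and s: "\<And>i. i < n \<Longrightarrow> C i \<subset> C (Suc i)"
  have "i \<le> n \<Longrightarrow> enat i \<le> len W (C i \<inter> Y) + len Y (C i \<uplus> Y)" for i
  proof (induction i)
    case 0
    then show ?case by (simp add: zero_enat_def[symmetric])
  next
    case (Suc i)
    let ?C = "C i" and ?D = "C (Suc i)"
    have c: "sm ?C" "sm ?D" "W \<subseteq> ?C" "W \<subseteq> ?D" "?C \<subset> ?D"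
      using C[of i] C[of "Suc i"] s[of i] Suc.prems by auto
    have cY: "sm (?C \<inter> Y)" "sm (?D \<inter> Y)" "sm (?C \<uplus> Y)" "sm (?D \<uplus> Y)"
      using c assms by (simp_all add: sm_Int sm_join)
    have m: "len W (?C \<inter> Y) \<le> len W (?D \<inter> Y)" "len Y (?C \<uplus> Y) \<le> len Y (?D \<uplus> Y)"
      using c(5) by (intro len_mono join_mono Int_mono order_refl; blast)+
    have IH: "enat i \<le> len W (?C \<inter> Y) + len Y (?C \<uplus> Y)" using Suc by simp
    have "?C \<inter> Y \<noteq> ?D \<inter> Y \<or> ?C \<uplus> Y \<noteq> ?D \<uplus> Y"
    proof (rule ccontr)
      assume "\<not> ?thesis"
      then have e: "?C \<inter> Y = ?D \<inter> Y" "?C \<uplus> Y = ?D \<uplus> Y" by auto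
      have "?D = (?C \<uplus> Y) \<inter> ?D" using e(2) join_upper1[of ?D Y] c assms by auto
      also have "\<dots> = (Y \<uplus> ?C) \<inter> ?D" using join_commute c assms by simp
      also have "\<dots> = (Y \<inter> ?D) \<uplus> ?C" using c assms by (intro join_modular) auto
      also have "\<dots> \<subseteq> ?C" using c e(1) by (intro join_least) auto
      finally show False using c by blast
    qed
    then show ?case
    proof
      assume "?C \<inter> Y \<noteq> ?D \<inter> Y"
      then have "?C \<inter> Y \<subset> ?D \<inter> Y" using c(5) by auto
      then have "len W (?C \<inter> Y) + 1 \<le> len W (?D \<inter> Y)"
        using len_strict_mono[OF assms(1) cY(1,2)] c assms by simp
      then have "(len W (?C \<inter> Y) + 1) + len Y (?C \<uplus> Y) \<le> len W (?D \<inter> Y) + len Y (?D \<uplus> Y)"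
        using m(2) by (rule add_mono)
      moreover have "enat (Suc i) \<le> (len W (?C \<inter> Y) + 1) + len Y (?C \<uplus> Y)"
        using add_right_mono[OF IH, of 1] by (simp add: eSuc_enat[symmetric] eSuc_plus_1 ac_simps)
      ultimately show ?thesis by (rule order_trans[rotated])
    next
      assume "?C \<uplus> Y \<noteq> ?D \<uplus> Y"
      then have "?C \<uplus> Y \<subset> ?D \<uplus> Y" using c(5) join_mono[of ?C ?D Y Y] by auto
      then have "len Y (?C \<uplus> Y) + 1 \<le> len Y (?D \<uplus> Y)"
        using len_strict_mono[OF assms(2) cY(3,4)] c assms join_upper2 by simp
      then have "len W (?C \<inter> Y) + (len Y (?C \<uplus> Y) + 1) \<le> len W (?D \<inter> Y) + len Y (?D \<uplus> Y)"
        using m(1) by (intro add_mono)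
      moreover have "enat (Suc i) \<le> len W (?C \<inter> Y) + (len Y (?C \<uplus> Y) + 1)"
        using add_right_mono[OF IH, of 1] by (simp add: eSuc_enat[symmetric] eSuc_plus_1 ac_simps)
      ultimately show ?thesis by (rule order_trans[rotated])
    qed
  qed
  from this[of n] have "enat n \<le> len W (C n \<inter> Y) + len Y (C n \<uplus> Y)" by simp
  also have "\<dots> \<le> len W Y + len Y V"
    using C[of n] assms by (intro add_mono len_mono join_least) auto
  finally show "enat n \<le> len W Y + len Y V" .
qed

lemma len_add:
  assumes "sm W" "sm Y" "sm V" "W \<subseteq> Y" "Y \<subseteq> V"
  shows "len W V = len W Y + len Y V"
  using len_add_le[OF assms] len_add_ge[OF assms] by (rule order_antisym)

text \<open>Multiplication by \<open>x\<close> induces an isomorphism from \<open>V\<close> modulo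
  \<open>V \<inter> colon Z x\<close> onto \<open>sc x V \<uplus> Z\<close> modulo \<open>Z\<close>.
  On submodules it becomes two strictly monotone maps, one in each direction, which is all that a
  comparison of chains requires.\<close>

lemma len_sc:
  assumes x: "x \<in> carrier R" and V: "sm V" and Z: "sm Z"
  shows "len Z (sc x V \<uplus> Z) = len (V \<inter> colon Z x) V"
proof (rule order_antisym)
  show "len Z (sc x V \<uplus> Z) \<le> len (V \<inter> colon Z x) V"
    unfolding len_def
  proof (rule chain_sup_map[where f = "\<lambda>N. V \<inter> colon N x"])
    show "V \<inter> colon N x \<in> {N. sm N \<and> V \<inter> colon Z x \<subseteq> N \<and> N \<subseteq> V}"
      if "N \<in> {N. sm N \<and> Z \<subseteq> N \<and> N \<subseteq> sc x V \<uplus> Z}" for N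
    proof -
      have "sm (V \<inter> colon N x)" using that x V by (intro sm_Int sm_colon) auto
      moreover have "colon Z x \<subseteq> colon N x" using that by (intro colon_mono) auto
      ultimately show ?thesis by blast
    qed
    fix N N' assume N: "N \<in> {N. sm N \<and> Z \<subseteq> N \<and> N \<subseteq> sc x V \<uplus> Z}"
      and N': "N' \<in> {N. sm N \<and> Z \<subseteq> N \<and> N \<subseteq> sc x V \<uplus> Z}" and "N \<subset> N'"
    then obtain n where n: "n \<in> N'" "n \<notin> N" by blast
    then obtain v z where vz: "n = x *\<^sub>M v +\<^sub>M z" "v \<in> V" "z \<in> Z"
      using N' unfolding join_def sc_def by auto
    have "x *\<^sub>M v \<in> N'" using sm_addD1[of N' "x *\<^sub>M v" z] N' n vz x sm_carrier[OF V] by auto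
    moreover have "x *\<^sub>M v \<notin> N" using sm_add[of N "x *\<^sub>M v" z] N n vz by auto
    ultimately have "v \<in> V \<inter> colon N' x" "v \<notin> V \<inter> colon N x"
      using vz sm_carrier[OF V] by (auto simp: colon_def)
    then show "V \<inter> colon N x \<subset> V \<inter> colon N' x" using \<open>N \<subset> N'\<close> by (auto simp: colon_def)
  qed
  show "len (V \<inter> colon Z x) V \<le> len Z (sc x V \<uplus> Z)"
    unfolding len_def
  proof (rule chain_sup_map[where f = "\<lambda>N. sc x N \<uplus> Z"])
    show "sc x N \<uplus> Z \<in> {N. sm N \<and> Z \<subseteq> N \<and> N \<subseteq> sc x V \<uplus> Z}"
      if "N \<in> {N. sm N \<and> V \<inter> colon Z x \<subseteq> N \<and> N \<subseteq> V}" for N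
      using that x V Z join_upper2[of "sc x N" Z] join_mono[OF sc_mono[of N V x], of Z Z]
      by (simp add: sm_join sm_sc)
    fix N N' assume N: "N \<in> {N. sm N \<and> V \<inter> colon Z x \<subseteq> N \<and> N \<subseteq> V}"
      and N': "N' \<in> {N. sm N \<and> V \<inter> colon Z x \<subseteq> N \<and> N \<subseteq> V}" and "N \<subset> N'"
    then obtain n where n: "n \<in> N'" "n \<notin> N" "n \<in> V" by blast
    have "x *\<^sub>M n \<in> sc x N' \<uplus> Z" using join_upper1[of "sc x N'" Z] scI[OF n(1)] x Z N' by (auto simp: sm_sc)
    moreover have "x *\<^sub>M n \<notin> sc x N \<uplus> Z"
    proof
      assume "x *\<^sub>M n \<in> sc x N \<uplus> Z"
      then obtain p z where pz: "x *\<^sub>M n = x *\<^sub>M p +\<^sub>M z" "p \<in> N" "z \<in> Z"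
        unfolding join_def sc_def by auto
      have c: "n \<in> carrier M" "p \<in> carrier M" "z \<in> carrier M"
        using n pz N V Z sm_carrier by auto
      have "x *\<^sub>M (n -\<^sub>M p) = z"
        using c x pz(1) by (simp add: smult_diff) (simp add: a_minus_def M.a_ac M.r_neg1 M.r_neg2 M.r_neg)
      then have "n -\<^sub>M p \<in> V \<inter> colon Z x"
        using n pz N c sm_diff[OF V] by (auto simp: colon_def)
      then have "n -\<^sub>M p \<in> N" using N by auto
      then have "n \<in> N" using sm_diffD[of N n p] N c pz by auto
      with n show False by simp
    qed
    ultimately show "sc x N \<uplus> Z \<subset> sc x N' \<uplus> Z" using join_mono[OF sc_mono, of N N' Z Z x] \<open>N \<subset> N'\<close> by auto
  qed
qed

section \<open>Quotient modules and regular sequences\<close>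

lemma coset_mem:
  assumes "sm N" "v \<in> carrier M"
  shows "u \<in> N +>\<^bsub>M\<^esub> v \<longleftrightarrow> u \<in> carrier M \<and> u -\<^sub>M v \<in> N"
proof
  assume "u \<in> N +>\<^bsub>M\<^esub> v"
  then obtain n where n: "n \<in> N" "u = n +\<^sub>M v" unfolding a_r_coset_def' by blast
  then show "u \<in> carrier M \<and> u -\<^sub>M v \<in> N"
    using assms sm_carrier[OF assms(1)] by (simp add: a_minus_def M.a_assoc M.r_neg)
next
  assume "u \<in> carrier M \<and> u -\<^sub>M v \<in> N"
  moreover from this have "u = (u -\<^sub>M v) +\<^sub>M v" using assms diff_add_cancel by simp
  ultimately show "u \<in> N +>\<^bsub>M\<^esub> v" unfolding a_r_coset_def' by blast
qed

lemma sm_abelian_subgroup: "sm N \<Longrightarrow> abelian_subgroup N M"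
  using submodule.axioms(1) M.abelian_group_axioms
  by (intro abelian_subgroupI3 additive_subgroup.intro) auto

lemma coset_eq:
  assumes "sm N" "u \<in> carrier M" "v \<in> carrier M"
  shows "N +>\<^bsub>M\<^esub> u = N +>\<^bsub>M\<^esub> v \<longleftrightarrow> u -\<^sub>M v \<in> N"
proof
  assume "N +>\<^bsub>M\<^esub> u = N +>\<^bsub>M\<^esub> v"
  moreover have "u \<in> N +>\<^bsub>M\<^esub> u" using assms sm_zero by (simp add: coset_mem a_minus_def M.r_neg)
  ultimately show "u -\<^sub>M v \<in> N" using assms by (simp add: coset_mem)
next
  assume d: "u -\<^sub>M v \<in> N"
  have "w -\<^sub>M u \<in> N \<longleftrightarrow> w -\<^sub>M v \<in> N" if w: "w \<in> carrier M" for w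
  proof -
    have e: "w -\<^sub>M v = (w -\<^sub>M u) +\<^sub>M (u -\<^sub>M v)"
      using w assms by (simp add: a_minus_def M.a_ac M.r_neg1 M.r_neg2)
    show ?thesis using e d assms w sm_add[of N "w -\<^sub>M u" "u -\<^sub>M v"] sm_addD1[of N "w -\<^sub>M u" "u -\<^sub>M v"]
      by auto
  qed
  then show "N +>\<^bsub>M\<^esub> u = N +>\<^bsub>M\<^esub> v" using assms by (auto simp: coset_mem)
qed

lemma coset_self: "sm N \<Longrightarrow> v \<in> N \<Longrightarrow> N +>\<^bsub>M\<^esub> v = N"
  using coset_eq[of N v "\<zero>\<^bsub>M\<^esub>"] sm_carrier[of N] M.a_coset_add_zero sm_subset[of N] sm_diff[of N v "\<zero>\<^bsub>M\<^esub>"] by (simp add: sm_zero)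

lemma quotient_smult:
  assumes "sm N" "v \<in> carrier M" "a \<in> carrier R"
  shows "a \<odot>\<^bsub>quotient_module M N\<^esub> (N +>\<^bsub>M\<^esub> v) = N +>\<^bsub>M\<^esub> (a *\<^sub>M v)"
proof -
  have c: "N +>\<^bsub>M\<^esub> (a *\<^sub>M u) = N +>\<^bsub>M\<^esub> (a *\<^sub>M v)" if "u \<in> N +>\<^bsub>M\<^esub> v" for u
    using that assms sm_smult[of N a "u -\<^sub>M v"]
    by (subst coset_eq) (auto simp: coset_mem smult_diff[symmetric])
  have v: "v \<in> N +>\<^bsub>M\<^esub> v" using assms sm_zero by (simp add: coset_mem a_minus_def M.r_neg)
  have "(\<Union>u\<in>N +>\<^bsub>M\<^esub> v. N +>\<^bsub>M\<^esub> (a *\<^sub>M u)) = (\<Union>u\<in>N +>\<^bsub>M\<^esub> v. N +>\<^bsub>M\<^esub> (a *\<^sub>M v))"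
    by (rule SUP_cong) (simp_all add: c)
  also have "\<dots> = N +>\<^bsub>M\<^esub> (a *\<^sub>M v)" using v by blast
  finally show ?thesis unfolding quotient_module_def by simp
qed

lemma quotient_add:
  assumes "sm N" "u \<in> carrier M" "v \<in> carrier M"
  shows "(N +>\<^bsub>M\<^esub> u) \<oplus>\<^bsub>quotient_module M N\<^esub> (N +>\<^bsub>M\<^esub> v) = N +>\<^bsub>M\<^esub> (u +\<^sub>M v)"
  unfolding quotient_module_def
  using abelian_subgroup.a_rcos_sum[OF sm_abelian_subgroup[OF assms(1)] assms(2,3)] by simp

lemma quotient_carrier: "carrier (quotient_module M N) = (\<lambda>v. N +>\<^bsub>M\<^esub> v) ` carrier M"
  unfolding quotient_module_def by (auto simp: A_RCOSETS_def')

lemma quotient_group: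
  assumes "sm N"
  shows "group (add_monoid (quotient_module M N))"
proof -
  have "group (M A_Mod N)"
    using abelian_subgroup.a_factorgroup_is_comm_group[OF sm_abelian_subgroup[OF assms]]
    by (simp add: comm_group.axioms(2))
  then show ?thesis
    unfolding quotient_module_def A_FactGroup_def FactGroup_def A_RCOSETS_def set_add_def
    by (simp add: group_def monoid_def group_axioms_def Units_def)
qed

lemma submodule_of_quotient:
  assumes N: "sm N" and Q: "submodule Q R (quotient_module M N)"
  shows "sm {v \<in> carrier M. N +>\<^bsub>M\<^esub> v \<in> Q}" "N \<subseteq> {v \<in> carrier M. N +>\<^bsub>M\<^esub> v \<in> Q}"
proof -
  let ?P = "{v \<in> carrier M. N +>\<^bsub>M\<^esub> v \<in> Q}"
  have g: "subgroup Q (add_monoid (quotient_module M N))" using Q by (rule submodule.axioms)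
  have zero: "N \<in> Q" using subgroup.one_closed[OF g] by (simp add: quotient_module_def)
  have smul: "a *\<^sub>M v \<in> ?P" if "a \<in> carrier R" "v \<in> ?P" for a v
    using submodule.smult_closed[OF Q that(1), of "N +>\<^bsub>M\<^esub> v"] that N quotient_smult[of N v a] by auto
  show "N \<subseteq> ?P" using zero coset_self[OF N] sm_carrier[OF N] by auto
  show "sm ?P"
  proof (rule submoduleI)
    show "\<zero>\<^bsub>M\<^esub> \<in> ?P" using zero coset_self[OF N sm_zero[OF N]] by simp
    show "\<ominus>\<^bsub>M\<^esub> v \<in> ?P" if "v \<in> ?P" for v
      using smul[of "\<ominus> \<one>" v] that by (simp add: smult_l_minus)
    show "u +\<^sub>M v \<in> ?P" if "u \<in> ?P" "v \<in> ?P" for u v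
      using subgroup.m_closed[OF g, of "N +>\<^bsub>M\<^esub> u" "N +>\<^bsub>M\<^esub> v"] that quotient_add[OF N, of u v] by simp
  qed (use smul in auto)
qed

lemma submodule_to_quotient:
  assumes N: "sm N" and P: "sm P"
  shows "submodule ((\<lambda>v. N +>\<^bsub>M\<^esub> v) ` P) R (quotient_module M N)"
proof (intro submodule.intro subgroup.intro submodule_axioms.intro)
  let ?Q = "quotient_module M N" and ?c = "\<lambda>v. N +>\<^bsub>M\<^esub> v"
  show "?c ` P \<subseteq> carrier (add_monoid ?Q)" using quotient_carrier sm_subset[OF P] by auto
  show "x \<otimes>\<^bsub>add_monoid ?Q\<^esub> y \<in> ?c ` P" if "x \<in> ?c ` P" "y \<in> ?c ` P" for x y
  proof -
    obtain u v where uv: "x = ?c u" "y = ?c v" "u \<in> P" "v \<in> P" using \<open>x \<in> _\<close> \<open>y \<in> _\<close> by blast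
    then have "x \<oplus>\<^bsub>?Q\<^esub> y = ?c (u +\<^sub>M v)" using quotient_add[OF N] sm_carrier[OF P] by simp
    then show ?thesis using uv sm_add[OF P] by auto
  qed
  have zero: "\<one>\<^bsub>add_monoid ?Q\<^esub> = N" by (simp add: quotient_module_def)
  show "\<one>\<^bsub>add_monoid ?Q\<^esub> \<in> ?c ` P"
    using zero coset_self[OF N sm_zero[OF N]] sm_zero[OF P] by (metis image_eqI)
  show "inv\<^bsub>add_monoid ?Q\<^esub> x \<in> ?c ` P" if "x \<in> ?c ` P" for x
  proof -
    obtain u where u: "x = ?c u" "u \<in> P" using \<open>x \<in> _\<close> by blast
    then have uc: "u \<in> carrier M" using sm_carrier[OF P] by simp
    have "?c (\<ominus>\<^bsub>M\<^esub> u) \<oplus>\<^bsub>?Q\<^esub> ?c u = ?c (\<ominus>\<^bsub>M\<^esub> u +\<^sub>M u)" using uc by (intro quotient_add N) auto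
    then have "?c (\<ominus>\<^bsub>M\<^esub> u) \<otimes>\<^bsub>add_monoid ?Q\<^esub> ?c u = \<one>\<^bsub>add_monoid ?Q\<^esub>"
      using uc zero coset_self[OF N sm_zero[OF N]] by (simp add: M.l_neg)
    then have "inv\<^bsub>add_monoid ?Q\<^esub> (?c u) = ?c (\<ominus>\<^bsub>M\<^esub> u)"
      using uc quotient_carrier by (intro group.inv_equality[OF quotient_group[OF N]]) auto
    then show ?thesis using u sm_neg[OF P] by auto
  qed
  show "a \<odot>\<^bsub>?Q\<^esub> x \<in> ?c ` P" if "a \<in> carrier R" "x \<in> ?c ` P" for a x
  proof -
    obtain u where u: "x = ?c u" "u \<in> P" using \<open>x \<in> _\<close> by blast
    then show ?thesis using quotient_smult[OF N, of u a] sm_carrier[OF P] sm_smult[OF P] that by auto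
  qed
qed

text \<open>The correspondence of submodules, given as preimage and image under the projection. From
  here on \<open>len\<close> replaces the length of the quotient record.\<close>

lemma module_length_quotient:
  assumes N: "sm N"
  shows "module_length R (quotient_module M N) = len N (carrier M)"
proof (rule order_antisym)
  let ?c = "\<lambda>v. N +>\<^bsub>M\<^esub> v"
  show "module_length R (quotient_module M N) \<le> len N (carrier M)"
    unfolding module_length_def len_def
  proof (rule chain_sup_map[where f = "\<lambda>Q. {v \<in> carrier M. ?c v \<in> Q}"])
    fix Q Q' assume Q: "Q \<in> {Q. submodule Q R (quotient_module M N)}"
      and Q': "Q' \<in> {Q. submodule Q R (quotient_module M N)}" and "Q \<subset> Q'"
    have "Q' \<subseteq> ?c ` carrier M"
      using Q' subgroup.subset[OF submodule.axioms(1)[of Q' R "quotient_module M N"]] quotient_carrier by simp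
    then obtain v where "v \<in> carrier M" "?c v \<in> Q'" "?c v \<notin> Q" using \<open>Q \<subset> Q'\<close> by blast
    then show "{v \<in> carrier M. ?c v \<in> Q} \<subset> {v \<in> carrier M. ?c v \<in> Q'}" using \<open>Q \<subset> Q'\<close> by blast
  qed (use submodule_of_quotient[OF N] in auto)
  show "len N (carrier M) \<le> module_length R (quotient_module M N)"
    unfolding module_length_def len_def
  proof (rule chain_sup_map[where f = "\<lambda>P. ?c ` P"])
    fix P P' assume P: "P \<in> {P. sm P \<and> N \<subseteq> P \<and> P \<subseteq> carrier M}"
      and P': "P' \<in> {P. sm P \<and> N \<subseteq> P \<and> P \<subseteq> carrier M}" and "P \<subset> P'"
    then obtain v where v: "v \<in> P'" "v \<notin> P" by blast
    have "?c v \<notin> ?c ` P"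
    proof
      assume "?c v \<in> ?c ` P"
      then obtain p where p: "p \<in> P" "?c v = ?c p" by blast
      moreover have "v \<in> carrier M" "p \<in> carrier M" using v p P P' by auto
      ultimately have "v -\<^sub>M p \<in> P" using coset_eq[OF N, of v p] P by auto
      then show False using sm_diffD[of P v p] P P' p v by auto
    qed
    then show "?c ` P \<subset> ?c ` P'" using v \<open>P \<subset> P'\<close> by blast
  qed (use submodule_to_quotient[OF N] in auto)
qed

section \<open>Regular elements modulo a submodule\<close>

definition reg :: "'c set \<Rightarrow> 'a \<Rightarrow> bool" where
  "reg U x \<longleftrightarrow> (\<forall>v\<in>carrier M. x *\<^sub>M v \<in> U \<longrightarrow> v \<in> U)"

lemma regD: "reg U x \<Longrightarrow> v \<in> carrier M \<Longrightarrow> x *\<^sub>M v \<in> U \<Longrightarrow> v \<in> U"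
  unfolding reg_def by blast

lemma nonzerodivisor_on_quotient:
  assumes U: "sm U" and x: "x \<in> carrier R" and nzd: "nonzerodivisor_on (quotient_module M U) x"
  shows "reg U x"
  unfolding reg_def
proof (intro ballI impI)
  fix v assume v: "v \<in> carrier M" "x *\<^sub>M v \<in> U"
  have "x \<odot>\<^bsub>quotient_module M U\<^esub> (U +>\<^bsub>M\<^esub> v) = U"
    using quotient_smult[OF U v(1) x] coset_self[OF U v(2)] by simp
  moreover have "U +>\<^bsub>M\<^esub> v \<in> carrier (quotient_module M U)" using quotient_carrier v by auto
  moreover have "\<zero>\<^bsub>quotient_module M U\<^esub> = U" by (simp add: quotient_module_def)
  ultimately have "U +>\<^bsub>M\<^esub> v = U" using nzd unfolding nonzerodivisor_on_def by simp
  moreover have "v \<in> U +>\<^bsub>M\<^esub> v" using U v sm_zero by (simp add: coset_mem a_minus_def M.r_neg)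
  ultimately show "v \<in> U" by simp
qed

text \<open>\<open>dp J k U\<close> says that \<open>J\<close> contains a regular sequence of length \<open>k\<close> on \<open>M / U\<close>.\<close>

primrec dp :: "'a set \<Rightarrow> nat \<Rightarrow> 'c set \<Rightarrow> bool" where
  "dp J 0 U \<longleftrightarrow> U \<noteq> carrier M"
| "dp J (Suc k) U \<longleftrightarrow> (\<exists>x\<in>J. reg U x \<and> dp J k (U \<uplus> sc x (carrier M)))"

lemma genideal_insert_times:
  assumes S: "S \<subseteq> carrier R" and x: "x \<in> carrier R"
  shows "act (Idl (insert x S)) (carrier M) = act (Idl S) (carrier M) \<uplus> sc x (carrier M)"
proof
  have iS: "Idl S \<subseteq> carrier R" "Idl (insert x S) \<subseteq> carrier R" "Idl S \<subseteq> Idl (insert x S)"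
    using S x genideal_ideal ideal_subset genideal_self[of "insert x S"] genideal_minimal[of "Idl (insert x S)" S]
    by auto
  have m: "sm (act (Idl S) (carrier M))" "sm (sc x (carrier M))" "sm (act (Idl (insert x S)) (carrier M))"
    using iS x by (simp_all add: sm_act sm_sc sm_carrier_set)
  show "act (Idl (insert x S)) (carrier M) \<subseteq> act (Idl S) (carrier M) \<uplus> sc x (carrier M)"
  proof (rule act_genideal_least)
    fix g assume "g \<in> insert x S"
    then show "sc g (carrier M) \<subseteq> act (Idl S) (carrier M) \<uplus> sc x (carrier M)"
      using join_upper1[OF m(1,2)] join_upper2[OF m(1,2)] sc_subset_act[of g "Idl S" "carrier M"]
        genideal_self[OF S] by blast
  qed (use S x m in \<open>auto simp: sm_join sm_carrier_set\<close>)
  have "x \<in> Idl (insert x S)" using genideal_self[of "insert x S"] S x by auto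
  then show "act (Idl S) (carrier M) \<uplus> sc x (carrier M) \<subseteq> act (Idl (insert x S)) (carrier M)"
    using iS m by (intro join_least act_mono1 sc_subset_act sm_carrier_set)
qed

lemma regular_sequence_dp:
  assumes reg: "regular_sequence R M xs" and J: "set xs \<subseteq> J"
  shows "dp J (length xs) {\<zero>\<^bsub>M\<^esub>}"
proof -
  let ?U = "\<lambda>i. act (Idl (set (take i xs))) (carrier M)"
  have c: "set xs \<subseteq> carrier R" using reg unfolding regular_sequence_def by blast
  have tc: "set (take i xs) \<subseteq> carrier R" for i using c set_take_subset[of i xs] by blast
  have smU: "sm (?U i)" for i
    by (intro sm_act ideal_subset genideal_ideal tc sm_carrier_set)
  \<comment> \<open>Induction on the number of remaining elements, because \<open>dp\<close> splits
    off the first element and leaves the tail to the quotient.\<close>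
  have "j \<le> length xs \<Longrightarrow> dp J j (?U (length xs - j))" for j
  proof (induction j)
    case 0
    then show ?case using reg unfolding regular_sequence_def ideal_times_module_eq by simp
  next
    case (Suc j)
    let ?i = "length xs - Suc j"
    have i: "?i < length xs" "Suc ?i = length xs - j" using Suc.prems by auto
    have xi: "xs ! ?i \<in> J" "xs ! ?i \<in> carrier R" using i J c nth_mem by blast+
    have "reg (?U ?i) (xs ! ?i)"
      using reg i unfolding regular_sequence_def ideal_times_module_eq
      by (intro nonzerodivisor_on_quotient smU xi) simp
    moreover have "?U (Suc ?i) = ?U ?i \<uplus> sc (xs ! ?i) (carrier M)"
      using genideal_insert_times[OF tc xi(2), of ?i] unfolding take_Suc_conv_app_nth[OF i(1)] by simp
    moreover have "dp J j (?U (Suc ?i))" using Suc i by simp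
    ultimately show ?case using xi by auto
  qed
  from this[of "length xs"] have "dp J (length xs) (?U 0)" by simp
  moreover have "?U 0 = {\<zero>\<^bsub>M\<^esub>}"
  proof -
    have "?U 0 \<subseteq> {\<zero>\<^bsub>M\<^esub>}"
      using act_genideal_least[of "{}" "carrier M" "{\<zero>\<^bsub>M\<^esub>}"] sm_carrier_set sm_zero_set by simp
    then show ?thesis using sm_zero[OF smU[of 0]] by blast
  qed
  ultimately show ?thesis by simp
qed

end

text \<open>The diagonal becomes constant at some \<open>N0\<close>, which by monotonicity fixes all
  entries with both indices at least \<open>N0\<close>. Only the finitely many rows below
  \<open>N0\<close> remain, and each stabilises by itself; hence a bound that is uniform in
  \<open>j\<close>.\<close>

lemma acc_double_sequence:
  fixes a :: "nat \<Rightarrow> nat \<Rightarrow> 'x::order"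
  assumes "acc P" and P: "\<And>j k. P (a j k)"
    and mono: "\<And>j j' k k'. j \<le> j' \<Longrightarrow> k \<le> k' \<Longrightarrow> a j k \<le> a j' k'"
  shows "\<exists>N. \<forall>j. \<forall>k\<ge>N. a j k = a j N"
proof -
  have "\<exists>N. \<forall>n\<ge>N. a n n = a N N"
    by (rule accD[of P "\<lambda>n. a n n", OF assms(1)]) (simp_all add: P mono)
  then obtain N0 where N0: "\<forall>n\<ge>N0. a n n = a N0 N0" ..
  have big: "a j k = a N0 N0" if "j \<ge> N0" "k \<ge> N0" for j k
  proof (rule order_antisym)
    have "a j k \<le> a (max j k) (max j k)" by (rule mono) simp_all
    also have "\<dots> = a N0 N0" using N0 that by (meson max.coboundedI1)
    finally show "a j k \<le> a N0 N0" .
    show "a N0 N0 \<le> a j k" by (rule mono) (use that in simp_all)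
  qed
  have "\<exists>N. \<forall>k\<ge>N. a j k = a j N" for j
    by (rule accD[of P "a j", OF assms(1)]) (simp_all add: P mono)
  then obtain Nj where Nj: "\<And>j. \<forall>k\<ge>Nj j. a j k = a j (Nj j)" by metis
  define N where "N = Max (insert N0 (Nj ` {..<N0}))"
  have "a j k = a j N" if k: "k \<ge> N" for j k
  proof (cases "j < N0")
    case True
    then have "Nj j \<le> N" unfolding N_def by (intro Max_ge) auto
    then have "a j k = a j (Nj j)" "a j N = a j (Nj j)" using Nj[of j] k by (meson order_trans)+
    then show ?thesis by simp
  next
    case False
    have "N0 \<le> N" unfolding N_def by (intro Max_ge) auto
    then show ?thesis using big[of j k] big[of j N] False k by simp
  qed
  then show ?thesis by blast
qed

section \<open>Noetherian modules and their Rees modules\<close>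

locale noetherian_module = module R M + noetherian_ring R for R (structure) and M (structure) +
  assumes finitely_generated: "\<exists>S \<subseteq> carrier M. finite S \<and> module_span R M S = carrier M"
begin

lemma acc_ideal: "acc (\<lambda>J. ideal J R)"
proof (rule accI)
  fix f :: "nat \<Rightarrow> 'a set"
  assume f: "\<And>n. ideal (f n) R" and mono: "\<And>m n. m \<le> n \<Longrightarrow> f m \<le> f n"
  have "subset.chain {I. ideal I R} (range f)"
    unfolding subset_chain_def
  proof (intro conjI ballI)
    fix x y assume "x \<in> range f" "y \<in> range f"
    then obtain i j where "x = f i" "y = f j" by blast
    then show "x \<subseteq> y \<or> y \<subseteq> x" using mono linear[of i j] by blast
  qed (use f in blast)
  then have "\<Union>(range f) \<in> range f" using ideal_chain_is_trivial[of "range f"] by blast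
  then obtain N where N: "\<Union>(range f) = f N" by blast
  have "f n = f N" if "n \<ge> N" for n
    using mono[OF that] N by (intro equalityI) (metis UN_upper UNIV_I)+
  then show "\<exists>N. \<forall>n\<ge>N. f n = f N" by blast
qed

lemma sm_cyclic: "u \<in> carrier M \<Longrightarrow> sm ((\<lambda>a. a *\<^sub>M u) ` carrier R)"
proof (rule submoduleI)
  assume u: "u \<in> carrier M"
  show "\<zero>\<^bsub>M\<^esub> \<in> (\<lambda>a. a *\<^sub>M u) ` carrier R" using u by (intro image_eqI[of _ _ \<zero>]) auto
  show "\<ominus>\<^bsub>M\<^esub> v \<in> (\<lambda>a. a *\<^sub>M u) ` carrier R" if "v \<in> (\<lambda>a. a *\<^sub>M u) ` carrier R" for v
    using that u by (auto simp flip: smult_l_minus)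
  show "v +\<^sub>M w \<in> (\<lambda>a. a *\<^sub>M u) ` carrier R"
    if "v \<in> (\<lambda>a. a *\<^sub>M u) ` carrier R" "w \<in> (\<lambda>a. a *\<^sub>M u) ` carrier R" for v w
    using that u by (auto simp flip: smult_l_distr)
  show "b *\<^sub>M v \<in> (\<lambda>a. a *\<^sub>M u) ` carrier R"
    if "b \<in> carrier R" "v \<in> (\<lambda>a. a *\<^sub>M u) ` carrier R" for b v
    using that u by (auto simp flip: smult_assoc1)
qed auto

text \<open>One generator \<open>u\<close> is added at a time. Comparable submodules coincide once
  they have the same intersection with the span of \<open>S\<close> and the same ideal of
  coefficients of \<open>u\<close> modulo that span.\<close>

lemma acc_sm_span:
  assumes "finite S" "S \<subseteq> carrier M"
  shows "acc (\<lambda>V. sm V \<and> V \<subseteq> module_span R M S)"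
  using assms
proof (induction S)
  case empty
  have "module_span R M {} \<subseteq> {\<zero>\<^bsub>M\<^esub>}" by (rule span_least) (auto simp: sm_zero_set)
  then have "V = {\<zero>\<^bsub>M\<^esub>}" if "sm V" "V \<subseteq> module_span R M {}" for V
    using that sm_zero[of V] by blast
  then show ?case by (intro accI) metis
next
  case (insert u S)
  let ?S = "module_span R M S" and ?C = "(\<lambda>a. a *\<^sub>M u) ` carrier R"
  have u: "u \<in> carrier M" and S: "sm ?S" using insert.prems by (auto intro: sm_span)
  let ?\<psi> = "\<lambda>V. {a \<in> carrier R. \<forall>v\<in>{u}. a *\<^sub>M v \<in> V \<uplus> ?S}"
  have C: "sm ?C" "u \<in> ?C" using sm_cyclic u by (auto intro: image_eqI[of _ _ \<one>])
  have span_le: "module_span R M (insert u S) \<subseteq> ?C \<uplus> ?S"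
  proof (rule span_least)
    show "sm (?C \<uplus> ?S)" using C S by (simp add: sm_join)
    show "insert u S \<subseteq> ?C \<uplus> ?S"
      using C join_upper1[OF C(1) S] join_upper2[OF C(1) S] span_superset[of S] by blast
  qed
  show ?case
  proof (rule acc_joint_injective[where Qa = "\<lambda>V. sm V \<and> V \<subseteq> ?S" and Qb = "\<lambda>J. ideal J R"
        and \<phi> = "\<lambda>V. V \<inter> ?S" and \<psi> = "\<lambda>V. {a \<in> carrier R. \<forall>v\<in>{u}. a *\<^sub>M v \<in> V \<uplus> ?S}"])
    show "acc (\<lambda>V. sm V \<and> V \<subseteq> ?S)" using insert by simp
    show "acc (\<lambda>J. ideal J R)" by (rule acc_ideal)
    show "sm (V \<inter> ?S) \<and> V \<inter> ?S \<subseteq> ?S" if "sm V \<and> V \<subseteq> module_span R M (insert u S)" for V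
      using that S by (simp add: sm_Int)
    show "ideal (?\<psi> V) R" if "sm V \<and> V \<subseteq> module_span R M (insert u S)" for V
      using that S u by (intro ideal_into sm_join) auto
    show "V \<inter> ?S \<subseteq> V' \<inter> ?S" if "V \<subseteq> V'" for V V' using that by blast
    show "?\<psi> V \<subseteq> ?\<psi> V'" if "V \<subseteq> V'" for V V' using join_mono[OF that, of ?S ?S] by blast
    fix V V' assume V: "sm V \<and> V \<subseteq> module_span R M (insert u S)"
      and V': "sm V' \<and> V' \<subseteq> module_span R M (insert u S)" and le: "V \<subseteq> V'"
      and \<phi>: "V \<inter> ?S = V' \<inter> ?S" and \<psi>: "?\<psi> V = ?\<psi> V'"
    have "v' \<in> V" if v': "v' \<in> V'" for v'
    proof -
      obtain a s where as: "v' = a *\<^sub>M u +\<^sub>M s" "a \<in> carrier R" "s \<in> ?S"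
        using v' V' span_le by (auto elim!: joinE)
      have sc: "s \<in> carrier M" "v' \<in> carrier M" using as S V' v' sm_carrier by auto
      have "a *\<^sub>M u = v' +\<^sub>M \<ominus>\<^bsub>M\<^esub> s" using as sc u by (simp add: M.a_assoc M.r_neg)
      then have "a \<in> ?\<psi> V'" using as(2) joinI[OF v' sm_neg[OF S as(3)]] by simp
      then have "a \<in> ?\<psi> V" using \<psi> by simp
      then have "a *\<^sub>M u \<in> V \<uplus> ?S" by simp
      then obtain v s' where vs: "a *\<^sub>M u = v +\<^sub>M s'" "v \<in> V" "s' \<in> ?S" by (rule joinE)
      have vc: "v \<in> carrier M" "s' \<in> carrier M" using vs S V sm_carrier by auto
      have e: "v' = v +\<^sub>M (s' +\<^sub>M s)" using as vs vc sc by (simp add: M.a_assoc)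
      have "s' +\<^sub>M s \<in> V'" using sm_addD2[of V' "s' +\<^sub>M s" v] V' vs le v' e vc sc by auto
      then have "s' +\<^sub>M s \<in> V" using \<phi> sm_add[OF S vs(3) as(3)] by blast
      then show "v' \<in> V" using e V vs sm_add by simp
    qed
    then show "V = V'" using le by blast
  qed
qed

lemma acc_sm: "acc sm"
proof -
  obtain S where S: "S \<subseteq> carrier M" "finite S" "module_span R M S = carrier M"
    using finitely_generated by blast
  have "(\<lambda>V. sm V \<and> V \<subseteq> module_span R M S) = sm" using S(3) sm_subset by auto
  then show ?thesis using acc_sm_span[OF S(2,1)] by simp
qed

text \<open>The part of degree \<open>n\<close> in which \<open>g\<close> occurs with exponents
  below \<open>j\<close> and coefficients from \<open>\<Phi>\<close>. Exponents above
  \<open>n\<close> contribute zero, so the sum is complete from \<open>j = Suc n\<close> on.\<close>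

primrec psum :: "'a \<Rightarrow> (nat \<Rightarrow> 'c set) \<Rightarrow> nat \<Rightarrow> nat \<Rightarrow> 'c set" where
  "psum g \<Phi> 0 n = {\<zero>\<^bsub>M\<^esub>}"
| "psum g \<Phi> (Suc j) n = psum g \<Phi> j n \<uplus> (if j \<le> n then sc (g [^] j) (\<Phi> (n - j)) else {\<zero>\<^bsub>M\<^esub>})"

text \<open>The degree \<open>n\<close> component of the Rees module of the ideal generated by a list, with the powers of
  the first generator kept apart as in the proof of Hilbert's basis theorem.\<close>

primrec rees :: "'a list \<Rightarrow> nat \<Rightarrow> 'c set" where
  "rees [] = (\<lambda>n. if n = 0 then carrier M else {\<zero>\<^bsub>M\<^esub>})"
| "rees (g # gs) = (\<lambda>n. psum g (rees gs) (Suc n) n)"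

lemma sm_psum: "g \<in> carrier R \<Longrightarrow> (\<forall>n. sm (\<Phi> n)) \<Longrightarrow> sm (psum g \<Phi> j n)"
  by (induction j) (simp_all add: sm_zero_set sm_join sm_sc)

lemma psum_mono_Suc:
  assumes "g \<in> carrier R" "\<forall>n. sm (\<Phi> n)"
  shows "psum g \<Phi> j n \<subseteq> psum g \<Phi> (Suc j) n"
proof -
  have "sm (if j \<le> n then sc (g [^] j) (\<Phi> (n - j)) else {\<zero>\<^bsub>M\<^esub>})"
    using assms by (simp add: sm_sc sm_zero_set)
  then show ?thesis using join_upper1[OF sm_psum[OF assms]] by simp
qed

lemma psum_mono:
  assumes "g \<in> carrier R" "\<forall>n. sm (\<Phi> n)" "j \<le> j'"
  shows "psum g \<Phi> j n \<subseteq> psum g \<Phi> j' n"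
  using lift_Suc_mono_le[of "\<lambda>j. psum g \<Phi> j n"] psum_mono_Suc[OF assms(1,2)] assms(3) by blast

lemma psum_stable:
  assumes "g \<in> carrier R" "\<forall>n. sm (\<Phi> n)"
  shows "psum g \<Phi> j n \<subseteq> psum g \<Phi> (Suc n) n"
proof (cases "j \<le> Suc n")
  case True
  then show ?thesis by (rule psum_mono[OF assms])
next
  case False
  then have "Suc n \<le> j" by simp
  then have "psum g \<Phi> j n = psum g \<Phi> (Suc n) n"
  proof (induction j rule: dec_induct)
    case (step j)
    then have "psum g \<Phi> (Suc j) n = psum g \<Phi> j n \<uplus> {\<zero>\<^bsub>M\<^esub>}" by simp
    then show ?case using join_zero[OF sm_psum[OF assms, of j n]] step by simp
  qed simp
  then show ?thesis by simp
qed

lemma psum_term: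
  assumes "g \<in> carrier R" "\<forall>n. sm (\<Phi> n)" "j \<le> n"
  shows "sc (g [^] j) (\<Phi> (n - j)) \<subseteq> psum g \<Phi> (Suc n) n"
proof -
  have "sc (g [^] j) (\<Phi> (n - j)) \<subseteq> psum g \<Phi> (Suc j) n"
    using assms join_upper2[OF sm_psum[OF assms(1,2)], of "sc (g [^] j) (\<Phi> (n - j))" j n] by (simp add: sm_sc)
  also have "\<dots> \<subseteq> psum g \<Phi> (Suc n) n" by (rule psum_stable[OF assms(1,2)])
  finally show ?thesis .
qed

lemma sc_Suc_pow: "g \<in> carrier R \<Longrightarrow> sm V \<Longrightarrow> sc g (sc (g [^] j) V) = sc (g [^] Suc j) V" for j :: nat
  by (simp add: sc_sc m_comm)

lemma sc_psum:
  assumes "g \<in> carrier R" "\<forall>n. sm (\<Phi> n)"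
  shows "sc g (psum g \<Phi> j n) \<subseteq> psum g \<Phi> (Suc j) (Suc n)"
proof (induction j)
  case 0
  have "\<zero>\<^bsub>M\<^esub> \<in> psum g \<Phi> (Suc 0) (Suc n)" by (rule sm_zero[OF sm_psum[OF assms]])
  then show ?case using assms by (simp add: sc_zero_set)
next
  case (Suc j)
  let ?T = "if j \<le> n then sc (g [^] j) (\<Phi> (n - j)) else {\<zero>\<^bsub>M\<^esub>}"
  let ?T' = "if Suc j \<le> Suc n then sc (g [^] Suc j) (\<Phi> (Suc n - Suc j)) else {\<zero>\<^bsub>M\<^esub>}"
  have "sc g (psum g \<Phi> (Suc j) n) = sc g (psum g \<Phi> j n) \<uplus> sc g ?T"
    unfolding psum.simps using assms sm_psum[OF assms, of j n] by (intro sc_join) (simp_all add: sm_sc sm_zero_set)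
  moreover have "sc g ?T = ?T'" using sc_Suc_pow assms by (simp add: sc_zero_set)
  ultimately show ?case unfolding psum.simps(2)[of g \<Phi> "Suc j"] using Suc by (simp only: join_mono order_refl)
qed

lemma sc_psum_other:
  assumes "g \<in> carrier R" "h \<in> carrier R" "\<forall>n. sm (\<Phi> n)" and h: "\<And>n. sc h (\<Phi> n) \<subseteq> \<Phi> (Suc n)"
  shows "sc h (psum g \<Phi> j n) \<subseteq> psum g \<Phi> j (Suc n)"
proof (induction j)
  case 0
  then show ?case using assms by (simp add: sc_zero_set)
next
  case (Suc j)
  let ?T = "if j \<le> n then sc (g [^] j) (\<Phi> (n - j)) else {\<zero>\<^bsub>M\<^esub>}"
  let ?T' = "if j \<le> Suc n then sc (g [^] j) (\<Phi> (Suc n - j)) else {\<zero>\<^bsub>M\<^esub>}"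
  have "sc h (psum g \<Phi> (Suc j) n) = sc h (psum g \<Phi> j n) \<uplus> sc h ?T"
    unfolding psum.simps using assms sm_psum[OF assms(1,3), of j n]
    by (intro sc_join) (simp_all add: sm_sc sm_zero_set)
  moreover have "sc h ?T \<subseteq> ?T'"
  proof (cases "j \<le> n")
    case True
    then have "sc h ?T = sc (g [^] j) (sc h (\<Phi> (n - j)))" using assms by (simp add: sc_commute[of h])
    also have "\<dots> \<subseteq> sc (g [^] j) (\<Phi> (Suc (n - j)))" using h by (intro sc_mono)
    finally show ?thesis using True by (simp add: Suc_diff_le)
  next
    case False
    have "\<zero>\<^bsub>M\<^esub> \<in> ?T'" using assms by (simp add: sm_zero sm_sc)
    then show ?thesis using False assms by (simp add: sc_zero_set)
  qed
  ultimately show ?case unfolding psum.simps using Suc by (simp only: join_mono)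
qed

lemma sm_rees: "set gs \<subseteq> carrier R \<Longrightarrow> sm (rees gs n)"
proof (induction gs arbitrary: n)
  case (Cons g gs)
  then have "g \<in> carrier R" "\<forall>n. sm (rees gs n)" by simp_all
  then show ?case unfolding rees.simps by (rule sm_psum)
qed (simp add: sm_zero_set sm_carrier_set)

lemma sc_rees: "set gs \<subseteq> carrier R \<Longrightarrow> g \<in> set gs \<Longrightarrow> sc g (rees gs n) \<subseteq> rees gs (Suc n)"
proof (induction gs arbitrary: n)
  case (Cons h gs)
  have h: "h \<in> carrier R" "g \<in> carrier R" "\<forall>n. sm (rees gs n)" using Cons.prems sm_rees by auto
  show ?case
  proof (cases "g = h")
    case True
    then show ?thesis unfolding rees.simps using sc_psum[OF h(1,3), of "Suc n" n] by (simp only:)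
  next
    case False
    then have "sc g (psum h (rees gs) (Suc n) n) \<subseteq> psum h (rees gs) (Suc n) (Suc n)"
      using Cons by (intro sc_psum_other h) auto
    also have "\<dots> \<subseteq> psum h (rees gs) (Suc (Suc n)) (Suc n)" by (rule psum_stable[OF h(1,3)])
    finally show ?thesis unfolding rees.simps .
  qed
qed simp

lemma rees_Suc_le:
  assumes "set gs \<subseteq> J" and J: "J \<subseteq> carrier R"
  shows "rees gs (Suc n) \<subseteq> act J (rees gs n)"
  using assms(1)
proof (induction gs arbitrary: n)
  case Nil
  then show ?case using sm_zero[OF sm_act[OF J sm_rees[of "[]"]]] by simp
next
  case (Cons g gs)
  have gs: "set gs \<subseteq> carrier R" "set (g # gs) \<subseteq> carrier R" and g: "g \<in> carrier R" "g \<in> J"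
    using Cons.prems J by auto
  have smr: "\<forall>n. sm (rees gs n)" using sm_rees gs by simp
  let ?A = "act J (rees (g # gs) n)"
  have A: "sm ?A" using gs by (intro sm_act J sm_rees)
  have "psum g (rees gs) j (Suc n) \<subseteq> ?A" for j
  proof (induction j)
    case 0
    then show ?case using sm_zero[OF A] by simp
  next
    case (Suc j)
    have "sc (g [^] j) (rees gs (Suc n - j)) \<subseteq> ?A" if "j \<le> Suc n"
    proof (cases j)
      case 0
      have "rees gs n \<subseteq> rees (g # gs) n"
        using psum_term[of g "rees gs", OF g(1) smr, of 0 n] smr by (simp add: sc_one)
      then have "act J (rees gs n) \<subseteq> ?A" by (intro act_mono J sm_rees gs)
      moreover have "rees gs (Suc n) \<subseteq> act J (rees gs n)" using Cons by simp
      ultimately show ?thesis using 0 smr by (simp add: sc_one)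
    next
      case (Suc i)
      have "sc (g [^] j) (rees gs (Suc n - j)) = sc g (sc (g [^] i) (rees gs (n - i)))"
        using Suc smr g sc_Suc_pow by simp
      also have "\<dots> \<subseteq> sc g (rees (g # gs) n)"
        using psum_term[of g "rees gs", OF g(1) smr, of i n] that Suc by (intro sc_mono) simp
      also have "\<dots> \<subseteq> ?A" by (rule sc_subset_act[OF g(2)])
      finally show ?thesis .
    qed
    then have "(if j \<le> Suc n then sc (g [^] j) (rees gs (Suc n - j)) else {\<zero>\<^bsub>M\<^esub>}) \<subseteq> ?A"
      using sm_zero[OF A] by simp
    then show ?case unfolding psum.simps by (intro join_least A Suc)
  qed
  then show ?case unfolding rees.simps .
qed

text \<open>Separating the powers of the generators is mere bookkeeping: degree \<open>n\<close>
  contains all monomials of degree \<open>n\<close>, so the component is the submodule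
  \<open>I\<^sup>n M\<close> of \<open>M\<close> itself.\<close>

lemma rees_eq_pw:
  assumes gs: "set gs \<subseteq> carrier R"
  shows "rees gs n = pw (Idl (set gs)) n (carrier M)"
proof (induction n)
  case 0
  have "rees gs 0 = carrier M" using gs
    by (induction gs) (use sm_carrier_set sm_zero_set join_commute[of "{\<zero>\<^bsub>M\<^esub>}" "carrier M"] in \<open>auto simp: sc_one join_zero\<close>)
  then show ?case by simp
next
  case (Suc n)
  have J: "Idl (set gs) \<subseteq> carrier R" by (rule ideal_subset[OF genideal_ideal[OF gs]])
  have "act (Idl (set gs)) (rees gs n) = rees gs (Suc n)"
  proof
    show "act (Idl (set gs)) (rees gs n) \<subseteq> rees gs (Suc n)"
      using gs by (intro act_genideal_least sm_rees sc_rees)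
    show "rees gs (Suc n) \<subseteq> act (Idl (set gs)) (rees gs n)"
      by (rule rees_Suc_le[OF genideal_self[OF gs] J])
  qed
  then show ?case using Suc by simp
qed

text \<open>A graded submodule of the Rees module over the polynomial ring in the generators.
  Stability under the generators extends to the whole ideal by \<open>graded_smult\<close>.\<close>

definition graded :: "'a list \<Rightarrow> (nat \<Rightarrow> 'c set) \<Rightarrow> bool" where
  "graded gs W \<longleftrightarrow> (\<forall>n. sm (W n) \<and> W n \<subseteq> rees gs n \<and> (\<forall>g\<in>set gs. sc g (W n) \<subseteq> W (Suc n)))"

text \<open>Hilbert's basis theorem, by induction on the generators. The sums of multiples of powers
  of \<open>g\<close> inside \<open>M\<close> are not direct, so leading coefficients are taken
  modulo \<open>?E j\<close>, the terms with smaller exponents.\<close>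

lemma acc_graded: "set gs \<subseteq> carrier R \<Longrightarrow> acc (graded gs)"
proof (induction gs)
  case Nil
  show ?case
  proof (rule acc_joint_injective[where \<phi> = "\<lambda>W. W 0" and \<psi> = "\<lambda>W. W 0", OF acc_sm acc_sm])
    fix W W' assume W: "graded [] W" "graded [] W'" and eq: "W 0 = W' 0"
    have "W n = {\<zero>\<^bsub>M\<^esub>}" "W' n = {\<zero>\<^bsub>M\<^esub>}" if "n \<noteq> 0" for n
      using W that sm_zero[of "W n"] sm_zero[of "W' n"] unfolding graded_def by (auto dest!: spec[of _ n])
    then show "W = W'" using eq by (metis ext)
  qed (auto simp: graded_def le_fun_def)
next
  case (Cons g gs)
  have gs: "set gs \<subseteq> carrier R" and g: "g \<in> carrier R" using Cons.prems by auto
  have smr: "sm (rees gs n)" for n using sm_rees gs by simp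
  let ?E = "psum g (rees gs)"
  have smE: "sm (?E j n)" for j n by (intro sm_psum g smr allI)
  \<comment> \<open>\<open>L j W\<close> collects the coefficients that can stand at
    \<open>g [^] j\<close> in an element of \<open>W\<close>. It is graded over the remaining
    generators and grows with \<open>j\<close>, so \<open>acc_double_sequence\<close> applies to
    \<open>L j (f k)\<close>.\<close>
  define L where "L j W k = rees gs k \<inter> colon (W (k + j) \<uplus> ?E j (k + j)) (g [^] j)" for j and W :: "nat \<Rightarrow> 'c set" and k
  have gj: "g [^] j \<in> carrier R" for j :: nat using g by simp
  have L: "graded gs (L j W)" if W: "graded (g # gs) W" for j W
    unfolding graded_def
  proof (intro allI conjI ballI)
    have smW: "sm (W n)" for n using W unfolding graded_def by blast
    fix n
    show "sm (L j W n)" unfolding L_def by (intro sm_Int sm_colon sm_join smr smE smW gj)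
    show "L j W n \<subseteq> rees gs n" unfolding L_def by blast
    fix h assume h: "h \<in> set gs"
    then have hc: "h \<in> carrier R" using gs by blast
    show "sc h (L j W n) \<subseteq> L j W (Suc n)"
    proof
      fix x assume "x \<in> sc h (L j W n)"
      then obtain u where u: "x = h *\<^sub>M u" "u \<in> L j W n" unfolding sc_def by blast
      have uc: "u \<in> carrier M" using u sm_carrier[OF smr[of n]] unfolding L_def by blast
      have "x \<in> rees gs (Suc n)" using sc_rees[OF gs h, of n] u scI unfolding L_def by blast
      moreover have "g [^] j *\<^sub>M x \<in> W (Suc n + j) \<uplus> ?E j (Suc n + j)"
      proof -
        have "g [^] j *\<^sub>M u \<in> W (n + j) \<uplus> ?E j (n + j)" using u unfolding L_def colon_def by blast
        then have "h *\<^sub>M (g [^] j *\<^sub>M u) \<in> sc h (W (n + j) \<uplus> ?E j (n + j))" by (rule scI)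
        also have "\<dots> = sc h (W (n + j)) \<uplus> sc h (?E j (n + j))" using hc smW smE by (rule sc_join)
        also have "\<dots> \<subseteq> W (Suc (n + j)) \<uplus> ?E j (Suc (n + j))"
          using W h sc_rees[OF gs h] unfolding graded_def
          by (intro join_mono sc_psum_other g hc smr allI) auto
        finally show ?thesis using u hc gj uc by (simp add: smult_left_commute)
      qed
      ultimately show "x \<in> L j W (Suc n)" unfolding L_def colon_def using u uc hc by simp
    qed
  qed
  have L_Suc: "L j W n \<subseteq> L (Suc j) W n" if W: "graded (g # gs) W" for j W n
  proof
    have smW: "sm (W n)" for n using W unfolding graded_def by blast
    fix u assume u: "u \<in> L j W n"
    have uc: "u \<in> carrier M" using u sm_carrier[OF smr[of n]] unfolding L_def by blast
    have "g [^] j *\<^sub>M u \<in> W (n + j) \<uplus> ?E j (n + j)" using u unfolding L_def colon_def by blast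
    then have "g *\<^sub>M (g [^] j *\<^sub>M u) \<in> sc g (W (n + j) \<uplus> ?E j (n + j))" by (rule scI)
    also have "\<dots> = sc g (W (n + j)) \<uplus> sc g (?E j (n + j))" using g smW smE by (rule sc_join)
    also have "\<dots> \<subseteq> W (Suc (n + j)) \<uplus> ?E (Suc j) (Suc (n + j))"
      using W unfolding graded_def by (intro join_mono sc_psum g smr allI) auto
    finally have "g [^] Suc j *\<^sub>M u \<in> W (n + Suc j) \<uplus> ?E (Suc j) (n + Suc j)"
      using g gj uc by (simp add: smult_assoc1[symmetric] m_comm)
    then show "u \<in> L (Suc j) W n" using u unfolding L_def colon_def by simp
  qed
  have L_mono: "L j W n \<subseteq> L j W' n" if "\<And>n. W n \<subseteq> W' n" for j W W' n
    unfolding L_def using join_mono[OF that order_refl, of "n + j" "?E j (n + j)"]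
    by (intro Int_mono colon_mono) auto
  have L_inj: "W' n \<subseteq> W n"
    if W: "graded (g # gs) W" "graded (g # gs) W'" "\<And>n. W n \<subseteq> W' n" and eq: "\<And>j. L j W = L j W'" for W W' n
  proof -
    have smW: "sm (W n)" "sm (W' n)" for n using W unfolding graded_def by blast+
    \<comment> \<open>Induction on the exponent bound: an element of \<open>W'\<close> differs from
      an element \<open>v\<close> of \<open>W\<close> with the same leading term by an element of
      \<open>?E j\<close>, which again lies in \<open>W'\<close>.\<close>
    have "W' n \<inter> ?E j n \<subseteq> W n" for j
    proof (induction j)
      case 0
      then show ?case using sm_zero[OF smW(1)[of n]] by auto
    next
      case (Suc j)
      show ?case
      proof
        fix w assume w: "w \<in> W' n \<inter> ?E (Suc j) n"
        then have wc: "w \<in> carrier M" using smW sm_carrier by blast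
        show "w \<in> W n"
        proof (cases "j \<le> n")
          case False
          then show ?thesis using w Suc join_zero[OF smE] by auto
        next
          case True
          then obtain e u where eu: "w = e +\<^sub>M g [^] j *\<^sub>M u" "e \<in> ?E j n" "u \<in> rees gs (n - j)"
            using w by (auto elim!: joinE simp: sc_def)
          have c: "e \<in> carrier M" "u \<in> carrier M" using eu smE smr sm_carrier by blast+
          have "g [^] j *\<^sub>M u = w +\<^sub>M \<ominus>\<^bsub>M\<^esub> e"
            using eu c gj[of j] by (simp add: M.a_ac M.r_neg1 M.r_neg2 M.r_neg)
          then have "g [^] j *\<^sub>M u \<in> W' n \<uplus> ?E j n"
            using joinI[of w "W' n" "\<ominus>\<^bsub>M\<^esub> e" "?E j n"] w sm_neg[OF smE eu(2)] by (simp only: IntD1)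
          then have "u \<in> L j W' (n - j)" unfolding L_def colon_def using eu c True by simp
          then have "u \<in> L j W (n - j)" using eq by simp
          then have "g [^] j *\<^sub>M u \<in> W n \<uplus> ?E j n" unfolding L_def colon_def using True by simp
          then obtain v e' where ve: "g [^] j *\<^sub>M u = v +\<^sub>M e'" "v \<in> W n" "e' \<in> ?E j n" by (rule joinE)
          have c': "v \<in> carrier M" "e' \<in> carrier M" using ve smE smW sm_carrier by blast+
          have e: "w = v +\<^sub>M (e +\<^sub>M e')" using eu ve c c' by (simp add: M.a_ac)
          have "e +\<^sub>M e' \<in> ?E j n" using eu ve sm_add[OF smE] by blast
          moreover have "e +\<^sub>M e' \<in> W' n"
            using sm_addD2[of "W' n" "e +\<^sub>M e'" v] smW W(3) ve w e c c' by auto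
          ultimately have "e +\<^sub>M e' \<in> W n" using Suc by blast
          then show ?thesis using e ve sm_add[OF smW(1)] by simp
        qed
      qed
    qed
    moreover have "W' n \<subseteq> ?E (Suc n) n" using W(2) unfolding graded_def rees.simps by blast
    ultimately show ?thesis by blast
  qed
  show ?case
  proof (rule accI)
    fix f :: "nat \<Rightarrow> nat \<Rightarrow> 'c set"
    assume f: "\<And>n. graded (g # gs) (f n)" and mono: "\<And>m n. m \<le> n \<Longrightarrow> f m \<le> f n"
    have "\<exists>N. \<forall>j. \<forall>k\<ge>N. L j (f k) = L j (f N)"
    proof (rule acc_double_sequence[where P = "graded gs"])
      show "acc (graded gs)" using Cons by simp
      show "graded gs (L j (f k))" for j k by (rule L[OF f])
      fix j j' k k' :: nat assume le: "j \<le> j'" "k \<le> k'"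
      have "L j (f k) \<le> L j (f k')" using L_mono mono[OF le(2)] by (simp add: le_fun_def)
      also have "\<dots> \<le> L j' (f k')"
        using lift_Suc_mono_le[of "\<lambda>j. L j (f k')", OF _ le(1)] L_Suc[OF f] by (simp add: le_fun_def)
      finally show "L j (f k) \<le> L j' (f k')" .
    qed
    then obtain N where N: "\<And>j k. k \<ge> N \<Longrightarrow> L j (f k) = L j (f N)" by blast
    have "f k = f N" if k: "k \<ge> N" for k
    proof (rule order_antisym)
      show "f N \<le> f k" using mono k by simp
      show "f k \<le> f N"
        unfolding le_fun_def
        using L_inj[OF f[of N] f[of k]] mono[OF k] N[OF k] by (simp add: le_fun_def)
    qed
    then show "\<exists>N. \<forall>k\<ge>N. f k = f N" by blast
  qed
qed

end

section \<open>Irreducible graded submodules and general elements\<close>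

context noetherian_module
begin

lemma join_cyclicD:
  "u \<in> N \<uplus> (\<lambda>c. c *\<^sub>M w) ` carrier R \<Longrightarrow> \<exists>x\<in>N. \<exists>c\<in>carrier R. u = x +\<^sub>M c *\<^sub>M w"
  unfolding join_def by blast

lemma gradedD:
  assumes "graded gs W"
  shows "sm (W n)" "W n \<subseteq> rees gs n" "g \<in> set gs \<Longrightarrow> sc g (W n) \<subseteq> W (Suc n)"
  using assms unfolding graded_def by blast+

lemma gradedI:
  assumes "\<And>n. sm (W n)" "\<And>n. W n \<subseteq> rees gs n"
    "\<And>g n u. g \<in> set gs \<Longrightarrow> u \<in> W n \<Longrightarrow> g *\<^sub>M u \<in> W (Suc n)"
  shows "graded gs W"
  using assms unfolding graded_def sc_def by blast

lemma graded_smult: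
  assumes W: "graded gs W" and gs: "set gs \<subseteq> carrier R" and y: "y \<in> Idl (set gs)" and u: "u \<in> W n"
  shows "y *\<^sub>M u \<in> W (Suc n)"
proof -
  have "act (Idl (set gs)) (W n) \<subseteq> W (Suc n)"
    by (intro act_genideal_least gs gradedD(1)[OF W] gradedD(3)[OF W])
  then show ?thesis using actI[OF y u] by blast
qed

lemma graded_rees: "set gs \<subseteq> carrier R \<Longrightarrow> graded gs (rees gs)"
  unfolding graded_def using sm_rees sc_rees by blast

text \<open>The graded colon of \<open>Q\<close> by \<open>y\<close>, where \<open>y\<close> is
  regarded as homogeneous of degree \<open>k\<close>. A ring element has no degree of its own, so
  the degree is an argument: a generator acts in degree 1, its \<open>k\<close>-th power in degree
  \<open>k\<close>.\<close>

definition colon_family :: "'a list \<Rightarrow> (nat \<Rightarrow> 'c set) \<Rightarrow> 'a \<Rightarrow> nat \<Rightarrow> nat \<Rightarrow> 'c set" where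
  "colon_family gs Q y k n = rees gs n \<inter> colon (Q (n + k)) y"

lemma graded_colon_family:
  assumes Q: "graded gs Q" and gs: "set gs \<subseteq> carrier R" and y: "y \<in> carrier R"
  shows "graded gs (colon_family gs Q y k)"
proof (rule gradedI)
  show "sm (colon_family gs Q y k n)" for n
    unfolding colon_family_def by (intro sm_Int sm_colon sm_rees gs y gradedD(1)[OF Q])
  show "colon_family gs Q y k n \<subseteq> rees gs n" for n unfolding colon_family_def by blast
  fix g n u assume g: "g \<in> set gs" and u: "u \<in> colon_family gs Q y k n"
  have c: "u \<in> carrier M" "g \<in> carrier R" using u g gs unfolding colon_family_def colon_def by auto
  have "g *\<^sub>M (y *\<^sub>M u) \<in> Q (Suc (n + k))"
    using u gradedD(3)[OF Q g, of "n + k"] scI unfolding colon_family_def colon_def by blast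
  moreover have "g *\<^sub>M u \<in> rees gs (Suc n)"
    using u sc_rees[OF gs g, of n] scI unfolding colon_family_def by blast
  ultimately show "g *\<^sub>M u \<in> colon_family gs Q y k (Suc n)"
    unfolding colon_family_def colon_def using c y by (simp add: smult_left_commute[of y g])
qed

lemma sc_pow_rees:
  fixes k :: nat
  assumes gs: "set gs \<subseteq> carrier R" and g: "g \<in> set gs"
  shows "sc (g [^] k) (rees gs n) \<subseteq> rees gs (n + k)"
proof (induction k)
  case 0
  then show ?case using sm_rees[OF gs] by (simp add: sc_one)
next
  case (Suc k)
  have gc: "g \<in> carrier R" using g gs by blast
  have "sc (g [^] Suc k) (rees gs n) = sc g (sc (g [^] k) (rees gs n))"
    using sc_Suc_pow[OF gc sm_rees[OF gs]] by simp
  also have "\<dots> \<subseteq> sc g (rees gs (n + k))" using Suc by (rule sc_mono)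
  also have "\<dots> \<subseteq> rees gs (n + Suc k)" using sc_rees[OF gs g] by simp
  finally show ?case .
qed

text \<open>A monomial of large degree contains a high power of some generator. \<open>Q\<close> may
  also be a constant family, and in that form the lemma turns powers of elements into powers of an
  ideal.\<close>

lemma rees_eventually_le:
  assumes "set gs \<subseteq> carrier R" and Q: "\<And>n. sm (Q n)"
    and "\<And>g n. g \<in> set gs \<Longrightarrow> sc g (Q n) \<subseteq> Q (Suc n)"
    and "\<And>g. g \<in> set gs \<Longrightarrow> \<exists>k::nat. \<forall>n. sc (g [^] k) (rees gs n) \<subseteq> Q (n + k)"
  shows "\<exists>K. \<forall>n\<ge>K. rees gs n \<subseteq> Q n"
  using assms(1,3,4)
proof (induction gs)
  case Nil
  have "rees [] n \<subseteq> Q n" if "n \<ge> 1" for n using that sm_zero[OF Q[of n]] by simp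
  then show ?case by blast
next
  case (Cons g gs)
  have gs: "set gs \<subseteq> carrier R" and g: "g \<in> carrier R" using Cons.prems by auto
  have smr: "\<forall>n. sm (rees gs n)" using sm_rees gs by simp
  have le: "rees gs n \<subseteq> rees (g # gs) n" for n
    using psum_term[of g "rees gs", OF g smr, of 0 n] smr by (simp add: sc_one)
  have "\<exists>K. \<forall>n\<ge>K. rees gs n \<subseteq> Q n"
  proof (rule Cons.IH[OF gs])
    show "sc h (Q n) \<subseteq> Q (Suc n)" if "h \<in> set gs" for h n using Cons.prems(2)[of h n] that by simp
    show "\<exists>k::nat. \<forall>n. sc (h [^] k) (rees gs n) \<subseteq> Q (n + k)" if h: "h \<in> set gs" for h
    proof -
      obtain k :: nat where "\<forall>n. sc (h [^] k) (rees (g # gs) n) \<subseteq> Q (n + k)"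
        using Cons.prems(3)[of h] h by auto
      then have "\<forall>n. sc (h [^] k) (rees gs n) \<subseteq> Q (n + k)" using sc_mono[OF le] by blast
      then show ?thesis by blast
    qed
  qed
  then obtain K where K: "\<forall>n\<ge>K. rees gs n \<subseteq> Q n" ..
  obtain k :: nat where k: "\<forall>n. sc (g [^] k) (rees (g # gs) n) \<subseteq> Q (n + k)"
    using Cons.prems(3)[of g] by auto
  have Qpow: "sc (g [^] j) (Q n) \<subseteq> Q (n + j)" for j n :: nat
  proof (induction j)
    case 0
    then show ?case using Q by (simp add: sc_one)
  next
    case (Suc j)
    have "sc (g [^] Suc j) (Q n) = sc g (sc (g [^] j) (Q n))" using sc_Suc_pow[OF g Q] by simp
    also have "\<dots> \<subseteq> sc g (Q (n + j))" using Suc by (rule sc_mono)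
    also have "\<dots> \<subseteq> Q (n + Suc j)" using Cons.prems(2)[of g] by simp
    finally show ?case .
  qed
  have "psum g (rees gs) j n \<subseteq> Q n" if n: "n \<ge> K + k" for j n
  proof (induction j)
    case 0
    then show ?case using sm_zero[OF Q] by simp
  next
    case (Suc j)
    have "sc (g [^] j) (rees gs (n - j)) \<subseteq> Q n" if "j \<le> n"
    \<comment> \<open>Either the factor in the other generators has degree at least
      \<open>K\<close>, or \<open>n \<ge> K + k\<close> forces the exponent \<open>j\<close> of
      \<open>g\<close> to be at least \<open>k\<close>.\<close>
    proof (cases "n - j \<ge> K")
      case True
      then have "sc (g [^] j) (rees gs (n - j)) \<subseteq> sc (g [^] j) (Q (n - j))" using K by (intro sc_mono) simp
      also have "\<dots> \<subseteq> Q n" using Qpow[of j "n - j"] that by simp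
      finally show ?thesis .
    next
      case False
      then have jk: "k \<le> j" using n by simp
      have e: "j - k \<le> n - k" "n - k - (j - k) = n - j" "n - k + k = n" using jk that n by auto
      have "g [^] j = g [^] k \<otimes> g [^] (j - k)" using nat_pow_mult[OF g, of k "j - k"] jk by simp
      then have "sc (g [^] j) (rees gs (n - j)) = sc (g [^] k) (sc (g [^] (j - k)) (rees gs (n - j)))"
        using smr g by (simp add: sc_sc)
      also have "\<dots> \<subseteq> sc (g [^] k) (rees (g # gs) (n - k))"
        using psum_term[of g "rees gs", OF g smr e(1)] unfolding e(2) rees.simps(2) by (rule sc_mono)
      also have "\<dots> \<subseteq> Q n" using k[rule_format, of "n - k"] unfolding e(3) .
      finally show ?thesis .
    qed
    then have "(if j \<le> n then sc (g [^] j) (rees gs (n - j)) else {\<zero>\<^bsub>M\<^esub>}) \<subseteq> Q n"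
      using sm_zero[OF Q] by simp
    then show ?case unfolding psum.simps by (intro join_least Q Suc)
  qed
  then have "\<forall>n\<ge>K + k. rees (g # gs) n \<subseteq> Q n" unfolding rees.simps(2) by blast
  then show ?case by blast
qed

definition zero_divisors :: "'a list \<Rightarrow> (nat \<Rightarrow> 'c set) \<Rightarrow> 'a set" where
  "zero_divisors gs Q = {y \<in> Idl (set gs). \<exists>n. \<exists>u\<in>rees gs n. u \<notin> Q n \<and> y *\<^sub>M u \<in> Q (Suc n)}"

text \<open>For zero divisors \<open>y\<close> and \<open>z\<close>, the colons of \<open>Q\<close>
  by \<open>y\<close> and by \<open>z\<close> are both strictly larger than \<open>Q\<close>. By
  irreducibility so is their intersection, and an element of it outside \<open>Q\<close> is carried
  into \<open>Q\<close> by \<open>y \<oplus> z\<close>.\<close>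

lemma ideal_zero_divisors:
  assumes gs: "set gs \<subseteq> carrier R" and irr: "meet_irreducible (graded gs) Q" and ne: "Q \<noteq> rees gs"
  shows "ideal (zero_divisors gs Q) R"
proof -
  let ?I = "Idl (set gs)"
  have I: "ideal ?I R" by (rule genideal_ideal[OF gs])
  have Q: "graded gs Q" using irr unfolding meet_irreducible_def by blast
  have Qc: "sm (Q n)" for n by (rule gradedD(1)[OF Q])
  have rc: "u \<in> carrier M" if "u \<in> rees gs n" for u n using sm_carrier[OF sm_rees[OF gs] that] .
  have Ic: "y \<in> carrier R" if "y \<in> ?I" for y using ideal.Icarr[OF I that] .
  have zero: "\<zero> \<in> zero_divisors gs Q"
  proof -
    obtain n where "Q n \<noteq> rees gs n" using ne by blast
    then obtain u where "u \<in> rees gs n" "u \<notin> Q n" using gradedD(2)[OF Q, of n] by blast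
    then show ?thesis unfolding zero_divisors_def
      using rc sm_zero[OF Qc] additive_subgroup.zero_closed[OF ideal.axioms(1)[OF I]] by auto
  qed
  have mult: "a \<otimes> y \<in> zero_divisors gs Q" if a: "a \<in> carrier R" and y: "y \<in> zero_divisors gs Q" for a y
  proof -
    obtain n u where u: "y \<in> ?I" "u \<in> rees gs n" "u \<notin> Q n" "y *\<^sub>M u \<in> Q (Suc n)"
      using y unfolding zero_divisors_def by blast
    have "(a \<otimes> y) *\<^sub>M u \<in> Q (Suc n)"
      using sm_smult[OF Qc a u(4)] a Ic[OF u(1)] rc[OF u(2)] by (simp add: smult_assoc1)
    moreover have "a \<otimes> y \<in> ?I" using ideal.I_l_closed[OF I u(1) a] .
    ultimately show ?thesis unfolding zero_divisors_def using u by blast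
  qed
  have add: "y \<oplus> z \<in> zero_divisors gs Q" if y: "y \<in> zero_divisors gs Q" and z: "z \<in> zero_divisors gs Q" for y z
  proof -
    have yz: "y \<in> ?I" "z \<in> ?I" using y z unfolding zero_divisors_def by blast+
    let ?C = "\<lambda>y. colon_family gs Q y 1"
    have neq: "Q \<noteq> ?C w" if w: "w \<in> zero_divisors gs Q" for w
    proof
      assume e: "Q = ?C w"
      obtain n u where u: "u \<in> rees gs n" "u \<notin> Q n" "w *\<^sub>M u \<in> Q (Suc n)"
        using w unfolding zero_divisors_def by blast
      then have "u \<in> ?C w n" unfolding colon_family_def colon_def using rc by simp
      then show False using e u by metis
    qed
    have gr: "graded gs (?C y)" "graded gs (?C z)" using graded_colon_family Q gs Ic yz by auto
    then have "Q \<noteq> inf (?C y) (?C z)"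
      using irr[unfolded meet_irreducible_def, THEN conjunct2, rule_format, OF gr] neq[OF y] neq[OF z] by auto
    moreover have "Q \<le> inf (?C y) (?C z)"
      unfolding le_fun_def colon_family_def colon_def
      using gradedD(2)[OF Q] graded_smult[OF Q gs] yz sm_carrier[OF Qc] by auto
    ultimately obtain n u where u: "u \<in> inf (?C y) (?C z) n" "u \<notin> Q n"
      unfolding le_fun_def by (metis ext subsetI subset_antisym)
    then have u': "u \<in> rees gs n" "y *\<^sub>M u \<in> Q (Suc n)" "z *\<^sub>M u \<in> Q (Suc n)"
      unfolding colon_family_def colon_def by auto
    have "(y \<oplus> z) *\<^sub>M u \<in> Q (Suc n)"
      using sm_add[OF Qc u'(2,3)] Ic yz rc[OF u'(1)] by (simp add: smult_l_distr)
    moreover have "y \<oplus> z \<in> ?I"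
      using additive_subgroup.a_closed[OF ideal.axioms(1)[OF I]] yz by blast
    ultimately show ?thesis unfolding zero_divisors_def using u u' by blast
  qed
  have sub: "y \<in> carrier R" if "y \<in> zero_divisors gs Q" for y
    using that Ic unfolding zero_divisors_def by blast
  show ?thesis
  proof (rule idealI[OF R.ring_axioms])
    show "subgroup (zero_divisors gs Q) (add_monoid R)"
    proof (rule R.add.subgroupI)
      show "\<ominus> y \<in> zero_divisors gs Q" if "y \<in> zero_divisors gs Q" for y
        using mult[of "\<ominus> \<one>" y] that sub by (simp add: l_minus)
    qed (use sub zero add in auto)
    show "a \<otimes> y \<in> zero_divisors gs Q" if "y \<in> zero_divisors gs Q" "a \<in> carrier R" for a y
      using mult that by blast
    show "y \<otimes> a \<in> zero_divisors gs Q" if "y \<in> zero_divisors gs Q" "a \<in> carrier R" for a y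
      using mult[OF that(2,1)] m_comm[OF sub[OF that(1)] that(2)] by simp
  qed
qed

text \<open>Noether's argument that irreducible submodules are primary. The colons by powers of
  \<open>g\<close> become stationary at some \<open>k\<close>; then \<open>Q\<close> is the
  intersection of its colon by \<open>g\<close> with \<open>S\<close>, the sum of \<open>Q\<close>
  and the multiples of \<open>g [^] k\<close>. The colon is strictly larger because \<open>g\<close>
  is a zero divisor, so \<open>Q = S\<close>.\<close>

lemma irreducible_pow_le:
  assumes gs: "set gs \<subseteq> carrier R" and irr: "meet_irreducible (graded gs) Q"
    and g: "g \<in> set gs" "g \<in> zero_divisors gs Q"
  shows "\<exists>k::nat. \<forall>n. sc (g [^] k) (rees gs n) \<subseteq> Q (n + k)"
proof -
  have Q: "graded gs Q" using irr unfolding meet_irreducible_def by blast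
  have Qc: "sm (Q n)" for n by (rule gradedD(1)[OF Q])
  have rc: "u \<in> carrier M" if "u \<in> rees gs n" for u n using sm_carrier[OF sm_rees[OF gs] that] .
  have gc: "g \<in> carrier R" using g gs by blast
  have gk: "g [^] k \<in> carrier R" for k :: nat using gc by simp
  have smr: "sm (rees gs n)" for n by (rule sm_rees[OF gs])
  let ?C = "\<lambda>k::nat. colon_family gs Q (g [^] k) k"
  have pow: "g [^] Suc k *\<^sub>M u = g *\<^sub>M (g [^] k *\<^sub>M u)" if "u \<in> carrier M" for k :: nat and u
    using that gc gk by (simp add: smult_assoc1[symmetric] m_comm)
  have "\<exists>K. \<forall>k\<ge>K. ?C k = ?C K"
  proof (rule accD[OF acc_graded[OF gs]])
    show "graded gs (?C k)" for k by (rule graded_colon_family[OF Q gs gk])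
    show "?C k \<le> ?C (Suc k)" for k
      unfolding le_fun_def colon_family_def colon_def
      using gradedD(3)[OF Q g(1)] scI pow by auto (metis scI subsetD)
  qed
  then obtain k where "\<forall>k'\<ge>k. ?C k' = ?C k" ..
  then have k: "?C (Suc k) = ?C k" using le_SucI[OF order_refl] by blast
  define S where "S n = Q n \<uplus> (if k \<le> n then sc (g [^] k) (rees gs (n - k)) else {\<zero>\<^bsub>M\<^esub>})" for n
  have smT: "sm (if k \<le> n then sc (g [^] k) (rees gs (n - k)) else {\<zero>\<^bsub>M\<^esub>})" for n
    using sm_sc[OF gk smr] sm_zero_set by simp
  have S: "graded gs S"
  proof (rule gradedI)
    show "sm (S n)" for n unfolding S_def by (intro sm_join Qc smT)
    show "S n \<subseteq> rees gs n" for n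
      unfolding S_def using gradedD(2)[OF Q, of n] sc_pow_rees[OF gs g(1), of k "n - k"] sm_zero[OF smr[of n]]
      by (intro join_least smr) auto
    fix h n u assume h: "h \<in> set gs" and "u \<in> S n"
    then obtain q w where u: "u = q +\<^sub>M w" "q \<in> Q n" "w \<in> (if k \<le> n then sc (g [^] k) (rees gs (n - k)) else {\<zero>\<^bsub>M\<^esub>})"
      unfolding S_def by (auto elim: joinE)
    have hc: "h \<in> carrier R" using h gs by blast
    have c: "q \<in> carrier M" "w \<in> carrier M" using u Qc smT sm_carrier by blast+
    have "h *\<^sub>M q \<in> Q (Suc n)" using gradedD(3)[OF Q h, of n] u scI by blast
    moreover have "h *\<^sub>M w \<in> (if k \<le> Suc n then sc (g [^] k) (rees gs (Suc n - k)) else {\<zero>\<^bsub>M\<^esub>})"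
    proof (cases "k \<le> n")
      case True
      then obtain v where v: "w = g [^] k *\<^sub>M v" "v \<in> rees gs (n - k)" using u unfolding sc_def by auto
      have "h *\<^sub>M v \<in> rees gs (Suc n - k)" using sc_rees[OF gs h, of "n - k"] v scI True by (auto simp: Suc_diff_le)
      moreover have "h *\<^sub>M w = g [^] k *\<^sub>M (h *\<^sub>M v)" using v rc hc gk by (simp add: smult_left_commute)
      ultimately show ?thesis using True scI by simp
    next
      case False
      then show ?thesis using u hc sm_zero[OF smT[of "Suc n"]] by simp
    qed
    ultimately show "h *\<^sub>M u \<in> S (Suc n)" unfolding S_def using u c hc by (simp only: smult_r_distr joinI)
  qed
  have eq: "Q = inf (colon_family gs Q g 1) S"
  proof (rule order_antisym)
    show "Q \<le> inf (colon_family gs Q g 1) S"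
      unfolding le_fun_def
    proof
      fix n
      have "Q n \<subseteq> colon_family gs Q g 1 n"
        unfolding colon_family_def colon_def
        using gradedD(2)[OF Q, of n] gradedD(3)[OF Q g(1), of n] scI sm_carrier[OF Qc] by auto
      moreover have "Q n \<subseteq> S n" unfolding S_def by (rule join_upper1[OF Qc smT])
      ultimately show "Q n \<subseteq> inf (colon_family gs Q g 1) S n" by simp
    qed
    show "inf (colon_family gs Q g 1) S \<le> Q"
      unfolding le_fun_def
    proof (intro allI subsetI)
      fix n u assume "u \<in> inf (colon_family gs Q g 1) S n"
      then have u: "u \<in> rees gs n" "g *\<^sub>M u \<in> Q (Suc n)" "u \<in> S n"
        unfolding colon_family_def colon_def by auto
      then obtain q w where qw: "u = q +\<^sub>M w" "q \<in> Q n" "w \<in> (if k \<le> n then sc (g [^] k) (rees gs (n - k)) else {\<zero>\<^bsub>M\<^esub>})"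
        unfolding S_def by (auto elim: joinE)
      have c: "q \<in> carrier M" "w \<in> carrier M" using qw Qc smT sm_carrier by blast+
      show "u \<in> Q n"
      proof (cases "k \<le> n")
        case False
        then show ?thesis using qw c by simp
      next
        case True
        then obtain v where v: "w = g [^] k *\<^sub>M v" "v \<in> rees gs (n - k)" using qw unfolding sc_def by auto
        have "g *\<^sub>M q \<in> Q (Suc n)" using gradedD(3)[OF Q g(1), of n] qw scI by blast
        then have "g *\<^sub>M w \<in> Q (Suc n)"
          using sm_addD2[OF Qc[of "Suc n"], of "g *\<^sub>M w" "g *\<^sub>M q"] u(2) qw c gc by (simp add: smult_r_distr)
        then have "v \<in> ?C (Suc k) (n - k)"
          unfolding colon_family_def colon_def using v rc[OF v(2)] True pow by simp
        then have "v \<in> ?C k (n - k)" using fun_cong[OF k, of "n - k"] by blast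
        then have "w \<in> Q n" using v True unfolding colon_family_def colon_def by simp
        then show ?thesis using qw sm_add[OF Qc] by simp
      qed
    qed
  qed
  have neq: "Q \<noteq> colon_family gs Q g 1"
  proof
    assume e: "Q = colon_family gs Q g 1"
    obtain n u where u: "u \<in> rees gs n" "u \<notin> Q n" "g *\<^sub>M u \<in> Q (Suc n)"
      using g(2) unfolding zero_divisors_def by blast
    then have "u \<in> colon_family gs Q g 1 n" unfolding colon_family_def colon_def using rc by simp
    then show False using e u by metis
  qed
  have "Q = colon_family gs Q g 1 \<or> Q = S"
    using irr[unfolded meet_irreducible_def, THEN conjunct2, rule_format,
      OF graded_colon_family[OF Q gs gc] S eq] .
  then have "Q = S" using neq by simp
  then have SQ: "S (n + k) = Q (n + k)" for n by simp
  have "sc (g [^] k) (rees gs n) \<subseteq> S (n + k)" for n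
    using join_upper2[OF Qc smT, of "n + k" "n + k"] by (simp add: S_def)
  then have "sc (g [^] k) (rees gs n) \<subseteq> Q (n + k)" for n by (simp only: SQ)
  then show ?thesis by blast
qed

text \<open>\<open>\<B>\<close> consists of the zero divisors modulo those irreducible components of \<open>Z\<close> for which they are
  not the whole ideal. The other components contain the Rees module in large degrees.\<close>

lemma general_nonzerodivisor:
  assumes gs: "set gs \<subseteq> carrier R" and Z: "graded gs Z"
  shows "\<exists>\<B>. finite \<B> \<and> (\<forall>B\<in>\<B>. ideal B R \<and> \<not> Idl (set gs) \<subseteq> B) \<and>
    (\<forall>x\<in>Idl (set gs). x \<notin> \<Union>\<B> \<longrightarrow> (\<exists>K. \<forall>n\<ge>K. \<forall>u\<in>rees gs n. x *\<^sub>M u \<in> Z (Suc n) \<longrightarrow> u \<in> Z n))"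
proof -
  let ?I = "Idl (set gs)"
  obtain \<Q> where \<Q>: "finite \<Q>" "\<And>q. q \<in> \<Q> \<Longrightarrow> meet_irreducible (graded gs) q" "\<And>q. q \<in> \<Q> \<Longrightarrow> Z \<le> q"
    "\<And>y. (\<And>q. q \<in> \<Q> \<Longrightarrow> y \<le> q) \<Longrightarrow> y \<le> Z"
    using irreducible_decomposition[where P = "graded gs" and z = Z, OF acc_graded[OF gs] Z] by metis
  define \<Q>1 where "\<Q>1 = {q \<in> \<Q>. q \<noteq> rees gs \<and> \<not> ?I \<subseteq> zero_divisors gs q}"
  have "\<exists>K. \<forall>n\<ge>K. rees gs n \<subseteq> q n" if q: "q \<in> \<Q>" "q \<notin> \<Q>1" for q
  proof (cases "q = rees gs")
    case False
    then have full: "?I \<subseteq> zero_divisors gs q" using q unfolding \<Q>1_def by blast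
    have gq: "graded gs q" using \<Q>(2)[OF q(1)] unfolding meet_irreducible_def by blast
    show ?thesis
    proof (rule rees_eventually_le[OF gs])
      show "sm (q n)" for n by (rule gradedD(1)[OF gq])
      show "sc g (q n) \<subseteq> q (Suc n)" if "g \<in> set gs" for g n by (rule gradedD(3)[OF gq that])
      show "\<exists>k::nat. \<forall>n. sc (g [^] k) (rees gs n) \<subseteq> q (n + k)" if "g \<in> set gs" for g
        using irreducible_pow_le[OF gs \<Q>(2)[OF q(1)] that] full genideal_self[OF gs] that by blast
    qed
  qed auto
  then obtain Kq where Kq: "\<And>q n. q \<in> \<Q> \<Longrightarrow> q \<notin> \<Q>1 \<Longrightarrow> n \<ge> Kq q \<Longrightarrow> rees gs n \<subseteq> q n" by metis
  define K where "K = Max (insert 0 (Kq ` \<Q>))"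
  have K: "Kq q \<le> K" if "q \<in> \<Q>" for q unfolding K_def using that \<Q>(1) by (intro Max_ge) auto
  show ?thesis
  proof (intro exI[of _ "zero_divisors gs ` \<Q>1"] conjI ballI impI)
    show "finite (zero_divisors gs ` \<Q>1)" using \<Q>(1) unfolding \<Q>1_def by simp
    show "ideal B R" "\<not> ?I \<subseteq> B" if "B \<in> zero_divisors gs ` \<Q>1" for B
      using that ideal_zero_divisors[OF gs] \<Q>(2) unfolding \<Q>1_def by auto
    fix x assume x: "x \<in> ?I" "x \<notin> \<Union>(zero_divisors gs ` \<Q>1)"
    have "u \<in> Z n" if n: "n \<ge> K" and u: "u \<in> rees gs n" and xu: "x *\<^sub>M u \<in> Z (Suc n)" for n u
    proof -
      have uq: "u \<in> q n" if q: "q \<in> \<Q>" for q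
      proof (cases "q \<in> \<Q>1")
        case True
        then have "x \<notin> zero_divisors gs q" using x by blast
        moreover have "x *\<^sub>M u \<in> q (Suc n)" using xu \<Q>(3)[OF q] unfolding le_fun_def by blast
        ultimately show ?thesis using u x(1) unfolding zero_divisors_def by blast
      next
        case False
        then show ?thesis using Kq[OF q False, of n] K[OF q] n u by auto
      qed
      \<comment> \<open>A family with the single element \<open>u\<close> in degree
        \<open>n\<close>. It is not graded, but the decomposition tests \<open>Z\<close> against
        arbitrary families.\<close>
      define y where "y = (\<lambda>i. if i = n then {u} else {})"
      have "y \<le> q" if "q \<in> \<Q>" for q unfolding y_def le_fun_def using uq[OF that] by simp
      then have "y \<le> Z" by (rule \<Q>(4))
      then show ?thesis unfolding y_def le_fun_def by (metis insert_subset)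
    qed
    then show "\<exists>K. \<forall>n\<ge>K. \<forall>u\<in>rees gs n. x *\<^sub>M u \<in> Z (Suc n) \<longrightarrow> u \<in> Z n" by blast
  qed
qed

text \<open>The graded submodules \<open>f k\<close> keep \<open>W\<close> up to degree
  \<open>k\<close> and are generated from degree \<open>k\<close> onwards. They increase with
  \<open>k\<close>, hence become stationary at some \<open>c\<close>, and comparing
  \<open>f (n + c)\<close> with \<open>f c\<close> in degree \<open>n + c\<close> gives the
  inclusion.\<close>

lemma artin_rees:
  assumes gs: "set gs \<subseteq> carrier R" and W: "graded gs W"
  shows "\<exists>c. \<forall>n. W (n + c) \<subseteq> pw (Idl (set gs)) n (W c)"
proof -
  let ?I = "Idl (set gs)"
  have Ic: "?I \<subseteq> carrier R" by (rule ideal_subset[OF genideal_ideal[OF gs]])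
  have Wc: "sm (W n)" for n by (rule gradedD(1)[OF W])
  define f where "f k n = (if n \<le> k then W n else pw ?I (n - k) (W k))" for k n
  have actW: "act ?I (W n) \<subseteq> W (Suc n)" for n
    by (intro act_genideal_least gs Wc gradedD(3)[OF W])
  have pwW: "pw ?I j (W k) \<subseteq> W (k + j)" for j k
  proof (induction j)
    case (Suc j)
    have "pw ?I (Suc j) (W k) \<subseteq> act ?I (W (k + j))" using act_mono[OF Ic Wc Suc] by simp
    then show ?case using actW[of "k + j"] by simp
  qed simp
  have "\<exists>c. \<forall>k\<ge>c. f k = f c"
  proof (rule accD[OF acc_graded[OF gs]])
    show "graded gs (f k)" for k
    proof (rule gradedI)
      show "sm (f k n)" for n unfolding f_def using sm_pw[OF Ic Wc] Wc by simp
      show "f k n \<subseteq> rees gs n" for n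
      proof (cases "n \<le> k")
        case False
        then show ?thesis using pwW[of "n - k" k] gradedD(2)[OF W, of n] unfolding f_def by simp
      qed (simp add: f_def gradedD(2)[OF W])
      fix g n u assume g: "g \<in> set gs" and u: "u \<in> f k n"
      show "g *\<^sub>M u \<in> f k (Suc n)"
      proof (cases "n < k")
        case True
        then show ?thesis using u scI gradedD(3)[OF W g, of n] unfolding f_def by auto
      next
        case False
        then have "u \<in> pw ?I (n - k) (W k)" using u unfolding f_def by (cases "n = k") auto
        then have "g *\<^sub>M u \<in> act ?I (pw ?I (n - k) (W k))" using g genideal_self[OF gs] by (intro actI) auto
        then show ?thesis using False unfolding f_def by (simp add: Suc_diff_le)
      qed
    qed
    show "f k \<le> f (Suc k)" for k
      unfolding le_fun_def
    proof
      fix n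
      consider "n \<le> k" | "n = Suc k" | "n > Suc k" by linarith
      then show "f k n \<subseteq> f (Suc k) n"
      proof cases
        case 2
        then show ?thesis using actW[of k] unfolding f_def by simp
      next
        case 3
        then have e: "n - k = Suc (n - Suc k)" by simp
        have "pw ?I (n - k) (W k) = pw ?I (n - Suc k) (act ?I (W k))" unfolding e by (rule pw_Suc2)
        also have "\<dots> \<subseteq> pw ?I (n - Suc k) (W (Suc k))" by (intro pw_mono Ic sm_act Wc actW)
        finally show ?thesis using 3 unfolding f_def by simp
      qed (simp add: f_def)
    qed
  qed
  then obtain c where c: "\<forall>k\<ge>c. f k = f c" ..
  have "W (n + c) \<subseteq> pw ?I n (W c)" for n
  proof -
    have "f (n + c) = f c" using c by (meson le_add2)
    then have "f (n + c) (n + c) = f c (n + c)" by simp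
    then show ?thesis unfolding f_def by (cases "n = 0") auto
  qed
  then show ?thesis by blast
qed

end

section \<open>Local rings with infinite residue field\<close>

locale noetherian_local = noetherian_module R M for R (structure) and M (structure) +
  fixes \<mm> :: "'a set"
  assumes local: "local_ring R \<mm>"
    and infinite_residue: "infinite (carrier (R Quot \<mm>))"
begin

lemma maximal_\<mm>: "maximalideal \<mm> R"
  using local unfolding local_ring_def by blast

lemma ideal_\<mm>: "ideal \<mm> R"
  using maximal_\<mm> maximalideal.axioms(1) by blast

lemma \<mm>_subset: "\<mm> \<subseteq> carrier R"
  by (rule ideal_subset[OF ideal_\<mm>])

lemma proper_ideal_le:
  assumes "ideal J R" "J \<noteq> carrier R"
  shows "J \<subseteq> \<mm>"
proof -
  obtain K where K: "ideal K R \<and> K \<noteq> carrier R \<and> J \<subseteq> K"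
    and max: "\<forall>L. ideal L R \<and> L \<noteq> carrier R \<and> J \<subseteq> L \<longrightarrow> K \<subseteq> L \<longrightarrow> L = K"
    using acc_maximal[OF acc_ideal, of "\<lambda>K. ideal K R \<and> K \<noteq> carrier R \<and> J \<subseteq> K" J] assms by blast
  have "maximalideal K R"
  proof (rule maximalidealI)
    show "L = K \<or> L = carrier R" if "ideal L R" "K \<subseteq> L" "L \<subseteq> carrier R" for L
      using max[THEN spec, of L] that K by auto
  qed (use K in auto)
  then show ?thesis using K local unfolding local_ring_def by auto
qed

lemma unit:
  assumes a: "a \<in> carrier R" "a \<notin> \<mm>"
  obtains b where "b \<in> carrier R" "b \<otimes> a = \<one>"
proof -
  have "ideal (PIdl a) R" "a \<in> PIdl a" using a cgenideal_ideal cgenideal_self by auto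
  then have "PIdl a = carrier R" using proper_ideal_le a by blast
  then have "\<one> \<in> PIdl a" by simp
  then obtain b where "b \<in> carrier R" "\<one> = b \<otimes> a" unfolding cgenideal_def by blast
  then show thesis using that by simp
qed

lemma one_not_in: "\<one> \<notin> \<mm>"
  using ideal.one_imp_carrier[OF ideal_\<mm>] maximalideal.I_notcarr[OF maximal_\<mm>] by blast

lemma one_minus_not_in:
  assumes "c \<in> \<mm>"
  shows "\<one> \<ominus> c \<notin> \<mm>"
proof
  assume "\<one> \<ominus> c \<in> \<mm>"
  then have "(\<one> \<ominus> c) \<oplus> c \<in> \<mm>"
    using additive_subgroup.a_closed[OF ideal.axioms(1)[OF ideal_\<mm>]] assms by blast
  moreover have "(\<one> \<ominus> c) \<oplus> c = \<one>"
    using assms \<mm>_subset by (auto simp: R.minus_eq R.a_assoc R.l_neg subsetD)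
  ultimately show False using one_not_in by simp
qed

lemma smult_unit_cancel:
  assumes V: "sm V" and a: "a \<in> carrier R" "a \<notin> \<mm>" and v: "v \<in> carrier M" "a *\<^sub>M v \<in> V"
  shows "v \<in> V"
proof -
  obtain b where b: "b \<in> carrier R" "b \<otimes> a = \<one>" using unit[OF a] .
  then have "b *\<^sub>M (a *\<^sub>M v) = v" using a v by (simp add: smult_assoc1[symmetric])
  then show ?thesis using sm_smult[OF V b(1) v(2)] by simp
qed

text \<open>One representative is chosen in each residue class. Distinct ones differ by a unit,
  which is the form in which the infinite residue field is used.\<close>

lemma residue_representatives:
  "\<exists>T. infinite T \<and> T \<subseteq> carrier R \<and> (\<forall>t\<in>T. \<forall>t'\<in>T. t \<noteq> t' \<longrightarrow> t \<ominus> t' \<notin> \<mm>)"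
proof -
  let ?C = "carrier (R Quot \<mm>)"
  have "\<forall>C\<in>?C. \<exists>t\<in>carrier R. C = \<mm> +> t"
    unfolding FactRing_def A_RCOSETS_def' by auto
  then obtain r where r: "\<And>C. C \<in> ?C \<Longrightarrow> r C \<in> carrier R" "\<And>C. C \<in> ?C \<Longrightarrow> C = \<mm> +> r C" by metis
  have inj: "inj_on r ?C" using r(2) by (metis inj_onI)
  show ?thesis
  proof (intro exI[of _ "r ` ?C"] conjI ballI impI)
    show "infinite (r ` ?C)" using infinite_residue inj finite_imageD by blast
    show "r ` ?C \<subseteq> carrier R" using r by blast
    fix t t' assume t: "t \<in> r ` ?C" "t' \<in> r ` ?C" "t \<noteq> t'"
    then obtain C C' where C: "C \<in> ?C" "C' \<in> ?C" "t = r C" "t' = r C'" by blast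
    show "t \<ominus> t' \<notin> \<mm>"
    proof
      assume "t \<ominus> t' \<in> \<mm>"
      then have "\<mm> +> t = \<mm> +> t'"
        using quotient_eq_iff_same_a_r_cos[OF ideal_\<mm>, of t t'] C r by blast
      then have "C = C'" using r(2) C by metis
      then show False using C t by simp
    qed
  qed
qed

text \<open>On the line \<open>w \<oplus> t \<otimes> x\<close>, with \<open>x\<close> outside the
  old ideals, two parameters with values in the same old ideal differ by a unit and would put
  \<open>x\<close> into it. So each old ideal excludes only finitely many \<open>t\<close>, and the
  new ideal excludes none, since it contains \<open>x\<close> but not \<open>w\<close>.\<close>

lemma avoidance:
  assumes "finite \<B>" and "\<And>B. B \<in> \<B> \<Longrightarrow> ideal B R \<and> \<not> J \<subseteq> B" and J: "ideal J R"
  shows "\<exists>x\<in>J. x \<notin> \<Union>\<B>"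
  using assms(1,2)
proof (induction \<B>)
  case empty
  then show ?case using additive_subgroup.zero_closed[OF ideal.axioms(1)[OF J]] by auto
next
  case (insert B \<B>)
  then obtain x where x: "x \<in> J" "x \<notin> \<Union>\<B>" by blast
  show ?case
  proof (cases "x \<in> B")
    case False
    then show ?thesis using x by blast
  next
    case True
    have B: "ideal B R" and "\<not> J \<subseteq> B" using insert.prems by auto
    then obtain w where w: "w \<in> J" "w \<notin> B" by blast
    have c: "x \<in> carrier R" "w \<in> carrier R" using x w ideal.Icarr[OF J] by auto
    obtain T where T: "infinite T" "T \<subseteq> carrier R" "\<forall>t\<in>T. \<forall>t'\<in>T. t \<noteq> t' \<longrightarrow> t \<ominus> t' \<notin> \<mm>"
      using residue_representatives by blast
    have fin: "finite {t \<in> T. w \<oplus> t \<otimes> x \<in> B'}" if B': "B' \<in> \<B>" for B'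
    proof (rule ccontr)
      assume inf: "infinite {t \<in> T. w \<oplus> t \<otimes> x \<in> B'}"
      then obtain t where t: "t \<in> T" "w \<oplus> t \<otimes> x \<in> B'"
        using infinite_imp_nonempty[OF inf] by blast
      have "{t \<in> T. w \<oplus> t \<otimes> x \<in> B'} - {t} \<noteq> {}"
        using infinite_imp_nonempty[OF infinite_remove[OF inf]] .
      then obtain t' where t': "t' \<in> T" "w \<oplus> t' \<otimes> x \<in> B'" "t \<noteq> t'" by blast
      have tc: "t \<in> carrier R" "t' \<in> carrier R" using t t' T by auto
      have iB: "ideal B' R" using insert.prems B' by auto
      note sB = ideal.axioms(1)[OF iB]
      have "(w \<oplus> t \<otimes> x) \<ominus> (w \<oplus> t' \<otimes> x) \<in> B'"
        unfolding R.minus_eq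
        by (intro additive_subgroup.a_closed[OF sB] additive_subgroup.a_inv_closed[OF sB] t t')
      moreover have "(w \<oplus> t \<otimes> x) \<ominus> (w \<oplus> t' \<otimes> x) = (t \<ominus> t') \<otimes> x"
        using c tc by algebra
      ultimately have d: "(t \<ominus> t') \<otimes> x \<in> B'" by simp
      obtain b where b: "b \<in> carrier R" "b \<otimes> (t \<ominus> t') = \<one>"
        using unit[of "t \<ominus> t'"] T(3) t t' tc by auto
      have "b \<otimes> ((t \<ominus> t') \<otimes> x) \<in> B'" using ideal.I_l_closed[OF iB d b(1)] .
      then have "x \<in> B'" using b tc c by (simp add: m_assoc[symmetric])
      then show False using x B' by blast
    qed
    have "finite (\<Union>B'\<in>\<B>. {t \<in> T. w \<oplus> t \<otimes> x \<in> B'})" using fin insert.hyps by blast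
    then obtain t where t: "t \<in> T" "\<And>B'. B' \<in> \<B> \<Longrightarrow> w \<oplus> t \<otimes> x \<notin> B'"
      using T(1) finite_subset[of T "\<Union>B'\<in>\<B>. {t \<in> T. w \<oplus> t \<otimes> x \<in> B'}"] by blast
    have tc: "t \<in> carrier R" using t T by auto
    have tx: "t \<otimes> x \<in> J" "t \<otimes> x \<in> B" using ideal.I_l_closed[OF J x(1) tc] ideal.I_l_closed[OF B True tc] by auto
    have "w \<oplus> t \<otimes> x \<notin> B"
    proof
      assume "w \<oplus> t \<otimes> x \<in> B"
      then have "(w \<oplus> t \<otimes> x) \<oplus> \<ominus> (t \<otimes> x) \<in> B"
        using additive_subgroup.a_closed[OF ideal.axioms(1)[OF B]]
          additive_subgroup.a_inv_closed[OF ideal.axioms(1)[OF B] tx(2)] by blast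
      then show False using w c tc by (simp add: R.a_assoc R.r_neg)
    qed
    moreover have "w \<oplus> t \<otimes> x \<in> J" using w tx additive_subgroup.a_closed[OF ideal.axioms(1)[OF J]] by blast
    ultimately show ?thesis using t by blast
  qed
qed

text \<open>A maximal proper submodule of \<open>V + W\<close> containing \<open>W\<close> also contains \<open>\<mm> (V + W)\<close>, which excludes
  \<open>V \<subseteq> \<mm> V + W\<close>.\<close>

lemma nakayama:
  assumes V: "sm V" and W: "sm W" and le: "V \<subseteq> act \<mm> V \<uplus> W"
  shows "V \<subseteq> W"
proof (rule ccontr)
  assume "\<not> V \<subseteq> W"
  let ?P = "\<lambda>N. sm N \<and> W \<subseteq> N \<and> \<not> V \<subseteq> N \<and> N \<subseteq> V \<uplus> W"
  have VW: "sm (V \<uplus> W)" using V W by (rule sm_join)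
  obtain N where N: "sm N" "W \<subseteq> N" "\<not> V \<subseteq> N" "N \<subseteq> V \<uplus> W"
    and max: "\<forall>L. ?P L \<longrightarrow> N \<subseteq> L \<longrightarrow> L = N"
    using acc_maximal[OF acc_sm, of ?P W] W \<open>\<not> V \<subseteq> W\<close> join_upper2[OF V W] by blast
  obtain u where u: "u \<in> V" "u \<notin> N" using N by blast
  have uc: "u \<in> carrier M" using u V sm_carrier by blast
  have top: "V \<subseteq> L" if L: "sm L" "N \<subseteq> L" "L \<noteq> N" "L \<subseteq> V \<uplus> W" for L
    using max[THEN spec, of L] L N by blast
  \<comment> \<open>Otherwise adjoining \<open>a *\<^sub>M u\<close> to \<open>N\<close> reaches
    \<open>u\<close> by maximality. Then \<open>u\<close> is an element of \<open>N\<close> plus the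
    multiple of \<open>u\<close> by \<open>c \<otimes> a\<close>, and
    \<open>\<one> \<ominus> c \<otimes> a\<close> is a unit.\<close>
  have au: "a *\<^sub>M u \<in> N" if a: "a \<in> \<mm>" for a
  proof (rule ccontr)
    assume au: "a *\<^sub>M u \<notin> N"
    have ac: "a \<in> carrier R" using a \<mm>_subset by blast
    let ?w = "a *\<^sub>M u"
    have wV: "?w \<in> V" using u ac V sm_smult by blast
    have wc: "?w \<in> carrier M" using uc ac by simp
    let ?L = "N \<uplus> (\<lambda>c. c *\<^sub>M ?w) ` carrier R"
    have C: "sm ((\<lambda>c. c *\<^sub>M ?w) ` carrier R)" by (rule sm_cyclic[OF wc])
    have "?w \<in> (\<lambda>c. c *\<^sub>M ?w) ` carrier R" using wc by (intro image_eqI[of _ _ \<one>]) auto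
    then have "?w \<in> ?L" using join_upper2[OF N(1) C] by blast
    moreover have "(\<lambda>c. c *\<^sub>M ?w) ` carrier R \<subseteq> V" using wV V sm_smult by blast
    then have "?L \<subseteq> V \<uplus> W" using join_least[OF VW N(4)] join_upper1[OF V W] by blast
    ultimately have "V \<subseteq> ?L" using top[of ?L] sm_join[OF N(1) C] join_upper1[OF N(1) C] au by blast
    then have "u \<in> ?L" using u by blast
    from join_cyclicD[OF this] obtain x c where x: "x \<in> N" "c \<in> carrier R" "u = x +\<^sub>M c *\<^sub>M ?w"
      by (elim bexE)
    have xc: "x \<in> carrier M" using x N sm_carrier by blast
    have ca: "c \<otimes> a \<in> \<mm>" using ideal.I_l_closed[OF ideal_\<mm> a x(2)] .
    have "(\<one> \<ominus> c \<otimes> a) *\<^sub>M u = u -\<^sub>M c *\<^sub>M ?w"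
      using uc ac x(2) by (simp add: R.minus_eq smult_l_distr smult_l_minus smult_assoc1 a_minus_def)
    also have "\<dots> = x"
      using xc wc x(2) by (subst x(3)) (simp add: a_minus_def M.a_assoc M.r_neg)
    finally have "(\<one> \<ominus> c \<otimes> a) *\<^sub>M u \<in> N" using x by simp
    then have "u \<in> N"
      using smult_unit_cancel[OF N(1) _ one_minus_not_in[OF ca] uc] ac x(2) by simp
    with u show False by simp
  qed
  have C: "sm ((\<lambda>c. c *\<^sub>M u) ` carrier R)" by (rule sm_cyclic[OF uc])
  let ?L = "N \<uplus> (\<lambda>c. c *\<^sub>M u) ` carrier R"
  have "u \<in> (\<lambda>c. c *\<^sub>M u) ` carrier R" using uc by (intro image_eqI[of _ _ \<one>]) auto
  then have "u \<in> ?L" using join_upper2[OF N(1) C] by blast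
  moreover have "(\<lambda>c. c *\<^sub>M u) ` carrier R \<subseteq> V" using u V sm_smult by blast
  then have "?L \<subseteq> V \<uplus> W" using join_least[OF VW N(4)] join_upper1[OF V W] by blast
  ultimately have VL: "V \<subseteq> ?L" using top[of ?L] sm_join[OF N(1) C] join_upper1[OF N(1) C] u by blast
  have "act \<mm> V \<subseteq> N"
  proof (rule act_least[OF N(1)])
    fix a v assume a: "a \<in> \<mm>" and "v \<in> V"
    then have "v \<in> ?L" using VL by blast
    from join_cyclicD[OF this] obtain x c where x: "x \<in> N" "c \<in> carrier R" "v = x +\<^sub>M c *\<^sub>M u"
      by (elim bexE)
    have ac: "a \<in> carrier R" using a \<mm>_subset by blast
    have "a *\<^sub>M v = a *\<^sub>M x +\<^sub>M c *\<^sub>M (a *\<^sub>M u)"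
      using x ac uc sm_carrier[OF N(1)] by (simp add: smult_r_distr smult_left_commute)
    then show "a *\<^sub>M v \<in> N" using sm_add[OF N(1)] sm_smult[OF N(1)] ac x au[OF a] by simp
  qed
  then have "V \<subseteq> N" using le join_least[OF N(1) _ N(2)] by blast
  with N show False by simp
qed

end

context noetherian_local
begin

section \<open>Regular elements and depth\<close>

lemma regD_diff: "reg U x \<Longrightarrow> sm U \<Longrightarrow> x \<in> carrier R \<Longrightarrow> u \<in> carrier M \<Longrightarrow> v \<in> carrier M \<Longrightarrow>
    x *\<^sub>M u -\<^sub>M x *\<^sub>M v \<in> U \<Longrightarrow> u -\<^sub>M v \<in> U"
  using regD[of U x "u -\<^sub>M v"] smult_diff[of x u v] by simp

lemma reg_pow:
  fixes k :: nat
  assumes "reg U x" "x \<in> carrier R"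
  shows "reg U (x [^] k)"
proof (induction k)
  case 0
  then show ?case unfolding reg_def by simp
next
  case (Suc k)
  show ?case unfolding reg_def
  proof (intro ballI impI)
    fix v assume v: "v \<in> carrier M" "x [^] Suc k *\<^sub>M v \<in> U"
    then have "x [^] k *\<^sub>M (x *\<^sub>M v) \<in> U" using assms by (simp add: smult_assoc1)
    then have "x *\<^sub>M v \<in> U" using regD[OF Suc] v assms by simp
    then show "v \<in> U" using regD[OF assms(1)] v by simp
  qed
qed

text \<open>The vanishing of Hom from \<open>R / J\<close> to \<open>M / U\<close>, stated on
  elements.\<close>

definition socle_free :: "'a set \<Rightarrow> 'c set \<Rightarrow> bool" where
  "socle_free J U \<longleftrightarrow> (\<forall>u\<in>carrier M. (\<forall>a\<in>J. a *\<^sub>M u \<in> U) \<longrightarrow> u \<in> U)"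

lemma socle_freeD: "socle_free J U \<Longrightarrow> u \<in> carrier M \<Longrightarrow> (\<And>a. a \<in> J \<Longrightarrow> a *\<^sub>M u \<in> U) \<Longrightarrow> u \<in> U"
  unfolding socle_free_def by blast

lemma reg_imp_socle_free: "reg U y \<Longrightarrow> y \<in> J \<Longrightarrow> socle_free J U"
  unfolding socle_free_def reg_def by blast

lemma ideal_generators:
  assumes "ideal J R"
  obtains gs where "set gs \<subseteq> carrier R" "J = Idl (set gs)"
proof -
  obtain A where A: "A \<subseteq> carrier R" "finite A" "J = Idl A" using finetely_gen[OF assms] by blast
  obtain gs where "set gs = A" using finite_list[OF A(2)] by blast
  then show thesis using that A by blast
qed

text \<open>The Rees module modulo \<open>?Z\<close> is that of \<open>M / U\<close>, so a general
  \<open>x\<close> is a nonzerodivisor on it in degrees from some \<open>K\<close> on. For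
  \<open>N = colon U x\<close> this gives \<open>pw J K N \<subseteq> U\<close>, and socle-freeness
  strips off the factors \<open>J\<close> one by one until \<open>N \<subseteq> U\<close>.\<close>

lemma general_regular:
  assumes J: "ideal J R" and U: "sm U" and sf: "socle_free J U"
  shows "\<exists>\<B>. finite \<B> \<and> (\<forall>B\<in>\<B>. ideal B R \<and> \<not> J \<subseteq> B) \<and> (\<forall>x\<in>J. x \<notin> \<Union>\<B> \<longrightarrow> reg U x)"
proof -
  obtain gs where gs: "set gs \<subseteq> carrier R" "J = Idl (set gs)" by (rule ideal_generators[OF J])
  have Jc: "J \<subseteq> carrier R" by (rule ideal_subset[OF J])
  let ?Z = "\<lambda>n. U \<inter> rees gs n"
  have "graded gs ?Z"
  proof (rule gradedI)
    show "sm (U \<inter> rees gs n)" for n by (intro sm_Int U sm_rees gs(1))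
    show "g *\<^sub>M u \<in> U \<inter> rees gs (Suc n)" if g: "g \<in> set gs" and u: "u \<in> U \<inter> rees gs n" for g n u
    proof -
      have "g \<in> carrier R" using g gs(1) by blast
      then show ?thesis using sm_smult[OF U] subsetD[OF sc_rees[OF gs(1) g, of n] scI] u by blast
    qed
  qed blast
  then obtain \<B> where \<B>: "finite \<B>" "\<forall>B\<in>\<B>. ideal B R \<and> \<not> J \<subseteq> B"
    "\<forall>x\<in>J. x \<notin> \<Union>\<B> \<longrightarrow> (\<exists>K. \<forall>n\<ge>K. \<forall>u\<in>rees gs n. x *\<^sub>M u \<in> ?Z (Suc n) \<longrightarrow> u \<in> ?Z n)"
    using general_nonzerodivisor[OF gs(1), of ?Z] unfolding gs(2) by blast
  have "reg U x" if x: "x \<in> J" "x \<notin> \<Union>\<B>" for x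
  proof -
    have xc: "x \<in> carrier R" using x Jc by blast
    obtain K where K: "\<forall>n\<ge>K. \<forall>u\<in>rees gs n. x *\<^sub>M u \<in> ?Z (Suc n) \<longrightarrow> u \<in> ?Z n"
      using \<B>(3) x by blast
    let ?N = "colon U x"
    have N: "sm ?N" by (rule sm_colon[OF xc U])
    have NK: "pw J K ?N \<subseteq> U"
    proof
      fix u assume u: "u \<in> pw J K ?N"
      have "pw J K ?N \<subseteq> ?N" by (rule pw_subset[OF Jc N])
      then have xu: "x *\<^sub>M u \<in> U" using u unfolding colon_def by blast
      have "pw J K ?N \<subseteq> pw J K (carrier M)" by (intro pw_mono Jc N sm_carrier_set sm_subset)
      then have ur: "u \<in> rees gs K" using u rees_eq_pw[OF gs(1)] gs(2) by auto
      then have "x *\<^sub>M u \<in> rees gs (Suc K)"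
        using graded_smult[OF graded_rees[OF gs(1)] gs(1)] x gs(2) by simp
      then show "u \<in> U" using K ur xu by blast
    qed
    have "pw J (K - j) ?N \<subseteq> U" if "j \<le> K" for j using that
    proof (induction j)
      case 0
      then show ?case using NK by simp
    next
      case (Suc j)
      show ?case
      proof
        fix u assume u: "u \<in> pw J (K - Suc j) ?N"
        have uc: "u \<in> carrier M" using sm_carrier[OF sm_pw[OF Jc N] u] .
        have "a *\<^sub>M u \<in> U" if "a \<in> J" for a
        proof -
          have "a *\<^sub>M u \<in> pw J (Suc (K - Suc j)) ?N" using actI[OF that u] by simp
          moreover have "Suc (K - Suc j) = K - j" using Suc.prems by simp
          ultimately show ?thesis using Suc by auto
        qed
        then show "u \<in> U" by (rule socle_freeD[OF sf uc])
      qed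
    qed
    from this[of K] have "?N \<subseteq> U" by simp
    then show ?thesis unfolding reg_def colon_def by blast
  qed
  then show ?thesis using \<B>(1,2) by blast
qed

section \<open>Quotients by one element and the exchange of regular elements\<close>

abbreviation quot :: "'c set \<Rightarrow> 'a \<Rightarrow> 'c set" where "quot U x \<equiv> U \<uplus> sc x (carrier M)"

lemma sm_quot: "sm U \<Longrightarrow> x \<in> carrier R \<Longrightarrow> sm (quot U x)"
  by (intro sm_join sm_sc sm_carrier_set)

lemma quot_upper: "sm U \<Longrightarrow> x \<in> carrier R \<Longrightarrow> U \<subseteq> quot U x"
  by (intro join_upper1 sm_sc sm_carrier_set)

lemma quotI: "q \<in> U \<Longrightarrow> w \<in> carrier M \<Longrightarrow> q +\<^sub>M x *\<^sub>M w \<in> quot U x"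
  by (intro joinI scI)

lemma quotE: "u \<in> quot U x \<Longrightarrow> \<exists>q\<in>U. \<exists>w\<in>carrier M. u = q +\<^sub>M x *\<^sub>M w"
  unfolding join_def sc_def by blast

lemma quot_commute:
  assumes "sm U" "x \<in> carrier R" "y \<in> carrier R"
  shows "quot (quot U x) y = quot (quot U y) x"
proof -
  let ?x = "sc x (carrier M)" and ?y = "sc y (carrier M)"
  have s: "sm ?x" "sm ?y" using assms by (simp_all add: sm_sc sm_carrier_set)
  have "U \<uplus> ?x \<uplus> ?y = U \<uplus> (?x \<uplus> ?y)" by (rule join_assoc[OF assms(1) s])
  also have "\<dots> = U \<uplus> (?y \<uplus> ?x)" by (simp only: join_commute[OF s])
  also have "\<dots> = U \<uplus> ?y \<uplus> ?x" by (rule join_assoc[OF assms(1) s(2,1), symmetric])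
  finally show ?thesis .
qed

lemma in_quot_of_diff:
  assumes "sm U" "x \<in> carrier R" "u \<in> carrier M" "w \<in> carrier M" "u -\<^sub>M x *\<^sub>M w \<in> U"
  shows "u \<in> quot U x"
  using quotI[OF assms(5,4), of x] diff_add_cancel[of u "x *\<^sub>M w"] assms by simp

text \<open>Homologically, both quotients detect the first Ext module of the residue field into
  \<open>M / U\<close>. By hand: in \<open>y u = q + x w\<close> the element \<open>w\<close> is
  killed by \<mm> modulo \<open>quot U y\<close>, hence lies in it, and cancelling \<open>y\<close>
  places \<open>u\<close> in \<open>quot U x\<close>.\<close>

lemma socle_free_exchange:
  assumes U: "sm U" and x: "x \<in> \<mm>" "reg U x" and y: "y \<in> \<mm>" "reg U y"
    and sf: "socle_free \<mm> (quot U y)"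
  shows "socle_free \<mm> (quot U x)"
  unfolding socle_free_def
proof (intro ballI impI)
  fix u assume u: "u \<in> carrier M" and all: "\<forall>a\<in>\<mm>. a *\<^sub>M u \<in> quot U x"
  have xc: "x \<in> carrier R" and yc: "y \<in> carrier R" using x y \<mm>_subset by auto
  obtain q w where qw: "q \<in> U" "w \<in> carrier M" "y *\<^sub>M u = q +\<^sub>M x *\<^sub>M w"
    using quotE[of "y *\<^sub>M u" U x] all y(1) by blast
  have qc: "q \<in> carrier M" using sm_carrier[OF U qw(1)] .
  have "w \<in> quot U y"
  proof (rule socle_freeD[OF sf qw(2)])
    fix a assume a: "a \<in> \<mm>"
    then have ac: "a \<in> carrier R" using \<mm>_subset by auto
    obtain q' t where qt: "q' \<in> U" "t \<in> carrier M" "a *\<^sub>M u = q' +\<^sub>M x *\<^sub>M t"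
      using quotE[of "a *\<^sub>M u" U x] all a by blast
    have q'c: "q' \<in> carrier M" using sm_carrier[OF U qt(1)] .
    have "a *\<^sub>M q +\<^sub>M x *\<^sub>M (a *\<^sub>M w) = a *\<^sub>M (y *\<^sub>M u)"
      using qw qc xc ac by (simp add: smult_r_distr smult_left_commute[of x a])
    also have "\<dots> = y *\<^sub>M (a *\<^sub>M u)" using ac yc u by (rule smult_left_commute)
    also have "\<dots> = y *\<^sub>M q' +\<^sub>M x *\<^sub>M (y *\<^sub>M t)"
      using qt q'c xc yc by (simp add: smult_r_distr smult_left_commute[of x y])
    finally have e: "a *\<^sub>M q +\<^sub>M x *\<^sub>M (a *\<^sub>M w) = y *\<^sub>M q' +\<^sub>M x *\<^sub>M (y *\<^sub>M t)" .
    let ?A = "a *\<^sub>M q" and ?B = "x *\<^sub>M (a *\<^sub>M w)" and ?C = "y *\<^sub>M q'" and ?D = "x *\<^sub>M (y *\<^sub>M t)"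
    have c: "?A \<in> carrier M" "?B \<in> carrier M" "?C \<in> carrier M" "?D \<in> carrier M"
      using ac xc yc qc q'c qw qt by simp_all
    have "?B = (?A +\<^sub>M ?B) -\<^sub>M ?A" using c by (simp add: a_minus_def M.a_ac M.r_neg1 M.r_neg2)
    also have "\<dots> = (?C +\<^sub>M ?D) -\<^sub>M ?A" by (simp only: e)
    finally have "?B -\<^sub>M ?D = ?C -\<^sub>M ?A" using c by (simp add: a_minus_def M.a_ac M.r_neg1 M.r_neg2 M.r_neg)
    moreover have "?C -\<^sub>M ?A \<in> U" using sm_diff[OF U] sm_smult[OF U] ac yc qw qt by simp
    ultimately have "a *\<^sub>M w -\<^sub>M y *\<^sub>M t \<in> U"
      using regD_diff[OF x(2) U xc, of "a *\<^sub>M w" "y *\<^sub>M t"] ac yc qw qt by simp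
    then show "a *\<^sub>M w \<in> quot U y" using in_quot_of_diff[OF U yc] ac qw qt by simp
  qed
  then obtain q2 s where qs: "q2 \<in> U" "s \<in> carrier M" "w = q2 +\<^sub>M y *\<^sub>M s" using quotE by blast
  have q2c: "q2 \<in> carrier M" using sm_carrier[OF U qs(1)] .
  let ?D = "y *\<^sub>M (x *\<^sub>M s)"
  have c: "q +\<^sub>M x *\<^sub>M q2 \<in> carrier M" "?D \<in> carrier M" using xc yc qc q2c qs by simp_all
  have "y *\<^sub>M u = (q +\<^sub>M x *\<^sub>M q2) +\<^sub>M ?D"
    using qw(3) qs xc yc qc q2c by (simp add: smult_r_distr smult_left_commute[of x y] M.a_assoc)
  then have "y *\<^sub>M u -\<^sub>M ?D = q +\<^sub>M x *\<^sub>M q2" using c by (simp add: a_minus_def M.a_assoc M.r_neg)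
  moreover have "q +\<^sub>M x *\<^sub>M q2 \<in> U" using sm_add[OF U] sm_smult[OF U] xc qw qs by simp
  ultimately have "u -\<^sub>M x *\<^sub>M s \<in> U" using regD_diff[OF y(2) U yc u, of "x *\<^sub>M s"] xc qs by simp
  then show "u \<in> quot U x" by (rule in_quot_of_diff[OF U xc u qs(2)])
qed

text \<open>The half of the permutability of regular sequences that needs no Nakayama argument: both
  factors are cancelled in turn.\<close>

lemma reg_swap:
  assumes U: "sm U" and y: "y \<in> carrier R" "reg U y" and z: "z \<in> carrier R" "reg (quot U y) z"
  shows "reg (quot U z) y"
  unfolding reg_def
proof (intro ballI impI)
  fix u assume u: "u \<in> carrier M" and yu: "y *\<^sub>M u \<in> quot U z"
  obtain q w where qw: "q \<in> U" "w \<in> carrier M" "y *\<^sub>M u = q +\<^sub>M z *\<^sub>M w" using quotE[OF yu] by blast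
  have qc: "q \<in> carrier M" using sm_carrier[OF U qw(1)] .
  have "z *\<^sub>M w \<in> quot U y"
  proof (rule sm_addD2[OF sm_quot[OF U y(1)]])
    show "q \<in> quot U y" using quot_upper[OF U y(1)] qw by blast
    have "y *\<^sub>M u \<in> quot U y" using quotI[OF sm_zero[OF U] u, of y] u y(1) by simp
    then show "q +\<^sub>M z *\<^sub>M w \<in> quot U y" unfolding qw(3) .
  qed (use z qw in simp)
  then have "w \<in> quot U y" by (rule regD[OF z(2) qw(2)])
  then obtain q2 s where qs: "q2 \<in> U" "s \<in> carrier M" "w = q2 +\<^sub>M y *\<^sub>M s" using quotE by blast
  have q2c: "q2 \<in> carrier M" using sm_carrier[OF U qs(1)] .
  let ?D = "y *\<^sub>M (z *\<^sub>M s)"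
  have c: "q +\<^sub>M z *\<^sub>M q2 \<in> carrier M" "?D \<in> carrier M" using z y qc q2c qs by simp_all
  have "y *\<^sub>M u = (q +\<^sub>M z *\<^sub>M q2) +\<^sub>M ?D"
    using qw(3) qs z y qc q2c by (simp add: smult_r_distr smult_left_commute[of z y] M.a_assoc)
  then have "y *\<^sub>M u -\<^sub>M ?D = q +\<^sub>M z *\<^sub>M q2" using c by (simp add: a_minus_def M.a_assoc M.r_neg)
  moreover have "q +\<^sub>M z *\<^sub>M q2 \<in> U" using sm_add[OF U] sm_smult[OF U] z qw qs by simp
  ultimately have "u -\<^sub>M z *\<^sub>M s \<in> U" using regD_diff[OF y(2) U y(1) u, of "z *\<^sub>M s"] z qs by simp
  then show "u \<in> quot U z" by (rule in_quot_of_diff[OF U z(1) u qs(2)])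
qed

text \<open>\<open>dp\<close> demands properness only at the end of its recursion; it passes back
  because the submodules increase along the sequence.\<close>

lemma dp_proper: "dp J k U \<Longrightarrow> sm U \<Longrightarrow> J \<subseteq> carrier R \<Longrightarrow> U \<noteq> carrier M"
proof (induction k arbitrary: U)
  case (Suc k)
  then obtain x where x: "x \<in> J" "dp J k (quot U x)" by auto
  then have xc: "x \<in> carrier R" using Suc.prems by blast
  then have "quot U x \<noteq> carrier M" using Suc.IH x sm_quot Suc.prems by simp
  moreover have "quot U x \<subseteq> carrier M" by (rule sm_subset[OF sm_quot[OF Suc.prems(2) xc]])
  ultimately show ?case using quot_upper[OF Suc.prems(2) xc] by blast
qed simp

lemma quot_proper:
  assumes U: "sm U" "U \<noteq> carrier M" and x: "x \<in> \<mm>"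
  shows "quot U x \<noteq> carrier M"
proof
  assume e: "quot U x = carrier M"
  have xc: "x \<in> carrier R" using x \<mm>_subset by auto
  have "carrier M \<subseteq> act \<mm> (carrier M) \<uplus> U"
  proof -
    have "quot U x = sc x (carrier M) \<uplus> U"
      using join_commute[OF U(1) sm_sc[OF xc sm_carrier_set]] .
    also have "\<dots> \<subseteq> act \<mm> (carrier M) \<uplus> U" by (intro join_mono sc_subset_act x order_refl)
    finally show ?thesis using e by simp
  qed
  then have "carrier M \<subseteq> U" using nakayama[OF sm_carrier_set U(1)] by simp
  then show False using U sm_subset by blast
qed

text \<open>Depth drops by exactly one step for every regular element, shown without homology. The
  witness \<open>y\<close> and the given \<open>x\<close> are linked by a general \<open>z\<close>,
  regular modulo \<open>U\<close>, \<open>quot U x\<close> and \<open>quot U y\<close>. Such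
  \<open>z\<close> exists because \<open>socle_free_exchange\<close> carries socle-freeness from
  \<open>quot U y\<close> to \<open>quot U x\<close>. The induction hypothesis is used for
  \<open>z\<close> modulo \<open>quot U y\<close> and for \<open>x\<close> modulo
  \<open>quot U z\<close>.\<close>

lemma dp_exchange:
  "sm U \<Longrightarrow> dp \<mm> (Suc k) U \<Longrightarrow> x \<in> \<mm> \<Longrightarrow> reg U x \<Longrightarrow> dp \<mm> k (quot U x)"
proof (induction k arbitrary: U x)
  case 0
  then show ?case using quot_proper dp_proper[OF 0(2,1) \<mm>_subset] by simp
next
  case (Suc k)
  note U = Suc.prems(1)
  obtain y where y: "y \<in> \<mm>" "reg U y" "dp \<mm> (Suc k) (quot U y)" using Suc.prems(2) by (auto simp del: dp.simps(2) simp: dp.simps(2)[of \<mm> "Suc k"])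
  have xc: "x \<in> carrier R" and yc: "y \<in> carrier R" using Suc.prems(3) y(1) \<mm>_subset by auto
  obtain y' where y': "y' \<in> \<mm>" "reg (quot U y) y'" using y(3) by auto
  have sfy: "socle_free \<mm> (quot U y)" by (rule reg_imp_socle_free[OF y'(2,1)])
  then have sfx: "socle_free \<mm> (quot U x)"
    using socle_free_exchange[OF U Suc.prems(3,4) y(1,2)] by simp
  have sfU: "socle_free \<mm> U" by (rule reg_imp_socle_free[OF y(2,1)])
  note sq = sm_quot[OF U xc] sm_quot[OF U yc]
  obtain \<B>1 where B1: "finite \<B>1" "\<forall>B\<in>\<B>1. ideal B R \<and> \<not> \<mm> \<subseteq> B" "\<forall>z\<in>\<mm>. z \<notin> \<Union>\<B>1 \<longrightarrow> reg U z"
    using general_regular[OF ideal_\<mm> U sfU] by blast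
  obtain \<B>2 where B2: "finite \<B>2" "\<forall>B\<in>\<B>2. ideal B R \<and> \<not> \<mm> \<subseteq> B" "\<forall>z\<in>\<mm>. z \<notin> \<Union>\<B>2 \<longrightarrow> reg (quot U x) z"
    using general_regular[OF ideal_\<mm> sq(1) sfx] by blast
  obtain \<B>3 where B3: "finite \<B>3" "\<forall>B\<in>\<B>3. ideal B R \<and> \<not> \<mm> \<subseteq> B" "\<forall>z\<in>\<mm>. z \<notin> \<Union>\<B>3 \<longrightarrow> reg (quot U y) z"
    using general_regular[OF ideal_\<mm> sq(2) sfy] by blast
  have "\<exists>z\<in>\<mm>. z \<notin> \<Union>(\<B>1 \<union> \<B>2 \<union> \<B>3)"
    using B1(1,2) B2(1,2) B3(1,2) by (intro avoidance ideal_\<mm>) auto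
  then obtain z where z: "z \<in> \<mm>" "reg U z" "reg (quot U x) z" "reg (quot U y) z"
    using B1(3) B2(3) B3(3) by blast
  have zc: "z \<in> carrier R" using z(1) \<mm>_subset by auto
  have "dp \<mm> k (quot (quot U y) z)" by (rule Suc.IH[OF sq(2) y(3) z(1,4)])
  then have "dp \<mm> k (quot (quot U z) y)" using quot_commute[OF U yc zc] by simp
  moreover have "reg (quot U z) y" by (rule reg_swap[OF U yc y(2) zc z(4)])
  ultimately have "dp \<mm> (Suc k) (quot U z)" using y(1) by auto
  moreover have "reg (quot U z) x" by (rule reg_swap[OF U xc Suc.prems(4) zc z(3)])
  ultimately have "dp \<mm> k (quot (quot U z) x)" using Suc.IH[OF sm_quot[OF U zc] _ Suc.prems(3)] by simp
  then have "dp \<mm> k (quot (quot U x) z)" using quot_commute[OF U xc zc] by simp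
  then show ?case using z(1,3) by auto
qed

text \<open>Rules out infinite depth, which a supremum in \<open>enat\<close> would allow. A
  submodule maximal among those admitting regular sequences of every length absorbs the multiples of
  a regular \<open>x\<close>, and regularity then makes it all of \<open>M\<close>.\<close>

lemma depth_bounded:
  assumes "sm U"
  shows "\<exists>k. \<not> dp \<mm> k U"
proof (rule ccontr)
  assume "\<not> ?thesis"
  then have all: "\<forall>k. dp \<mm> k U" by blast
  let ?P = "\<lambda>V. sm V \<and> (\<forall>k. dp \<mm> k V)"
  obtain V where V: "sm V" "\<forall>k. dp \<mm> k V" and max: "\<forall>W. ?P W \<longrightarrow> V \<subseteq> W \<longrightarrow> W = V"
    using acc_maximal[OF acc_sm, of ?P U] assms all by blast
  have "dp \<mm> (Suc 0) V" using V(2) by blast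
  then obtain x where x: "x \<in> \<mm>" "reg V x" by auto
  have xc: "x \<in> carrier R" using x \<mm>_subset by auto
  have "dp \<mm> k (quot V x)" for k using dp_exchange[OF V(1) _ x, of k] V(2) by blast
  then have "quot V x = V" using max[THEN spec, of "quot V x"] sm_quot[OF V(1) xc] quot_upper[OF V(1) xc] by blast
  then have "sc x (carrier M) \<subseteq> V" using join_upper2[OF V(1) sm_sc[OF xc sm_carrier_set]] by simp
  then have "carrier M \<subseteq> V" using regD[OF x(2)] scI by blast
  moreover have "V \<noteq> carrier M" using V(2) dp.simps(1) by blast
  ultimately show False using sm_subset[OF V(1)] by blast
qed

section \<open>Dimension\<close>

definition ann :: "'c set \<Rightarrow> 'a set" where
  "ann U = {a \<in> carrier R. \<forall>v\<in>carrier M. a *\<^sub>M v \<in> U}"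

lemma ideal_ann: "sm U \<Longrightarrow> ideal (ann U) R"
  unfolding ann_def by (rule ideal_into) auto

lemma ann_mono: "U \<subseteq> V \<Longrightarrow> ann U \<subseteq> ann V"
  unfolding ann_def by blast

lemma prime_disjoint:
  assumes J: "ideal J R" and S: "S \<subseteq> carrier R" "\<one> \<in> S" "J \<inter> S = {}"
    and mult: "\<forall>s\<in>S. \<forall>t\<in>S. s \<otimes> t \<in> S"
  shows "\<exists>Q. primeideal Q R \<and> J \<subseteq> Q \<and> Q \<inter> S = {}"
proof -
  let ?P = "\<lambda>Q. ideal Q R \<and> J \<subseteq> Q \<and> Q \<inter> S = {}"
  obtain Q where Q: "ideal Q R" "J \<subseteq> Q" "Q \<inter> S = {}" and max: "\<forall>L. ?P L \<longrightarrow> Q \<subseteq> L \<longrightarrow> L = Q"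
    using acc_maximal[OF acc_ideal, of ?P J] J S(3) by blast
  have meets: "\<exists>q\<in>Q. \<exists>r\<in>carrier R. q \<oplus> r \<otimes> a \<in> S" if a: "a \<in> carrier R" "a \<notin> Q" for a
  proof -
    let ?L = "set_add R Q (PIdl a)"
    have L: "ideal ?L R" by (rule add_ideals[OF Q(1) cgenideal_ideal[OF a(1)]])
    have QL: "Q \<subseteq> ?L"
    proof
      fix q assume q: "q \<in> Q"
      have "\<zero> \<in> PIdl a" using cgenideal_ideal[OF a(1)] ideal.axioms(1) additive_subgroup.zero_closed by blast
      then have "q \<oplus> \<zero> \<in> ?L" using q unfolding set_add_def' by blast
      then show "q \<in> ?L" using q ideal.Icarr[OF Q(1)] by simp
    qed
    have "a \<in> ?L"
    proof -
      have "\<zero> \<in> Q" using Q(1) ideal.axioms(1) additive_subgroup.zero_closed by blast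
      then have "\<zero> \<oplus> a \<in> ?L" using cgenideal_self[OF a(1)] unfolding set_add_def' by blast
      then show ?thesis using a by simp
    qed
    then have "?L \<noteq> Q" using a by blast
    then have "\<not> ?P ?L" using max QL by blast
    then have "?L \<inter> S \<noteq> {}" using L QL Q(2) by blast
    then obtain s where s: "s \<in> S" "s \<in> ?L" by blast
    then obtain q p where "q \<in> Q" "p \<in> PIdl a" "s = q \<oplus> p" unfolding set_add_def' by blast
    moreover from this(2) obtain r where "r \<in> carrier R" "p = r \<otimes> a" unfolding cgenideal_def by blast
    ultimately show ?thesis using s(1) by blast
  qed
  have "primeideal Q R"
  proof (rule primeidealI[OF Q(1) is_cring])
    show "carrier R \<noteq> Q" using Q(3) S(2) one_closed by blast
    fix a b assume ab: "a \<in> carrier R" "b \<in> carrier R" "a \<otimes> b \<in> Q"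
    show "a \<in> Q \<or> b \<in> Q"
    proof (rule ccontr)
      assume "\<not> ?thesis"
      then obtain q r q' r' where q: "q \<in> Q" "r \<in> carrier R" "q \<oplus> r \<otimes> a \<in> S"
        and q': "q' \<in> Q" "r' \<in> carrier R" "q' \<oplus> r' \<otimes> b \<in> S"
        using meets[of a] meets[of b] ab by blast
      have c: "q \<in> carrier R" "q' \<in> carrier R" using q q' ideal.Icarr[OF Q(1)] by auto
      have "(q \<oplus> r \<otimes> a) \<otimes> (q' \<oplus> r' \<otimes> b) = (q' \<oplus> r' \<otimes> b) \<otimes> q \<oplus> ((r \<otimes> a) \<otimes> q' \<oplus> (r \<otimes> r') \<otimes> (a \<otimes> b))"
        using c ab q(2) q'(2) by algebra
      moreover have "\<dots> \<in> Q"
        using additive_subgroup.a_closed[OF ideal.axioms(1)[OF Q(1)]] ideal.I_l_closed[OF Q(1)] q q' ab c by simp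
      ultimately have "(q \<oplus> r \<otimes> a) \<otimes> (q' \<oplus> r' \<otimes> b) \<in> Q" by simp
      moreover have "(q \<oplus> r \<otimes> a) \<otimes> (q' \<oplus> r' \<otimes> b) \<in> S" using mult q(3) q'(3) by blast
      ultimately show False using Q(3) by blast
    qed
  qed
  then show ?thesis using Q by blast
qed

text \<open>A regular element avoids the minimal primes of the support.\<close>

lemma prime_below:
  assumes U: "sm U" and x: "x \<in> carrier R" "reg U x"
    and P: "primeideal P R" "ann (quot U x) \<subseteq> P"
  shows "\<exists>Q. primeideal Q R \<and> ann U \<subseteq> Q \<and> Q \<subset> P"
proof -
  have iP: "ideal P R" using primeideal.axioms(1)[OF P(1)] .
  have xP: "x \<in> P"
  proof -
    have "x *\<^sub>M v \<in> quot U x" if "v \<in> carrier M" for v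
      using join_upper2[OF U sm_sc[OF x(1) sm_carrier_set]] scI[OF that, of x] by blast
    then have "x \<in> ann (quot U x)" unfolding ann_def using x(1) by blast
    then show ?thesis using P(2) by blast
  qed
  \<comment> \<open>The multiplicative set generated by \<open>x\<close> and the complement of
    \<open>P\<close>. It misses \<open>ann U\<close>: regularity cancels the power of
    \<open>x\<close>, and what remains is an element of \<open>ann U\<close> outside
    \<open>P\<close>.\<close>
  define S where "S = {s \<otimes> x [^] (k::nat) | s k. s \<in> carrier R \<and> s \<notin> P}"
  have oneP: "\<one> \<notin> P" using ideal.one_imp_carrier[OF iP] primeideal.I_notcarr[OF P(1)] by blast
  have S0: "s \<in> S" if "s \<in> carrier R" "s \<notin> P" for s
  proof -
    have "s = s \<otimes> x [^] (0::nat)" using that by simp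
    then show ?thesis unfolding S_def using that by blast
  qed
  have xS: "x \<in> S"
  proof -
    have "x = \<one> \<otimes> x [^] (1::nat)" using x by simp
    then show ?thesis unfolding S_def using oneP one_closed by blast
  qed
  have "\<exists>Q. primeideal Q R \<and> ann U \<subseteq> Q \<and> Q \<inter> S = {}"
  proof (rule prime_disjoint[OF ideal_ann[OF U]])
    show "S \<subseteq> carrier R" unfolding S_def using x by auto
    show "\<one> \<in> S" using S0 oneP by simp
    show "ann U \<inter> S = {}"
    proof (rule ccontr)
      assume "ann U \<inter> S \<noteq> {}"
      then obtain s and k :: nat where s: "s \<in> carrier R" "s \<notin> P" "s \<otimes> x [^] k \<in> ann U"
        unfolding S_def by blast
      have "s *\<^sub>M v \<in> U" if v: "v \<in> carrier M" for v
      proof -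
        have "x [^] k *\<^sub>M (s *\<^sub>M v) = (s \<otimes> x [^] k) *\<^sub>M v"
          using v s x by (simp add: smult_assoc1 smult_left_commute[of s])
        then have "x [^] k *\<^sub>M (s *\<^sub>M v) \<in> U" using s(3) v unfolding ann_def by simp
        then show ?thesis using regD[OF reg_pow[OF x(2,1)]] s v by blast
      qed
      then have "s \<in> ann U" unfolding ann_def using s by blast
      then show False using s ann_mono[OF quot_upper[OF U x(1)]] P(2) by blast
    qed
    show "\<forall>s\<in>S. \<forall>t\<in>S. s \<otimes> t \<in> S"
    proof (intro ballI)
      fix s t assume "s \<in> S" "t \<in> S"
      then obtain a b and k l :: nat where s: "s = a \<otimes> x [^] k" "a \<in> carrier R" "a \<notin> P"
        and t: "t = b \<otimes> x [^] l" "b \<in> carrier R" "b \<notin> P" unfolding S_def by blast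
      have xk: "x [^] k \<in> carrier R" "x [^] l \<in> carrier R" using x by simp_all
      have "s \<otimes> t = (a \<otimes> b) \<otimes> (x [^] k \<otimes> x [^] l)"
        unfolding s(1) t(1) using s(2) t(2) xk by algebra
      also have "\<dots> = (a \<otimes> b) \<otimes> x [^] (k + l)" using nat_pow_mult[OF x(1)] by simp
      finally have "s \<otimes> t = (a \<otimes> b) \<otimes> x [^] (k + l)" .
      moreover have "a \<otimes> b \<notin> P" using primeideal.I_prime[OF P(1)] s t by blast
      ultimately show "s \<otimes> t \<in> S" unfolding S_def using s t by blast
    qed
  qed
  then obtain Q where Q: "primeideal Q R" "ann U \<subseteq> Q" "Q \<inter> S = {}" by blast
  have "Q \<subseteq> P" using Q(3) S0 ideal.Icarr[OF primeideal.axioms(1)[OF Q(1)]] by blast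
  moreover have "x \<notin> Q" using Q(3) xS by blast
  ultimately show ?thesis using Q xP by blast
qed

text \<open>\<open>rseq k U\<close> says that \<open>U = (x\<^sub>1, \<dots>, x\<^sub>k) M\<close> for a regular sequence in \<open>\<mm>\<close>.\<close>

primrec rseq :: "nat \<Rightarrow> 'c set \<Rightarrow> bool" where
  "rseq 0 U \<longleftrightarrow> U = {\<zero>\<^bsub>M\<^esub>}"
| "rseq (Suc k) U \<longleftrightarrow> (\<exists>V x. rseq k V \<and> x \<in> \<mm> \<and> reg V x \<and> U = quot V x)"

lemma sm_rseq: "rseq k U \<Longrightarrow> sm U"
proof (induction k arbitrary: U)
  case (Suc k)
  then obtain V x where "rseq k V" "x \<in> \<mm>" "U = quot V x" by auto
  then show ?case using Suc.IH sm_quot \<mm>_subset by blast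
qed (simp add: sm_zero_set)

text \<open>Undoing one element of the sequence allows a strictly smaller prime by
  \<open>prime_below\<close>, so the chain is built downwards from \<open>P\<close>.\<close>

lemma rseq_prime_chain:
  "rseq k U \<Longrightarrow> primeideal P R \<Longrightarrow> ann U \<subseteq> P \<Longrightarrow>
    \<exists>C. (\<forall>i\<le>k. primeideal (C i) R \<and> ann {\<zero>\<^bsub>M\<^esub>} \<subseteq> C i) \<and> (\<forall>i<k. C i \<subset> C (Suc i)) \<and> C k = P"
proof (induction k arbitrary: U P)
  case 0
  then show ?case by (intro exI[of _ "\<lambda>_. P"]) simp
next
  case (Suc k)
  then obtain V x where V: "rseq k V" "x \<in> \<mm>" "reg V x" "U = quot V x" by auto
  have sV: "sm V" and xc: "x \<in> carrier R" using sm_rseq[OF V(1)] V(2) \<mm>_subset by auto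
  obtain Q where Q: "primeideal Q R" "ann V \<subseteq> Q" "Q \<subset> P"
    using prime_below[OF sV xc V(3) Suc.prems(2)] Suc.prems(3) V(4) by blast
  obtain C where C: "\<forall>i\<le>k. primeideal (C i) R \<and> ann {\<zero>\<^bsub>M\<^esub>} \<subseteq> C i" "\<forall>i<k. C i \<subset> C (Suc i)" "C k = Q"
    using Suc.IH[OF V(1) Q(1,2)] by blast
  have "ann {\<zero>\<^bsub>M\<^esub>} \<subseteq> P" using C(1,3) Q(3) by blast
  then show ?case
    using C Q(3) Suc.prems(2)
    by (intro exI[of _ "\<lambda>i. if i \<le> k then C i else P"]) (auto simp: le_Suc_eq less_Suc_eq)
qed

lemma annihilator_eq: "annihilator R M = ann {\<zero>\<^bsub>M\<^esub>}"
  unfolding annihilator_def ann_def by simp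

text \<open>The membership rule keeps strict inclusions strict in the quotient ring, where the
  dimension is measured.\<close>

lemma prime_image:
  assumes J: "ideal J R" and P: "primeideal P R" "J \<subseteq> P"
  shows "primeideal ((+>) J ` P) (R Quot J)"
    and "a \<in> carrier R \<Longrightarrow> J +> a \<in> (+>) J ` P \<longleftrightarrow> a \<in> P"
proof -
  have iP: "ideal P R" using primeideal.axioms(1)[OF P(1)] .
  have mem: "J +> a \<in> (+>) J ` P \<longleftrightarrow> a \<in> P" if a: "a \<in> carrier R" for a
  proof
    assume "J +> a \<in> (+>) J ` P"
    then obtain p where p: "p \<in> P" "J +> a = J +> p" by blast
    have pc: "p \<in> carrier R" using p ideal.Icarr[OF iP] by blast
    have "a \<ominus> p \<in> P" using quotient_eq_iff_same_a_r_cos[OF J a pc] p P by blast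
    then have "(a \<ominus> p) \<oplus> p \<in> P" using p additive_subgroup.a_closed[OF ideal.axioms(1)[OF iP]] by blast
    then show "a \<in> P" using a pc by (simp add: R.minus_eq R.a_assoc R.l_neg)
  qed blast
  then show "a \<in> carrier R \<Longrightarrow> J +> a \<in> (+>) J ` P \<longleftrightarrow> a \<in> P" .
  have carr: "carrier (R Quot J) = (+>) J ` carrier R"
    unfolding FactRing_def A_RCOSETS_def' by auto
  show "primeideal ((+>) J ` P) (R Quot J)"
  proof (rule primeidealI)
    show "ideal ((+>) J ` P) (R Quot J)" by (rule ring_ideal_imp_quot_ideal[OF J iP])
    show "cring (R Quot J)" by (rule ideal.quotient_is_cring[OF J is_cring])
    have "J +> \<one> \<notin> (+>) J ` P"
      using mem[of \<one>] ideal.one_imp_carrier[OF iP] primeideal.I_notcarr[OF P(1)] by auto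
    then show "carrier (R Quot J) \<noteq> (+>) J ` P" unfolding carr by blast
    fix c d assume c: "c \<in> carrier (R Quot J)" and d: "d \<in> carrier (R Quot J)"
      and cd: "c \<otimes>\<^bsub>R Quot J\<^esub> d \<in> (+>) J ` P"
    obtain a b where ab: "a \<in> carrier R" "c = J +> a" "b \<in> carrier R" "d = J +> b"
      using c d unfolding carr by blast
    have "c \<otimes>\<^bsub>R Quot J\<^esub> d = J +> (a \<otimes> b)"
      unfolding FactRing_def using ideal.rcoset_mult_add[OF J ab(1,3)] ab by simp
    then have "a \<otimes> b \<in> P" using cd mem[of "a \<otimes> b"] ab by simp
    then have "a \<in> P \<or> b \<in> P" using primeideal.I_prime[OF P(1) ab(1,3)] by blast
    then show "c \<in> (+>) J ` P \<or> d \<in> (+>) J ` P" using ab by blast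
  qed
qed

lemma prime_chain_le_dim:
  assumes C: "\<And>i. i \<le> n \<Longrightarrow> primeideal (C i) R \<and> ann {\<zero>\<^bsub>M\<^esub>} \<subseteq> C i" "\<And>i. i < n \<Longrightarrow> C i \<subset> C (Suc i)"
  shows "enat n \<le> module_dim R M"
  unfolding module_dim_def krull_dim_def annihilator_eq
proof (rule chain_sup_ge)
  let ?J = "ann {\<zero>\<^bsub>M\<^esub>}"
  have J: "ideal ?J R" by (rule ideal_ann[OF sm_zero_set])
  show "(+>) ?J ` C i \<in> {P. primeideal P (R Quot ?J)}" if "i \<le> n" for i
    using prime_image(1)[OF J] C(1)[OF that] by blast
  show "(+>) ?J ` C i \<subset> (+>) ?J ` C (Suc i)" if i: "i < n" for i
  proof -
    obtain a where a: "a \<in> C (Suc i)" "a \<notin> C i" using C(2)[OF i] by blast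
    have p: "primeideal (C i) R" "?J \<subseteq> C i" "primeideal (C (Suc i)) R"
      using C(1)[of i] C(1)[of "Suc i"] i by auto
    have "a \<in> carrier R" using a(1) ideal.Icarr[OF primeideal.axioms(1)[OF p(3)]] by blast
    then have "?J +> a \<notin> (+>) ?J ` C i" using prime_image(2)[OF J p(1,2)] a(2) by blast
    then show ?thesis using a(1) C(2)[OF i] by blast
  qed
qed

text \<open>The constant family \<open>U\<close> is taken as the target in
  \<open>rees_eventually_le\<close>.\<close>

lemma pw_le_of_powers:
  assumes J: "ideal J R" and U: "sm U" and pow: "\<forall>a\<in>J. \<exists>k::nat. a [^] k \<in> ann U"
  shows "\<exists>K. pw J K (carrier M) \<subseteq> U"
proof -
  obtain gs where gs: "set gs \<subseteq> carrier R" "J = Idl (set gs)" by (rule ideal_generators[OF J])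
  have "\<exists>K. \<forall>n\<ge>K. rees gs n \<subseteq> U"
  proof (rule rees_eventually_le[OF gs(1)])
    show "sm U" by (rule U)
    show "sc g U \<subseteq> U" if "g \<in> set gs" for g using sc_subset[OF _ U] that gs(1) by blast
    fix g assume "g \<in> set gs"
    then have "g \<in> J" using genideal_self[OF gs(1)] gs(2) by blast
    then obtain k :: nat where "g [^] k \<in> ann U" using pow by blast
    then have "sc (g [^] k) (rees gs n) \<subseteq> U" for n
      unfolding ann_def sc_def using sm_carrier[OF sm_rees[OF gs(1)]] by blast
    then show "\<exists>k::nat. \<forall>n. sc (g [^] k) (rees gs n) \<subseteq> U" by blast
  qed
  then obtain K where "\<forall>n\<ge>K. rees gs n \<subseteq> U" ..
  then have "rees gs K \<subseteq> U" by blast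
  then show ?thesis using rees_eq_pw[OF gs(1)] gs(2) by auto
qed

text \<open>A prime above \<open>ann U\<close> other than \<mm> would end a chain of length
  \<open>d\<close>, which \<mm> prolongs beyond the dimension. So \<mm> is the only such prime, and
  every element of \<mm> has a power in \<open>ann U\<close>.\<close>

lemma rseq_finite_colength:
  assumes U: "rseq d U" and dim: "module_dim R M = enat d"
  shows "\<exists>K. pw \<mm> K (carrier M) \<subseteq> U"
proof (rule pw_le_of_powers[OF ideal_\<mm> sm_rseq[OF U]])
  have only: "P = \<mm>" if P: "primeideal P R" "ann U \<subseteq> P" for P
  proof (rule ccontr)
    assume "P \<noteq> \<mm>"
    then have lt: "P \<subset> \<mm>"
      using proper_ideal_le[OF primeideal.axioms(1)[OF P(1)]] primeideal.I_notcarr[OF P(1)] by blast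
    obtain C where C: "\<forall>i\<le>d. primeideal (C i) R \<and> ann {\<zero>\<^bsub>M\<^esub>} \<subseteq> C i" "\<forall>i<d. C i \<subset> C (Suc i)" "C d = P"
      using rseq_prime_chain[OF U P] by blast
    have m: "primeideal \<mm> R" by (rule maximalideal_prime[OF maximal_\<mm>])
    have "ann {\<zero>\<^bsub>M\<^esub>} \<subseteq> \<mm>" using C(1,3) lt by blast
    then have "enat (Suc d) \<le> module_dim R M"
      using C lt m
      by (intro prime_chain_le_dim[of "Suc d" "\<lambda>i. if i \<le> d then C i else \<mm>"]) (auto simp: le_Suc_eq less_Suc_eq)
    then show False using dim by simp
  qed
  show "\<forall>a\<in>\<mm>. \<exists>k::nat. a [^] k \<in> ann U"
  proof (rule ballI, rule ccontr)
    fix a assume a: "a \<in> \<mm>" and no: "\<not> (\<exists>k::nat. a [^] k \<in> ann U)"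
    have ac: "a \<in> carrier R" using a \<mm>_subset by auto
    have "\<exists>Q. primeideal Q R \<and> ann U \<subseteq> Q \<and> Q \<inter> range (\<lambda>k::nat. a [^] k) = {}"
    proof (rule prime_disjoint[OF ideal_ann[OF sm_rseq[OF U]]])
      show "range (\<lambda>k::nat. a [^] k) \<subseteq> carrier R" using ac by auto
      show "\<one> \<in> range (\<lambda>k::nat. a [^] k)" by (rule range_eqI[of _ _ 0]) simp
      show "ann U \<inter> range (\<lambda>k::nat. a [^] k) = {}" using no by blast
      show "\<forall>s\<in>range (\<lambda>k::nat. a [^] k). \<forall>t\<in>range (\<lambda>k::nat. a [^] k). s \<otimes> t \<in> range (\<lambda>k::nat. a [^] k)"
        using nat_pow_mult[OF ac] by auto
    qed
    then obtain Q where Q: "primeideal Q R" "ann U \<subseteq> Q" "Q \<inter> range (\<lambda>k::nat. a [^] k) = {}" by blast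
    have "Q = \<mm>" by (rule only[OF Q(1,2)])
    moreover have "a \<in> range (\<lambda>k::nat. a [^] k)" using ac by (intro range_eqI[of _ _ 1]) simp
    ultimately show False using a Q(3) by blast
  qed
qed

section \<open>Finite lengths\<close>

text \<open>The quotient is an image of the residue field: a submodule strictly above
  \<open>W\<close> contains a multiple of \<open>u\<close> by an element outside \<mm>, hence
  \<open>u\<close>.\<close>

lemma len_cyclic:
  assumes W: "sm W" and u: "u \<in> carrier M" and a: "\<And>a. a \<in> \<mm> \<Longrightarrow> a *\<^sub>M u \<in> W"
  shows "len W (W \<uplus> (\<lambda>c. c *\<^sub>M u) ` carrier R) \<le> 1"
proof -
  let ?V = "W \<uplus> (\<lambda>c. c *\<^sub>M u) ` carrier R"
  have dich: "N = W \<or> N = ?V" if N: "sm N" "W \<subseteq> N" "N \<subseteq> ?V" for N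
  proof (rule ccontr)
    assume as: "\<not> ?thesis"
    then obtain n where n: "n \<in> N" "n \<notin> W" using N by blast
    then have "n \<in> ?V" using N by blast
    from join_cyclicD[OF this] obtain w c where w: "w \<in> W" "c \<in> carrier R" "n = w +\<^sub>M c *\<^sub>M u"
      by (elim bexE)
    have "c \<notin> \<mm>" using n w sm_add[OF W] a by blast
    moreover have "c *\<^sub>M u \<in> N" using sm_addD2[OF N(1), of "c *\<^sub>M u" w] w n N u by auto
    ultimately have "u \<in> N" using smult_unit_cancel[OF N(1) w(2) _ u] by blast
    then have "(\<lambda>c. c *\<^sub>M u) ` carrier R \<subseteq> N" using sm_smult[OF N(1)] by blast
    then have "?V \<subseteq> N" by (intro join_least N)
    then show False using as N by blast
  qed
  have "len W ?V \<le> enat 1"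
    unfolding len_def
  proof (rule chain_sup_le)
    fix n :: nat and C assume C: "\<And>i. i \<le> n \<Longrightarrow> C i \<in> {N. sm N \<and> W \<subseteq> N \<and> N \<subseteq> ?V}"
      and s: "\<And>i. i < n \<Longrightarrow> C i \<subset> C (Suc i)"
    have cd: "C i = W \<or> C i = ?V" if "i \<le> n" for i using dich[of "C i"] C[OF that] by blast
    have "n \<le> 1"
    proof (rule ccontr)
      assume "\<not> n \<le> 1"
      then have "C 0 \<subset> C 1" "C 1 \<subset> C 2" "C 0 = W \<or> C 0 = ?V" "C 1 = W \<or> C 1 = ?V" "C 2 = W \<or> C 2 = ?V"
        using s[of 0] s[of 1] cd[of 0] cd[of 1] cd[of 2] by (auto simp: numeral_2_eq_2)
      then show False by blast
    qed
    then show "enat n \<le> enat 1" by simp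
  qed
  then show ?thesis by (simp add: one_enat_def)
qed

text \<open>No basis of the vector space \<open>V / W\<close> is chosen. Among the submodules of
  finite length over \<open>W\<close> there is a maximal one, and a further generator would add at
  most 1.\<close>

lemma len_finite_step:
  assumes V: "sm V" and W: "sm W" "W \<subseteq> V" and act: "act \<mm> V \<subseteq> W"
  shows "len W V \<noteq> \<infinity>"
proof -
  let ?P = "\<lambda>L. sm L \<and> W \<subseteq> L \<and> L \<subseteq> V \<and> len W L \<noteq> \<infinity>"
  have "len W W \<noteq> \<infinity>" by (simp add: len_self)
  then obtain L where L: "sm L" "W \<subseteq> L" "L \<subseteq> V" "len W L \<noteq> \<infinity>"
    and max: "\<forall>N. ?P N \<longrightarrow> L \<subseteq> N \<longrightarrow> N = L"
    using acc_maximal[OF acc_sm, of ?P W] W by blast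
  have "L = V"
  proof (rule ccontr)
    assume "L \<noteq> V"
    then obtain u where u: "u \<in> V" "u \<notin> L" using L by blast
    have uc: "u \<in> carrier M" using sm_carrier[OF V u(1)] .
    let ?C = "(\<lambda>c. c *\<^sub>M u) ` carrier R"
    have C: "sm ?C" by (rule sm_cyclic[OF uc])
    have uC: "u \<in> ?C" using uc by (intro image_eqI[of _ _ \<one>]) auto
    have au: "a *\<^sub>M u \<in> L" if "a \<in> \<mm>" for a using actI[OF that u(1)] act L(2) by blast
    have N: "sm (L \<uplus> ?C)" by (rule sm_join[OF L(1) C])
    have LN: "L \<subseteq> L \<uplus> ?C" by (rule join_upper1[OF L(1) C])
    have "?C \<subseteq> V" using sm_smult[OF V _ u(1)] by blast
    then have NV: "L \<uplus> ?C \<subseteq> V" by (intro join_least V L)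
    have "len W (L \<uplus> ?C) = len W L + len L (L \<uplus> ?C)" by (rule len_add[OF W(1) L(1) N L(2) LN])
    also have "\<dots> \<le> len W L + 1" by (intro add_left_mono len_cyclic L(1) uc au)
    finally have "len W (L \<uplus> ?C) \<le> len W L + 1" .
    moreover have "len W L + 1 \<noteq> \<infinity>" using L(4) by (auto simp: one_enat_def)
    ultimately have "len W (L \<uplus> ?C) \<noteq> \<infinity>" by (metis enat_ord_simps(5))
    then have "L \<uplus> ?C = L" using max N LN NV L(2) by blast
    then show False using join_upper2[OF L(1) C] uC u(2) by blast
  qed
  then show ?thesis using L(4) by simp
qed

lemma len_finite:
  assumes U: "sm U" and K: "pw \<mm> K (carrier M) \<subseteq> U"
  shows "len U (carrier M) \<noteq> \<infinity>"
proof -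
  have P: "sm (pw \<mm> n (carrier M))" for n by (rule sm_pw[OF \<mm>_subset sm_carrier_set])
  have "len (pw \<mm> n (carrier M)) (carrier M) \<noteq> \<infinity>" for n
  proof (induction n)
    case 0
    then show ?case by (simp add: len_self)
  next
    case (Suc n)
    have le: "pw \<mm> (Suc n) (carrier M) \<subseteq> pw \<mm> n (carrier M)"
      by (intro pw_antimono \<mm>_subset sm_carrier_set) simp
    have "len (pw \<mm> (Suc n) (carrier M)) (carrier M)
      = len (pw \<mm> (Suc n) (carrier M)) (pw \<mm> n (carrier M)) + len (pw \<mm> n (carrier M)) (carrier M)"
      by (intro len_add P sm_carrier_set le sm_subset)
    moreover have "len (pw \<mm> (Suc n) (carrier M)) (pw \<mm> n (carrier M)) \<noteq> \<infinity>"
      by (intro len_finite_step P le) simp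
    ultimately show ?case using Suc by auto
  qed
  then show ?thesis using len_antimono[OF K, of "carrier M"] by (metis enat_ord_simps(5))
qed

end

section \<open>Hilbert functions with respect to a primary ideal\<close>

locale primary_module = noetherian_local R M \<mm> for R (structure) and M (structure) and \<mm> +
  fixes I :: "'a set"
  assumes primary: "primary_to R \<mm> I"
begin

lemma ideal_I: "ideal I R"
  using primary unfolding primary_to_def primary_ideal_def by blast

lemma I_subset: "I \<subseteq> carrier R"
  by (rule ideal_subset[OF ideal_I])

lemma power_in_I: "a \<in> \<mm> \<Longrightarrow> \<exists>k::nat. a [^] k \<in> I"
  using primary unfolding primary_to_def radical_ideal_def by blast

lemma I_le_\<mm>: "I \<subseteq> \<mm>"
proof
  fix a assume a: "a \<in> I"
  then have "a \<in> carrier R" "a [^] (1::nat) \<in> I" using I_subset by auto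
  then have "a \<in> radical_ideal R I" unfolding radical_ideal_def by blast
  then show "a \<in> \<mm>" using primary unfolding primary_to_def by blast
qed

lemma sm_pwI: "sm (pw I n (carrier M))"
  by (rule sm_pw[OF I_subset sm_carrier_set])

lemma pw_mono1:
  assumes "J \<subseteq> K" "K \<subseteq> carrier R" "sm V"
  shows "pw J n V \<subseteq> pw K n V"
proof (induction n)
  case (Suc n)
  have J: "J \<subseteq> carrier R" using assms by blast
  have "act J (pw J n V) \<subseteq> act J (pw K n V)" by (intro act_mono J sm_pw assms Suc)
  also have "\<dots> \<subseteq> act K (pw K n V)" by (intro act_mono1 assms sm_pw)
  finally show ?case by simp
qed simp

lemma \<mm>_power_le_act: "\<exists>K. pw \<mm> K (carrier M) \<subseteq> act I (carrier M)"
proof (rule pw_le_of_powers[OF ideal_\<mm> sm_act[OF I_subset sm_carrier_set]])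
  have "a \<in> ann (act I (carrier M))" if "a \<in> I" for a
    unfolding ann_def using that I_subset actI[OF that, of _ "carrier M"] by blast
  then show "\<forall>a\<in>\<mm>. \<exists>k::nat. a [^] k \<in> ann (act I (carrier M))" using power_in_I by blast
qed

lemma \<mm>_power_le_I_power: "\<exists>K. pw \<mm> K (carrier M) \<subseteq> pw I n (carrier M)"
proof (induction n)
  case 0
  then show ?case by (intro exI[of _ 0]) simp
next
  case (Suc n)
  obtain K where K: "pw \<mm> K (carrier M) \<subseteq> pw I n (carrier M)" using Suc by blast
  obtain L where L: "pw \<mm> L (carrier M) \<subseteq> act I (carrier M)" using \<mm>_power_le_act by blast
  have "pw \<mm> (L + K) (carrier M) = pw \<mm> L (pw \<mm> K (carrier M))" by (rule pw_add)
  also have "\<dots> \<subseteq> pw \<mm> L (pw I n (carrier M))"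
    by (intro pw_mono \<mm>_subset sm_pw sm_carrier_set I_subset K)
  also have "\<dots> = pw I n (pw \<mm> L (carrier M))"
    by (rule pw_commute[OF \<mm>_subset I_subset sm_carrier_set])
  also have "\<dots> \<subseteq> pw I n (act I (carrier M))"
    by (intro pw_mono \<mm>_subset sm_pw sm_act sm_carrier_set I_subset L)
  also have "\<dots> = pw I (Suc n) (carrier M)" by (rule pw_Suc2[symmetric])
  finally show ?case by blast
qed

section \<open>The I-adic filtration modulo \<open>U\<close> and superficial elements\<close>

abbreviation F :: "'c set \<Rightarrow> nat \<Rightarrow> 'c set" where "F U n \<equiv> pw I n (carrier M) \<uplus> U"

lemma sm_F: "sm U \<Longrightarrow> sm (F U n)"
  by (intro sm_join sm_pwI)

lemma F_upper: "sm U \<Longrightarrow> U \<subseteq> F U n"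
  by (intro join_upper2 sm_pwI)

lemma pw_le_F: "sm U \<Longrightarrow> pw I n (carrier M) \<subseteq> F U n"
  by (intro join_upper1 sm_pwI)

lemma F_antimono: "m \<le> n \<Longrightarrow> F U n \<subseteq> F U m"
  by (intro join_mono pw_antimono I_subset sm_carrier_set order_refl)

lemma F_0: "sm U \<Longrightarrow> F U 0 = carrier M"
  by (simp add: join_absorb1 sm_carrier_set sm_subset)

lemma len_F_finite:
  assumes "sm U"
  shows "len (F U n) (carrier M) \<noteq> \<infinity>"
proof -
  obtain K where "pw \<mm> K (carrier M) \<subseteq> pw I n (carrier M)" using \<mm>_power_le_I_power by blast
  then have "pw \<mm> K (carrier M) \<subseteq> F U n" using pw_le_F[OF assms] by blast
  then show ?thesis by (rule len_finite[OF sm_F[OF assms]])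
qed

lemma smult_F:
  assumes U: "sm U" and x: "x \<in> I" and u: "u \<in> F U n"
  shows "x *\<^sub>M u \<in> F U (Suc n)"
proof -
  have xc: "x \<in> carrier R" using x I_subset by blast
  obtain v q where v: "u = v +\<^sub>M q" "v \<in> pw I n (carrier M)" "q \<in> U" using u by (rule joinE)
  have c: "v \<in> carrier M" "q \<in> carrier M" using sm_carrier[OF sm_pwI v(2)] sm_carrier[OF U v(3)] by auto
  have "x *\<^sub>M u = x *\<^sub>M v +\<^sub>M x *\<^sub>M q" unfolding v(1) using xc c by (rule smult_r_distr)
  then show ?thesis using joinI[of "x *\<^sub>M v" "pw I (Suc n) (carrier M)" "x *\<^sub>M q" U]
      actI[OF x v(2)] sm_smult[OF U xc v(3)] by simp
qed

text \<open>The hypothesis on \<open>K\<close> says that \<open>x\<close> is injective on the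
  associated graded module of \<open>M / U\<close> in large degrees. By itself this only lifts
  \<open>u\<close> from one step of the filtration to the next (\<open>climb\<close>); a starting
  step within constant distance \<open>c\<close> of \<open>n\<close> comes from the Artin-Rees lemma
  for \<open>quot U x\<close> together with regularity of \<open>x\<close>.\<close>

lemma superficial_colon:
  assumes U: "sm U" and x: "x \<in> I" "reg U x"
    and gs: "set gs \<subseteq> carrier R" "I = Idl (set gs)"
    and K: "\<forall>n\<ge>K. \<forall>u\<in>rees gs n. x *\<^sub>M u \<in> F U (Suc (Suc n)) \<inter> rees gs (Suc n) \<longrightarrow> u \<in> F U (Suc n) \<inter> rees gs n"
  shows "\<exists>n0. \<forall>n\<ge>n0. colon (F U (Suc n)) x \<subseteq> F U n"
proof -
  have xc: "x \<in> carrier R" using x I_subset by auto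
  have rees: "rees gs n = pw I n (carrier M)" for n using rees_eq_pw[OF gs(1)] gs(2) by simp
  have sq: "sm (quot U x)" by (rule sm_quot[OF U xc])
  let ?W = "\<lambda>n. quot U x \<inter> rees gs n"
  have "graded gs ?W"
  proof (rule gradedI)
    show "sm (quot U x \<inter> rees gs n)" for n by (intro sm_Int sq sm_rees gs(1))
    show "g *\<^sub>M u \<in> quot U x \<inter> rees gs (Suc n)" if g: "g \<in> set gs" and u: "u \<in> quot U x \<inter> rees gs n" for g n u
    proof -
      have "g \<in> carrier R" using g gs(1) by blast
      then show ?thesis using sm_smult[OF sq] subsetD[OF sc_rees[OF gs(1) g, of n] scI] u by blast
    qed
  qed blast
  then obtain c where c: "\<forall>n. ?W (n + c) \<subseteq> pw I n (?W c)"
    using artin_rees[OF gs(1), of ?W] gs(2) by blast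
  have pwq: "pw I j (quot U x) \<subseteq> quot U x \<and> pw I j (quot U x) \<subseteq> U \<uplus> sc x (pw I j (carrier M))" for j
  proof
    show "pw I j (quot U x) \<subseteq> quot U x" by (rule pw_subset[OF I_subset sq])
    have "pw I j (quot U x) = pw I j U \<uplus> sc x (pw I j (carrier M))"
      by (simp add: pw_join pw_sc I_subset U sm_sc xc sm_carrier_set)
    also have "\<dots> \<subseteq> U \<uplus> sc x (pw I j (carrier M))"
      by (intro join_mono pw_subset I_subset U order_refl)
    finally show "pw I j (quot U x) \<subseteq> U \<uplus> sc x (pw I j (carrier M))" .
  qed
  have climb: "u \<in> F U n"
    if s: "K \<le> s" "s \<le> n" and u: "u \<in> F U s" and xu: "x *\<^sub>M u \<in> F U (Suc n)" for s n u
    using s(2,1) u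
  proof (induction s rule: inc_induct)
    case (step s)
    obtain v q where v: "u = v +\<^sub>M q" "v \<in> pw I s (carrier M)" "q \<in> U" using step.prems(2) by (rule joinE)
    have vc: "v \<in> carrier M" "q \<in> carrier M" using sm_carrier[OF sm_pwI v(2)] sm_carrier[OF U v(3)] by auto
    have "x *\<^sub>M u = x *\<^sub>M v +\<^sub>M x *\<^sub>M q" unfolding v(1) using xc vc by (rule smult_r_distr)
    moreover have "x *\<^sub>M q \<in> F U (Suc n)" using F_upper[OF U] sm_smult[OF U xc v(3)] by blast
    ultimately have "x *\<^sub>M v \<in> F U (Suc n)"
      using sm_addD1[OF sm_F[OF U], of "x *\<^sub>M v" "x *\<^sub>M q" "Suc n"] xu xc vc by simp
    then have "x *\<^sub>M v \<in> F U (Suc (Suc s))" using F_antimono[of "Suc (Suc s)" "Suc n" U] step.hyps by auto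
    moreover have "x *\<^sub>M v \<in> rees gs (Suc s)" unfolding rees using actI[OF x(1) v(2)] by simp
    ultimately have "v \<in> F U (Suc s)" using K step.prems(1) v(2) rees by blast
    then have "u \<in> F U (Suc s)" unfolding v(1)
      using subsetD[OF F_upper[OF U] v(3)] by (intro sm_add sm_F U) blast+
    then show ?case using step.IH step.prems(1) by simp
  qed
  have "u \<in> F U n" if n: "n \<ge> c + K" and u: "u \<in> colon (F U (Suc n)) x" for n u
  proof -
    have uc: "u \<in> carrier M" and xu: "x *\<^sub>M u \<in> F U (Suc n)" using u unfolding colon_def by auto
    obtain i q where i: "x *\<^sub>M u = i +\<^sub>M q" "i \<in> pw I (Suc n) (carrier M)" "q \<in> U" using xu by (rule joinE)
    have ic: "i \<in> carrier M" "q \<in> carrier M" using sm_carrier[OF sm_pwI i(2)] sm_carrier[OF U i(3)] by auto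
    have "x *\<^sub>M u \<in> quot U x" using quotI[OF sm_zero[OF U] uc, of x] uc xc by simp
    then have "i \<in> quot U x"
      using sm_addD1[OF sq ic(1), of q] quot_upper[OF U xc] i(1,3) by auto
    then have "i \<in> ?W (Suc n - c + c)" using i(2) n rees by simp
    then have "i \<in> pw I (Suc n - c) (?W c)" using c by blast
    also have "\<dots> \<subseteq> pw I (Suc n - c) (quot U x)"
      by (intro pw_mono I_subset sm_Int sq sm_rees gs(1)) blast
    also have "\<dots> \<subseteq> U \<uplus> sc x (pw I (Suc n - c) (carrier M))" using pwq by blast
    finally obtain q' w where w: "i = q' +\<^sub>M x *\<^sub>M w" "q' \<in> U" "w \<in> pw I (Suc n - c) (carrier M)"
      unfolding join_def sc_def by blast
    have wc: "w \<in> carrier M" "q' \<in> carrier M" using sm_carrier[OF sm_pwI w(3)] sm_carrier[OF U w(2)] by auto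
    have "x *\<^sub>M u = (q' +\<^sub>M q) +\<^sub>M x *\<^sub>M w" using i(1) w(1) wc ic xc by (simp add: M.a_ac)
    then have "x *\<^sub>M u -\<^sub>M x *\<^sub>M w = q' +\<^sub>M q" using wc ic xc by (simp add: a_minus_def M.a_assoc M.r_neg)
    then have d: "u -\<^sub>M w \<in> U" using regD_diff[OF x(2) U xc uc wc(1)] sm_add[OF U w(2) i(3)] by simp
    have "w +\<^sub>M (u -\<^sub>M w) = u" using uc wc by (simp add: a_minus_def M.a_ac M.r_neg1 M.r_neg2 M.r_neg)
    then have "u \<in> F U (Suc n - c)" using joinI[OF w(3) d] by simp
    moreover have "n - c \<le> Suc n - c" by simp
    ultimately have "u \<in> F U (n - c)" using subsetD[OF F_antimono] by blast
    then show ?thesis using climb[of "n - c" n u] n xu by simp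
  qed
  then show ?thesis by blast
qed

lemma superficial_element:
  assumes U: "sm U" and dp: "dp \<mm> (Suc k) U"
  shows "\<exists>x\<in>I. reg U x \<and> dp \<mm> k (quot U x) \<and> (\<exists>n0. \<forall>n\<ge>n0. colon (F U (Suc n)) x \<subseteq> F U n)"
proof -
  obtain gs where gs: "set gs \<subseteq> carrier R" "I = Idl (set gs)" by (rule ideal_generators[OF ideal_I])
  have rees: "rees gs n = pw I n (carrier M)" for n using rees_eq_pw[OF gs(1)] gs(2) by simp
  obtain y where y: "y \<in> \<mm>" "reg U y" using dp by auto
  \<comment> \<open>Some power of the regular element of \<mm> lies in \<open>I\<close>; this makes
    \<open>U\<close> socle-free with respect to \<open>I\<close>, so \<open>x\<close> can be sought
    in \<open>I\<close>.\<close>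
  obtain j :: nat where j: "y [^] j \<in> I" using power_in_I[OF y(1)] by blast
  have "reg U (y [^] j)" using reg_pow[OF y(2)] y(1) \<mm>_subset by auto
  then have sf: "socle_free I U" using j by (rule reg_imp_socle_free)
  obtain \<B>1 where B1: "finite \<B>1" "\<forall>B\<in>\<B>1. ideal B R \<and> \<not> I \<subseteq> B" "\<forall>x\<in>I. x \<notin> \<Union>\<B>1 \<longrightarrow> reg U x"
    using general_regular[OF ideal_I U sf] by blast
  \<comment> \<open>The Rees module modulo this family is the associated graded module of
    \<open>M / U\<close>.\<close>
  let ?Z = "\<lambda>n. F U (Suc n) \<inter> rees gs n"
  have "graded gs ?Z"
  proof (rule gradedI)
    show "sm (F U (Suc n) \<inter> rees gs n)" for n by (intro sm_Int sm_F U sm_rees gs(1))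
    show "g *\<^sub>M u \<in> F U (Suc (Suc n)) \<inter> rees gs (Suc n)" if g: "g \<in> set gs" and u: "u \<in> F U (Suc n) \<inter> rees gs n" for g n u
    proof -
      have "g \<in> I" using g genideal_self[OF gs(1)] gs(2) by blast
      then have "g *\<^sub>M u \<in> F U (Suc (Suc n))" using smult_F[OF U] u by blast
      moreover have "g *\<^sub>M u \<in> rees gs (Suc n)" using subsetD[OF sc_rees[OF gs(1) g, of n] scI] u by blast
      ultimately show ?thesis by blast
    qed
  qed blast
  then obtain \<B>2 where B2: "finite \<B>2" "\<forall>B\<in>\<B>2. ideal B R \<and> \<not> I \<subseteq> B"
    "\<forall>x\<in>I. x \<notin> \<Union>\<B>2 \<longrightarrow> (\<exists>K. \<forall>n\<ge>K. \<forall>u\<in>rees gs n. x *\<^sub>M u \<in> ?Z (Suc n) \<longrightarrow> u \<in> ?Z n)"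
    using general_nonzerodivisor[OF gs(1), of ?Z] unfolding gs(2) by blast
  have "\<exists>x\<in>I. x \<notin> \<Union>(\<B>1 \<union> \<B>2)"
    using B1(1,2) B2(1,2) by (intro avoidance ideal_I) auto
  then obtain x where x: "x \<in> I" "x \<notin> \<Union>\<B>1" "x \<notin> \<Union>\<B>2" by blast
  have r: "reg U x" using B1(3) x by blast
  obtain K where K: "\<forall>n\<ge>K. \<forall>u\<in>rees gs n. x *\<^sub>M u \<in> ?Z (Suc n) \<longrightarrow> u \<in> ?Z n"
    using B2(3) x by blast
  have "\<exists>n0. \<forall>n\<ge>n0. colon (F U (Suc n)) x \<subseteq> F U n"
    by (rule superficial_colon[OF U x(1) r gs K])
  moreover have "dp \<mm> k (quot U x)" using dp_exchange[OF U dp _ r] x(1) I_le_\<mm> by blast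
  ultimately show ?thesis using x(1) r by blast
qed

text \<open>Length is additive in the exact sequence given by multiplication by \<open>x\<close> on
  \<open>M\<close> modulo \<open>F U (Suc n)\<close>: the kernel is controlled by the colon, which
  is \<open>F U n\<close>, and the cokernel belongs to \<open>quot U x\<close>.\<close>

lemma len_superficial:
  assumes U: "sm U" and x: "x \<in> I" and n: "colon (F U (Suc n)) x \<subseteq> F U n"
  shows "len (F U (Suc n)) (carrier M) = len (F U n) (carrier M) + len (F (quot U x) (Suc n)) (carrier M)"
proof -
  have xc: "x \<in> carrier R" using x I_subset by blast
  let ?Z = "F U (Suc n)" and ?Y = "sc x (carrier M)"
  have sY: "sm ?Y" by (rule sm_sc[OF xc sm_carrier_set])
  have sZ: "sm ?Z" by (rule sm_F[OF U])
  have col: "colon ?Z x = F U n"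
    using n smult_F[OF U x] sm_carrier[OF sm_F[OF U]] unfolding colon_def by blast
  have FF: "F (quot U x) (Suc n) = ?Y \<uplus> ?Z"
    using join_assoc[OF sm_pwI U sY, of "Suc n"] join_commute[OF sZ sY] by simp
  have "len ?Z (carrier M) = len ?Z (?Y \<uplus> ?Z) + len (?Y \<uplus> ?Z) (carrier M)"
    by (intro len_add sZ sm_join sY sm_carrier_set join_upper2 sm_subset)
  also have "len ?Z (?Y \<uplus> ?Z) = len (carrier M \<inter> colon ?Z x) (carrier M)"
    by (rule len_sc[OF xc sm_carrier_set sZ])
  also have "carrier M \<inter> colon ?Z x = F U n" unfolding col using sm_subset[OF sm_F[OF U]] by blast
  finally show ?thesis unfolding FF .
qed

section \<open>The bound in dimension one\<close>

text \<open>Multiplication by \<open>x\<close> induces a map from \<open>A / B\<close> to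
  \<open>M / C\<close> whose image contains \<open>B / C\<close>. It is used for the filtrations by
  powers of \<open>I\<close> and of \<mm>.\<close>

lemma len_descent:
  assumes x: "x \<in> carrier R" and s: "sm A" "sm B" "sm C"
    and le: "B \<subseteq> sc x A \<uplus> C" "sc x B \<subseteq> C" "B \<subseteq> A"
  shows "len C B \<le> len B A"
proof -
  have "len C B \<le> len C (sc x A \<uplus> C)" by (rule len_mono[OF le(1)])
  also have "\<dots> = len (A \<inter> colon C x) A" by (rule len_sc[OF x s(1,3)])
  also have "\<dots> \<le> len B A" using le(2,3) sc_le_iff[OF s(2)] by (intro len_antimono) blast
  finally show ?thesis .
qed

lemma len_le_1_cases:
  assumes s: "sm W" "sm Y" "sm V" and le: "W \<subset> Y" "Y \<subseteq> V" and len: "len W V \<le> 1"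
  shows "Y = V"
proof (rule ccontr)
  assume "Y \<noteq> V"
  then have "1 + 1 \<le> len W Y + len Y V" using len_pos[OF s(1,2) le(1)] len_pos[OF s(2,3)] le(2)
    by (intro add_mono) auto
  also have "\<dots> = len W V" using le by (intro len_add[symmetric] s) auto
  finally have "(1::enat) + 1 \<le> 1" using len by (rule order_trans)
  then show False by (simp add: one_enat_def)
qed

text \<open>A module version of a lemma of Eakin and Sathaye. A general \<open>x\<close> has the longest image, and
  by induction one more general factor can be exchanged for \<open>x\<close> without losing length.\<close>

lemma eakin_sathaye:
  assumes T: "sm T" and y: "y \<in> carrier R"
    and len: "len T (sc y (pw I i (carrier M)) \<uplus> T) \<le> enat i"
    and B: "finite \<B>" "\<forall>B\<in>\<B>. ideal B R \<and> \<not> I \<subseteq> B"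
  shows "\<exists>x\<in>I. x \<notin> \<Union>\<B> \<and> sc y (pw I i (carrier M)) \<uplus> T =
    (case i of 0 \<Rightarrow> T | Suc j \<Rightarrow> sc y (sc x (pw I j (carrier M))) \<uplus> T)"
  using y len B
proof (induction i arbitrary: y \<B>)
  case 0
  let ?A = "sc y (pw I 0 (carrier M)) \<uplus> T"
  have sA: "sm ?A" "T \<subseteq> ?A" using 0 T by (auto intro!: sm_join sm_sc sm_carrier_set subsetD[OF join_upper2])
  have "?A = T"
  proof (rule ccontr)
    assume "?A \<noteq> T"
    then have "1 \<le> len T ?A" using sA by (intro len_pos T) auto
    then have "(1::enat) \<le> enat 0" using 0(2) by (rule order_trans)
    then show False by (simp add: one_enat_def)
  qed
  moreover have "\<exists>x\<in>I. x \<notin> \<Union>\<B>" using 0 by (intro avoidance ideal_I) auto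
  ultimately show ?case by auto
next
  case (Suc i)
  note y = Suc.prems(1)
  let ?C = "carrier M"
  let ?A = "sc y (pw I (Suc i) ?C) \<uplus> T"
  define G where "G x = sc y (sc x (pw I i ?C)) \<uplus> T" for x
  have Ic: "x \<in> carrier R" if "x \<in> I" for x using that I_subset by blast
  have sG: "sm (G x)" if "x \<in> I" for x unfolding G_def by (intro sm_join sm_sc sm_pwI T y Ic that)
  have TG: "T \<subseteq> G x" if "x \<in> I" for x unfolding G_def by (intro join_upper2 sm_sc sm_pwI T y Ic that)
  have sA: "sm ?A" by (intro sm_join sm_sc sm_pwI T y)
  have GA: "G x \<subseteq> ?A" if "x \<in> I" for x
    unfolding G_def using sc_pw[OF that, of i ?C] by (intro join_mono sc_mono order_refl)
  have fin: "len T (G x) \<le> enat (Suc i)" if "x \<in> I" for x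
    using len_mono[OF GA[OF that], of T] Suc.prems(2) by (rule order_trans)
  \<comment> \<open>The lengths are bounded by \<open>Suc i\<close>, so a general \<open>x\<close>
    with the longest image exists.\<close>
  let ?S = "{n. \<exists>x\<in>I. x \<notin> \<Union>\<B> \<and> len T (G x) = enat n}"
  have Sb: "?S \<subseteq> {..Suc i}" using fin by force
  have Sfin: "finite ?S" by (rule finite_subset[OF Sb]) simp
  have memS: "\<exists>n\<in>?S. len T (G x) = enat n" if "x \<in> I" "x \<notin> \<Union>\<B>" for x
    using fin[OF that(1)] enat_ile that by blast
  have "\<exists>x\<in>I. x \<notin> \<Union>\<B>" using Suc.prems(3,4) by (intro avoidance ideal_I) auto
  then have "?S \<noteq> {}" using memS by blast
  then have "Max ?S \<in> ?S" by (rule Max_in[OF Sfin])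
  then obtain x where x: "x \<in> I" "x \<notin> \<Union>\<B>" "len T (G x) = enat (Max ?S)" by blast
  have max: "len T (G x') \<le> len T (G x)" if x': "x' \<in> I" "x' \<notin> \<Union>\<B>" for x'
  proof -
    obtain n where n: "n \<in> ?S" "len T (G x') = enat n" using memS[OF x'] by blast
    have "n \<le> Max ?S" by (rule Max_ge[OF Sfin n(1)])
    then show ?thesis unfolding n(2) x(3) by simp
  qed
  have "G x = ?A"
  proof (rule ccontr)
    assume ne: "G x \<noteq> ?A"
    then have "len T (G x) + 1 \<le> len T ?A"
      using GA[OF x(1)] by (intro len_strict_mono T sG x(1) sA TG) blast
    then have "len T (G x) + 1 \<le> enat (Suc i)" using Suc.prems(2) by (rule order_trans)
    then have small: "len T (G x) \<le> enat i" unfolding x(3) by (simp add: one_enat_def)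
    let ?P = "sc y (pw I i ?C)"
    have sP: "sm ?P" by (intro sm_sc y sm_pwI)
    \<comment> \<open>\<open>I \<subseteq> W\<close> would give \<open>G x = ?A\<close>, so
      \<open>W\<close> may join the ideals to be avoided. The contradiction will be that an
      \<open>x'\<close> outside \<open>W\<close> still satisfies \<open>G x' = G x\<close>, which
      puts it into \<open>W\<close>.\<close>
    define W where "W = {a \<in> carrier R. \<forall>v\<in>?P. a *\<^sub>M v \<in> G x}"
    have W: "ideal W R" unfolding W_def by (rule ideal_into[OF sG[OF x(1)] sm_subset[OF sP]])
    have "\<not> I \<subseteq> W"
    proof
      assume "I \<subseteq> W"
      then have "act I ?P \<subseteq> G x" unfolding W_def by (intro act_least sG x(1)) blast
      moreover have "act I ?P = sc y (pw I (Suc i) ?C)" using act_sc[OF I_subset y sm_pwI] by simp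
      ultimately have "?A \<subseteq> G x" using TG[OF x(1)] by (intro join_least sG x(1)) auto
      then show False using ne GA[OF x(1)] by blast
    qed
    have xc: "x \<in> carrier R" by (rule Ic[OF x(1)])
    have yx: "y \<otimes> x \<in> carrier R" using y xc by simp
    have Gyx: "sc (y \<otimes> x) (pw I i ?C) \<uplus> T = G x" unfolding G_def by (simp add: sc_sc[OF y xc sm_pwI])
    \<comment> \<open>The factor \<open>x\<close> is absorbed into \<open>y\<close>. The exponent
      drops to \<open>i\<close>, and so does the length bound, since \<open>G x\<close> is strictly
      smaller than \<open>?A\<close>.\<close>
    have "\<exists>x'\<in>I. x' \<notin> \<Union>(insert W \<B>) \<and> sc (y \<otimes> x) (pw I i ?C) \<uplus> T =
        (case i of 0 \<Rightarrow> T | Suc j \<Rightarrow> sc (y \<otimes> x) (sc x' (pw I j ?C)) \<uplus> T)"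
      using small Suc.prems(3,4) W \<open>\<not> I \<subseteq> W\<close> unfolding Gyx[symmetric]
      by (intro Suc.IH[OF yx]) auto
    then obtain x' where x': "x' \<in> I" "x' \<notin> \<Union>\<B>" "x' \<notin> W"
      and eq: "G x = (case i of 0 \<Rightarrow> T | Suc j \<Rightarrow> sc (y \<otimes> x) (sc x' (pw I j ?C)) \<uplus> T)"
      unfolding Gyx by blast
    have x'c: "x' \<in> carrier R" by (rule Ic[OF x'(1)])
    have "G x \<subseteq> G x'"
    proof (cases i)
      case 0
      then show ?thesis using eq TG[OF x'(1)] by simp
    next
      case (Suc j)
      have "sc (y \<otimes> x) (sc x' (pw I j ?C)) = sc y (sc x (sc x' (pw I j ?C)))"
        by (rule sc_sc[OF y xc sm_sc[OF x'c sm_pwI], symmetric])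
      also have "\<dots> = sc y (sc x' (sc x (pw I j ?C)))" by (simp only: sc_commute[OF xc x'c sm_pwI])
      also have "\<dots> \<subseteq> sc y (sc x' (pw I i ?C))" unfolding Suc by (intro sc_mono sc_pw x(1))
      finally have "sc (y \<otimes> x) (sc x' (pw I j ?C)) \<uplus> T \<subseteq> G x'" unfolding G_def by (intro join_mono order_refl)
      then show ?thesis using eq Suc by simp
    qed
    moreover have "G x = G x'"
    proof (rule ccontr)
      assume "G x \<noteq> G x'"
      then have "len T (G x) + 1 \<le> len T (G x')"
        using calculation by (intro len_strict_mono T sG x(1) x'(1) TG) blast
      also have "\<dots> \<le> len T (G x)" by (rule max[OF x'(1,2)])
      finally show False unfolding x(3) by (simp add: one_enat_def)
    qed
    have "x' *\<^sub>M v \<in> G x" if v: "v \<in> ?P" for v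
    proof -
      have "sc x' ?P = sc y (sc x' (pw I i ?C))" by (rule sc_commute[OF x'c y sm_pwI])
      then have "x' *\<^sub>M v \<in> sc y (sc x' (pw I i ?C))" using scI[OF v, of x'] by simp
      moreover have "sc y (sc x' (pw I i ?C)) \<subseteq> G x'"
        unfolding G_def by (intro join_upper1 sm_sc sm_pwI T y x'c)
      ultimately show ?thesis using \<open>G x = G x'\<close> by blast
    qed
    then have "x' \<in> W" unfolding W_def using x'c by blast
    with x'(3) show False by simp
  qed
  then show ?case using x(1,2) unfolding G_def by auto
qed

lemma act_join_absorb:
  assumes J: "J \<subseteq> carrier R" and V: "sm V" and U: "sm U"
  shows "act J (V \<uplus> U) \<uplus> U = act J V \<uplus> U"
proof -
  have "act J (V \<uplus> U) \<uplus> U = (act J V \<uplus> act J U) \<uplus> U" by (simp only: act_join[OF J V U])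
  also have "\<dots> = act J V \<uplus> (act J U \<uplus> U)" by (intro join_assoc sm_act J V U)
  also have "act J U \<uplus> U = U" by (intro join_absorb2 sm_act act_subset J U)
  finally show ?thesis .
qed

lemma pw_join_absorb:
  assumes J: "J \<subseteq> carrier R" and V: "sm V" and U: "sm U"
  shows "pw J j (V \<uplus> U) \<uplus> U = pw J j V \<uplus> U"
proof -
  have "pw J j (V \<uplus> U) \<uplus> U = (pw J j V \<uplus> pw J j U) \<uplus> U" by (simp only: pw_join[OF J V U])
  also have "\<dots> = pw J j V \<uplus> (pw J j U \<uplus> U)" by (intro join_assoc sm_pw J V U)
  also have "pw J j U \<uplus> U = U" by (intro join_absorb2 sm_pw pw_subset J U)
  finally show ?thesis .
qed

text \<open>The inclusion propagates to all degrees from \<open>n\<close> on, where multiplication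
  by \<open>x\<close> then maps each graded piece of \<open>M / U\<close> onto the next one.\<close>

lemma hilbert_function_descent:
  assumes U: "sm U" and x: "x \<in> I" and n: "pw I (Suc n) (carrier M) \<subseteq> sc x (pw I n (carrier M)) \<uplus> U"
  shows "len (F U (Suc (Suc n + i))) (F U (Suc n + i)) \<le> len (F U (Suc n)) (F U n)"
proof -
  have xc: "x \<in> carrier R" using x I_subset by blast
  have step: "len (F U (Suc (Suc k))) (F U (Suc k)) \<le> len (F U (Suc k)) (F U k)" if k: "k \<ge> n" for k
  proof (rule len_descent[OF xc sm_F[OF U] sm_F[OF U] sm_F[OF U]])
    let ?i = "k - n"
    have "pw I (Suc k) (carrier M) = pw I ?i (pw I (Suc n) (carrier M))"
      using pw_add[of I ?i "Suc n" "carrier M"] k by simp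
    also have "\<dots> \<subseteq> pw I ?i (sc x (pw I n (carrier M)) \<uplus> U)"
      by (intro pw_mono I_subset sm_pwI sm_join sm_sc xc U n)
    also have "\<dots> = sc x (pw I ?i (pw I n (carrier M))) \<uplus> pw I ?i U"
      by (simp add: pw_join pw_sc I_subset xc sm_sc sm_pwI U)
    also have "\<dots> \<subseteq> sc x (pw I k (carrier M)) \<uplus> U"
      using pw_add[of I ?i n "carrier M"] k by (intro join_mono pw_subset I_subset U) simp
    also have "\<dots> \<subseteq> sc x (F U k) \<uplus> F U (Suc (Suc k))" by (intro join_mono sc_mono pw_le_F F_upper U)
    finally have *: "pw I (Suc k) (carrier M) \<subseteq> sc x (F U k) \<uplus> F U (Suc (Suc k))" .
    have s: "sm (sc x (F U k))" "sm (F U (Suc (Suc k)))" by (intro sm_sc xc sm_F U)+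
    have "U \<subseteq> sc x (F U k) \<uplus> F U (Suc (Suc k))" using F_upper[OF U] join_upper2[OF s] by blast
    then show "F U (Suc k) \<subseteq> sc x (F U k) \<uplus> F U (Suc (Suc k))" using * by (intro join_least sm_join s)
    show "sc x (F U (Suc k)) \<subseteq> F U (Suc (Suc k))" unfolding sc_def using smult_F[OF U x] by blast
    show "F U (Suc k) \<subseteq> F U k" by (rule F_antimono) simp
  qed
  show ?thesis
  proof (induction i)
    case 0
    then show ?case using step[of n] by simp
  next
    case (Suc i)
    then show ?case using step[of "Suc n + i"] by (simp add: order_trans)
  qed
qed

lemma len_chain_ge:
  assumes P: "\<And>j. sm (P j)" "\<And>j. P (Suc j) \<subset> P j"
  shows "enat i \<le> len (P (j + i)) (P j)"
proof (induction i)
  case 0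
  then show ?case by (simp add: zero_enat_def[symmetric])
next
  case (Suc i)
  have anti: "P (j + i) \<subseteq> P j" using lift_Suc_antimono_le[of P] P(2) by (simp add: less_imp_le)
  have "enat (Suc i) = 1 + enat i" by (simp add: one_enat_def)
  also have "\<dots> \<le> len (P (j + Suc i)) (P (j + i)) + len (P (j + i)) (P j)"
    using P by (intro add_mono Suc len_pos) auto
  also have "\<dots> = len (P (j + Suc i)) (P j)"
    using anti P(2)[of "j + i"] by (intro len_add[symmetric] P) auto
  finally show ?case .
qed

lemma len_chain_le:
  assumes P: "\<And>j. sm (P j)" "\<And>j. P (Suc j) \<subset> P j" and le: "\<And>k. k \<ge> j \<Longrightarrow> len (P (Suc k)) (P k) \<le> 1"
  shows "len (P (j + i)) (P j) \<le> enat i"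
proof (induction i)
  case 0
  then show ?case by (simp add: len_self zero_enat_def)
next
  case (Suc i)
  have anti: "P (j + i) \<subseteq> P j" using lift_Suc_antimono_le[of P] P(2) by (simp add: less_imp_le)
  have "len (P (j + Suc i)) (P j) = len (P (j + Suc i)) (P (j + i)) + len (P (j + i)) (P j)"
    using anti P(2)[of "j + i"] by (intro len_add P) auto
  also have "\<dots> \<le> 1 + enat i" using le[of "j + i"] Suc by (intro add_mono) auto
  finally show ?case by (simp add: one_enat_def)
qed

text \<open>As over a discrete valuation ring, a submodule of \<open>\<mm> N\<close> that contains some \<open>\<mm>\<^sup>k N\<close> is, modulo \<open>U\<close>,
  itself of the form \<open>\<mm>\<^sup>c N\<close>. This is applied to \<open>I N\<close>.\<close>

lemma uniserial_case:
  assumes U: "sm U" and N: "N = pw I n (carrier M)"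
    and P: "\<And>j. P j = pw \<mm> j N \<uplus> U" and strict: "\<And>j. P (Suc j) \<subset> P j"
    and one: "len (P 2) (P 1) \<le> 1"
    and b: "b \<ge> 1" "F U (Suc n) \<subseteq> P b"
  shows "\<exists>c\<ge>1. \<forall>i. F U (n + i) = P (i * c) \<and> (i \<ge> 1 \<longrightarrow> len (P (i * c + c)) (P (i * c)) \<le> enat c)"
proof -
  have sN: "sm N" unfolding N by (rule sm_pwI)
  have spN: "sm (pw \<mm> j N)" for j by (rule sm_pw[OF \<mm>_subset sN])
  have sP: "sm (P j)" for j unfolding P by (rule sm_join[OF spN U])
  have UP: "U \<subseteq> P j" for j unfolding P by (rule join_upper2[OF spN U])
  have pwP: "pw \<mm> j N \<subseteq> P j" for j unfolding P by (rule join_upper1[OF spN U])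
  have anti: "i \<le> j \<Longrightarrow> P j \<subseteq> P i" for i j
    using lift_Suc_antimono_le[of P] strict by (simp add: less_imp_le)
  have P1: "P 1 = act \<mm> N \<uplus> U" unfolding P by simp
  \<comment> \<open>A product outside \<open>P 2\<close> makes \<open>sc a N\<close> fill the
    quotient of \<open>P 1\<close> by \<open>P 2\<close>, which has length at most one. By
    Nakayama's lemma \<open>act \<mm> N\<close> is then \<open>sc a N\<close> modulo
    \<open>U\<close>: on \<open>N\<close> the ideal \<mm> acts like a principal ideal.\<close>
  obtain a v where av: "a \<in> \<mm>" "v \<in> N" "a *\<^sub>M v \<notin> P 2"
  proof -
    have "\<not> act \<mm> N \<subseteq> P 2"
    proof
      assume "act \<mm> N \<subseteq> P 2"
      then have "P 1 \<subseteq> P 2" unfolding P1 by (intro join_least sP UP)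
      then show False using strict[of 1] by (simp add: numeral_2_eq_2)
    qed
    then have "\<not> (\<forall>a\<in>\<mm>. \<forall>v\<in>N. a *\<^sub>M v \<in> P 2)" using act_least[OF sP, of \<mm> N 2] by blast
    then show thesis using that by blast
  qed
  have ac: "a \<in> carrier R" using av(1) \<mm>_subset by blast
  have aN: "sm (sc a N)" "sc a N \<subseteq> act \<mm> N" using sm_sc[OF ac sN] sc_subset_act[OF av(1)] by auto
  have actN_P1: "act \<mm> N \<subseteq> P 1" using pwP[of 1] by simp
  have Y: "P 2 \<uplus> sc a N = P 1"
  proof (rule len_le_1_cases[OF sP[of 2] _ sP[of 1] _ _ one])
    show "sm (P 2 \<uplus> sc a N)" by (rule sm_join[OF sP aN(1)])
    have "a *\<^sub>M v \<in> P 2 \<uplus> sc a N" using scI[OF av(2), of a] join_upper2[OF sP[of 2] aN(1)] by blast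
    then show "P 2 \<subset> P 2 \<uplus> sc a N" using join_upper1[OF sP[of 2] aN(1)] av(3) by blast
    show "P 2 \<uplus> sc a N \<subseteq> P 1" using aN(2) actN_P1 anti[of 1 2] by (intro join_least sP) auto
  qed
  have main: "act \<mm> N \<subseteq> U \<uplus> sc a N"
  proof (rule nakayama)
    show "sm (act \<mm> N)" by (rule sm_act[OF \<mm>_subset sN])
    show "sm (U \<uplus> sc a N)" by (rule sm_join[OF U aN(1)])
    have "P 2 = act \<mm> (act \<mm> N) \<uplus> U" unfolding P by (simp add: numeral_2_eq_2)
    then have "P 1 = act \<mm> (act \<mm> N) \<uplus> U \<uplus> sc a N" using Y by simp
    also have "\<dots> = act \<mm> (act \<mm> N) \<uplus> (U \<uplus> sc a N)"
      by (intro join_assoc sm_act \<mm>_subset sN U aN(1))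
    finally show "act \<mm> N \<subseteq> act \<mm> (act \<mm> N) \<uplus> (U \<uplus> sc a N)" using actN_P1 by simp
  qed
  \<comment> \<open>Multiplication by \<open>a\<close> carries each quotient onto the next. The
    range starts at \<open>k = 1\<close> because the length of \<open>P 0\<close> over
    \<open>P 1\<close> is not restricted.\<close>
  have le1: "len (P (Suc k)) (P k) \<le> 1" if "k \<ge> 1" for k
    using that
  proof (induction k rule: dec_induct)
    case base
    then show ?case using one by (simp add: numeral_2_eq_2)
  next
    case (step k)
    have "len (P (Suc (Suc k))) (P (Suc k)) \<le> len (P (Suc k)) (P k)"
    proof (rule len_descent[OF ac sP sP sP])
      have "pw \<mm> (Suc k) N = pw \<mm> k (act \<mm> N)" by (rule pw_Suc2)
      also have "\<dots> \<subseteq> pw \<mm> k (U \<uplus> sc a N)"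
        by (intro pw_mono \<mm>_subset sm_act sN sm_join U aN(1) main)
      also have "\<dots> = pw \<mm> k U \<uplus> sc a (pw \<mm> k N)"
        by (simp add: pw_join pw_sc \<mm>_subset U aN(1) ac sN)
      also have "\<dots> \<subseteq> U \<uplus> sc a (P k)" by (intro join_mono pw_subset \<mm>_subset U sc_mono pwP)
      also have "\<dots> \<subseteq> P (Suc (Suc k)) \<uplus> sc a (P k)" by (intro join_mono UP order_refl)
      also have "\<dots> = sc a (P k) \<uplus> P (Suc (Suc k))" by (intro join_commute sP sm_sc ac)
      finally have *: "pw \<mm> (Suc k) N \<subseteq> sc a (P k) \<uplus> P (Suc (Suc k))" .
      have s: "sm (sc a (P k))" by (intro sm_sc ac sP)
      have "U \<subseteq> sc a (P k) \<uplus> P (Suc (Suc k))" using UP join_upper2[OF s sP] by blast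
      then show "P (Suc k) \<subseteq> sc a (P k) \<uplus> P (Suc (Suc k))"
        using * unfolding P[of "Suc k"] by (intro join_least sm_join s sP)
      have "sc a (P (Suc k)) = sc a (pw \<mm> (Suc k) N) \<uplus> sc a U" unfolding P by (rule sc_join[OF ac spN U])
      also have "\<dots> \<subseteq> P (Suc (Suc k))"
        unfolding P[of "Suc (Suc k)"] by (intro join_mono sc_pw av(1) sc_subset ac U)
      finally show "sc a (P (Suc k)) \<subseteq> P (Suc (Suc k))" .
      show "P (Suc k) \<subseteq> P k" using strict by blast
    qed
    then show ?case using step.IH by (rule order_trans)
  qed
  let ?T = "F U (Suc n)"
  have sT: "sm ?T" by (rule sm_F[OF U])
  have FT: "?T = act I N \<uplus> U" unfolding N by simp
  obtain K where K: "pw \<mm> K (carrier M) \<subseteq> act I (carrier M)" using \<mm>_power_le_act by blast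
  have "pw \<mm> K N = pw I n (pw \<mm> K (carrier M))"
    unfolding N by (rule pw_commute[OF \<mm>_subset I_subset sm_carrier_set])
  also have "\<dots> \<subseteq> pw I n (act I (carrier M))"
    by (intro pw_mono I_subset sm_pw \<mm>_subset sm_carrier_set sm_act K)
  also have "\<dots> = act I N" unfolding N by (rule act_pw[OF I_subset sm_carrier_set, symmetric])
  finally have PK: "P K \<subseteq> ?T" unfolding P FT by (intro join_mono order_refl)
  have bound: "j \<le> K" if "?T \<subseteq> P j" for j
  proof (rule ccontr)
    assume "\<not> j \<le> K"
    then have "P j \<subseteq> P (Suc K)" by (intro anti) simp
    then show False using that PK strict[of K] by blast
  qed
  \<comment> \<open>The largest exponent for which \<open>I N\<close> lies in
    \<open>\<mm>\<^sup>c N\<close> modulo \<open>U\<close>. It exists because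
    \<open>P K \<subseteq> ?T\<close> bounds the exponents.\<close>
  define c where "c = Max {j. ?T \<subseteq> P j}"
  have fin: "finite {j. ?T \<subseteq> P j}" by (rule finite_subset[of _ "{..K}"]) (use bound in auto)
  have cin: "?T \<subseteq> P c" using Max_in[OF fin] b(2) unfolding c_def by blast
  have cb: "c \<ge> b" unfolding c_def using b(2) by (intro Max_ge[OF fin]) simp
  have cmax: "\<not> ?T \<subseteq> P (Suc c)"
  proof
    assume "?T \<subseteq> P (Suc c)"
    then have "Suc c \<le> c" unfolding c_def[symmetric] using Max_ge[OF fin, of "Suc c"] c_def by simp
    then show False by simp
  qed
  \<comment> \<open>By maximality \<open>?T\<close> is not contained in \<open>P (Suc c)\<close>, so
    it fills a quotient of length at most one; Nakayama's lemma turns this into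
    \<open>P c \<subseteq> ?T\<close>.\<close>
  have "P (Suc c) \<uplus> ?T = P c"
  proof (rule len_le_1_cases[OF sP[of "Suc c"] _ sP[of c] _ _ le1])
    show "sm (P (Suc c) \<uplus> ?T)" by (rule sm_join[OF sP sT])
    show "P (Suc c) \<subset> P (Suc c) \<uplus> ?T"
      using join_upper1[OF sP[of "Suc c"] sT] join_upper2[OF sP[of "Suc c"] sT] cmax by blast
    show "P (Suc c) \<uplus> ?T \<subseteq> P c" by (rule join_least[OF sP psubset_imp_subset[OF strict] cin])
    show "1 \<le> c" using b(1) cb by simp
  qed
  then have "pw \<mm> c N \<subseteq> (act \<mm> (pw \<mm> c N) \<uplus> U) \<uplus> ?T" using pwP[of c] unfolding P[of "Suc c"] by simp
  also have "\<dots> = act \<mm> (pw \<mm> c N) \<uplus> (U \<uplus> ?T)" by (intro join_assoc sm_act \<mm>_subset spN U sT)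
  also have "U \<uplus> ?T = ?T" by (intro join_absorb2 U sT F_upper)
  finally have "pw \<mm> c N \<subseteq> ?T" by (rule nakayama[OF spN sT])
  then have "P c \<subseteq> ?T" unfolding P[of c] by (intro join_least sT F_upper U)
  then have Tc: "?T = P c" using cin by blast
  \<comment> \<open>The factor \<open>I\<close> is moved past the powers of \<mm> to
    \<open>N\<close>, where it may be replaced by \<open>\<mm>\<^sup>c\<close>; all of this is
    modulo \<open>U\<close>.\<close>
  have FP: "F U (n + i) = P (i * c)" for i
  proof (induction i)
    case 0
    then show ?case unfolding P N by simp
  next
    case (Suc i)
    have "F U (n + Suc i) = act I (pw I (n + i) (carrier M)) \<uplus> U" by simp
    also have "\<dots> = act I (F U (n + i)) \<uplus> U" by (rule act_join_absorb[OF I_subset sm_pwI U, symmetric])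
    also have "\<dots> = act I (pw \<mm> (i * c) N \<uplus> U) \<uplus> U" using Suc unfolding P by simp
    also have "\<dots> = act I (pw \<mm> (i * c) N) \<uplus> U" by (rule act_join_absorb[OF I_subset spN U])
    also have "\<dots> = pw \<mm> (i * c) (act I N) \<uplus> U"
      by (simp only: act_pw_commute[OF I_subset \<mm>_subset sN])
    also have "\<dots> = pw \<mm> (i * c) (act I N \<uplus> U) \<uplus> U"
      by (rule pw_join_absorb[OF \<mm>_subset sm_act[OF I_subset sN] U, symmetric])
    also have "\<dots> = pw \<mm> (i * c) (pw \<mm> c N \<uplus> U) \<uplus> U" using Tc unfolding FT P by simp
    also have "\<dots> = pw \<mm> (i * c) (pw \<mm> c N) \<uplus> U" by (rule pw_join_absorb[OF \<mm>_subset spN U])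
    also have "\<dots> = P (Suc i * c)" unfolding P pw_add[symmetric] by (simp add: add.commute)
    finally show ?case .
  qed
  have "len (P (i * c + c)) (P (i * c)) \<le> enat c" if i: "i \<ge> 1" for i
  proof (rule len_chain_le[of P, OF sP strict])
    fix k assume "k \<ge> i * c"
    moreover have "1 \<le> i * c" using mult_le_mono[of 1 i 1 c] i b(1) cb by simp
    ultimately have "1 \<le> k" by (metis order_trans)
    then show "len (P (Suc k)) (P k) \<le> 1" by (rule le1)
  qed
  then show ?thesis using FP b(1) cb by (intro exI[of _ c]) auto
qed

lemma hilbert_function_ge:
  assumes U: "sm U" and b: "b \<ge> 2" and Ib: "act I (carrier M) \<subseteq> pw \<mm> b (carrier M)"
    and e: "\<And>k. k \<ge> k0 \<Longrightarrow> len (F U (Suc k)) (F U k) = enat e"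
  shows "enat e \<le> len (F U (Suc n)) (F U n) \<or> enat (n + b + 1) \<le> len (F U (Suc n)) (F U n)"
proof -
  let ?H = "\<lambda>k. len (F U (Suc k)) (F U k)"
  define N where "N = pw I n (carrier M)"
  define P where "P j = pw \<mm> j N \<uplus> U" for j
  have sN: "sm N" unfolding N_def by (rule sm_pwI)
  have spN: "sm (pw \<mm> j N)" for j by (rule sm_pw[OF \<mm>_subset sN])
  have sP: "sm (P j)" for j unfolding P_def by (rule sm_join[OF spN U])
  have P_Suc: "P (Suc j) \<subseteq> P j" for j
    unfolding P_def by (intro join_mono pw_antimono \<mm>_subset sN order_refl) simp
  have P0: "P 0 = F U n" unfolding P_def N_def by simp
  show ?thesis
  proof (cases "\<forall>j. P (Suc j) \<subset> P j")
    case False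
    \<comment> \<open>Degenerate case: by Nakayama's lemma
      \<open>pw \<mm> j N \<subseteq> U\<close>, so the filtration ends in \<open>U\<close> and
      \<open>e = 0\<close>.\<close>
    then obtain j where "P (Suc j) = P j" using P_Suc by blast
    then have "pw \<mm> j N \<subseteq> act \<mm> (pw \<mm> j N) \<uplus> U"
      using join_upper1[OF spN[of j] U] unfolding P_def by simp
    then have jU: "pw \<mm> j N \<subseteq> U" by (rule nakayama[OF spN U])
    have FU: "F U (n + j + i) = U" for i
    proof (rule join_absorb2[OF sm_pwI U])
      have "pw I (n + j + i) (carrier M) \<subseteq> pw I (j + n) (carrier M)"
        by (intro pw_antimono I_subset sm_carrier_set) simp
      also have "\<dots> = pw I j N" unfolding N_def by (rule pw_add)
      also have "\<dots> \<subseteq> pw \<mm> j N" by (rule pw_mono1[OF I_le_\<mm> \<mm>_subset sN])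
      finally show "pw I (n + j + i) (carrier M) \<subseteq> U" using jU by blast
    qed
    have "?H (n + j + k0) = enat e" by (intro e) simp
    moreover have "?H (n + j + k0) = 0" using FU[of k0] FU[of "Suc k0"] by (simp add: len_self)
    ultimately have "enat e = 0" by simp
    then show ?thesis by simp
  next
    case True
    then have strict: "P (Suc j) \<subset> P j" for j by blast
    have FPb: "F U (Suc n) \<subseteq> P b"
    proof -
      have "pw I (Suc n) (carrier M) = pw I n (act I (carrier M))" by (rule pw_Suc2)
      also have "\<dots> \<subseteq> pw I n (pw \<mm> b (carrier M))"
        by (intro pw_mono I_subset sm_act sm_pw \<mm>_subset sm_carrier_set Ib)
      also have "\<dots> = pw \<mm> b N" unfolding N_def by (rule pw_commute[OF I_subset \<mm>_subset sm_carrier_set])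
      finally show ?thesis unfolding P_def by (intro join_mono order_refl)
    qed
    have anti: "i \<le> j \<Longrightarrow> P j \<subseteq> P i" for i j
      using lift_Suc_antimono_le[of P] P_Suc by blast
    have "len (P b) (P 0) = len (P b) (P 1) + len (P 1) (P 0)"
      using b by (intro len_add sP anti) auto
    also have "len (P b) (P 1) = len (P b) (P 2) + len (P 2) (P 1)"
      using b by (intro len_add sP anti) auto
    finally have split: "len (P b) (P 0) = len (P b) (P 2) + len (P 2) (P 1) + len (P 1) (P 0)" .
    have Hb: "len (P b) (P 0) \<le> ?H n" unfolding P0 by (rule len_antimono[OF FPb])
    \<comment> \<open>Each of the \<open>b - 2\<close> steps from \<open>P 2\<close> down to
      \<open>P b\<close> is strict and counts at least one.\<close>
    have tail: "enat (b - 2) \<le> len (P b) (P 2)"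
      using len_chain_ge[of P "b - 2" 2, OF sP strict] le_add_diff_inverse[OF b] by metis
    show ?thesis
    proof (cases "len (P 1) (P 0) \<le> enat n")
      case True
      have sc1: "sc \<one> (pw I n (carrier M)) = N" unfolding N_def by (rule sc_one[OF sm_pwI])
      have NP1: "N \<uplus> P 1 = P 0"
      proof -
        have "U \<subseteq> P 1" unfolding P_def by (rule join_upper2[OF spN U])
        then have "P 0 \<subseteq> N \<uplus> P 1" unfolding P_def[of 0] pw.simps by (intro join_mono order_refl)
        moreover have "N \<subseteq> P 0" unfolding P_def pw.simps by (rule join_upper1[OF sN U])
        then have "N \<uplus> P 1 \<subseteq> P 0" using anti[of 0 1] by (intro join_least sP) auto
        ultimately show ?thesis by blast
      qed
      \<comment> \<open>With \<open>y = \<one>\<close> and \<open>T = P 1\<close>, the module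
        \<open>N\<close> becomes \<open>x I\<^sup>n\<^sup>-\<^sup>1 M\<close> modulo
        \<open>\<mm> N + U\<close>, and Nakayama's lemma will remove \<open>\<mm> N\<close>. For
        \<open>n = 0\<close> the conclusion would read \<open>P 0 = P 1\<close>, which strictness
        excludes.\<close>
      have "\<exists>x\<in>I. x \<notin> \<Union>{} \<and> sc \<one> (pw I n (carrier M)) \<uplus> P 1 =
          (case n of 0 \<Rightarrow> P 1 | Suc j \<Rightarrow> sc \<one> (sc x (pw I j (carrier M))) \<uplus> P 1)"
        using True by (intro eakin_sathaye sP) (simp_all add: sc1 NP1 del: One_nat_def)
      then obtain x where x: "x \<in> I"
        "P 0 = (case n of 0 \<Rightarrow> P 1 | Suc j \<Rightarrow> sc \<one> (sc x (pw I j (carrier M))) \<uplus> P 1)"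
        unfolding sc1 NP1 by blast
      have xc: "x \<in> carrier R" using x(1) I_subset by blast
      obtain j where j: "n = Suc j" using x(2) strict[of 0] by (cases n) auto
      let ?S = "sc x (pw I j (carrier M))"
      have sS: "sm ?S" by (intro sm_sc xc sm_pwI)
      have eq: "P 0 = ?S \<uplus> P 1" using x(2) j sc_one[OF sS] by simp
      have "N \<subseteq> P 0" unfolding P_def pw.simps by (rule join_upper1[OF sN U])
      also have "\<dots> = P 1 \<uplus> ?S" unfolding eq by (rule join_commute[OF sS sP])
      also have "\<dots> = act \<mm> N \<uplus> (U \<uplus> ?S)"
        unfolding P_def using join_assoc[OF sm_act[OF \<mm>_subset sN] U sS] by simp
      also have "U \<uplus> ?S = ?S \<uplus> U" by (rule join_commute[OF U sS])
      finally have "N \<subseteq> ?S \<uplus> U" by (rule nakayama[OF sN sm_join[OF sS U]])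
      then have desc: "pw I (Suc j) (carrier M) \<subseteq> sc x (pw I j (carrier M)) \<uplus> U" unfolding N_def j .
      have "?H (n + k0) \<le> ?H n"
      proof (cases k0)
        case (Suc i)
        have "pw I (Suc n) (carrier M) \<subseteq> sc x (pw I n (carrier M)) \<uplus> U"
        proof -
          have "pw I (Suc n) (carrier M) = act I (pw I (Suc j) (carrier M))" unfolding j by simp
          also have "\<dots> \<subseteq> act I (?S \<uplus> U)" by (intro act_mono I_subset sm_join sS U desc)
          also have "\<dots> = sc x (act I (pw I j (carrier M))) \<uplus> act I U"
            by (simp add: act_join act_sc I_subset xc sS U sm_pwI)
          also have "\<dots> \<subseteq> sc x (pw I n (carrier M)) \<uplus> U"
            unfolding j by (intro join_mono act_subset I_subset U) simp
          finally show ?thesis .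
        qed
        then show ?thesis using hilbert_function_descent[OF U x(1), of n i] Suc by simp
      qed simp
      moreover have "?H (n + k0) = enat e" by (intro e) simp
      ultimately show ?thesis by simp
    next
      case mu: False
      then have mu': "enat (n + 1) \<le> len (P 1) (P 0)"
        by (simp add: not_le) (metis Suc_ile_eq)
      show ?thesis
      proof (cases "len (P 2) (P 1) \<le> 1")
        case False
        then have "enat 2 \<le> len (P 2) (P 1)"
          by (simp add: not_le one_enat_def numeral_2_eq_2) (metis Suc_ile_eq)
        then have "enat (b - 2) + enat 2 + enat (n + 1) \<le> len (P b) (P 2) + len (P 2) (P 1) + len (P 1) (P 0)"
          using tail mu' by (intro add_mono)
        also have "\<dots> \<le> ?H n" using Hb unfolding split .
        finally have "enat (b - 2) + enat 2 + enat (n + 1) \<le> ?H n" .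
        moreover have "enat (b - 2) + enat 2 + enat (n + 1) = enat (n + b + 1)" using b by simp
        ultimately show ?thesis by (simp only: simp_thms)
      next
        case True
        have "\<exists>c\<ge>1. \<forall>i. F U (n + i) = P (i * c) \<and> (i \<ge> 1 \<longrightarrow> len (P (i * c + c)) (P (i * c)) \<le> enat c)"
          using b by (intro uniserial_case[OF U N_def P_def strict True _ FPb]) simp
        then obtain c where c: "\<And>i. F U (n + i) = P (i * c)"
          "\<And>i. i \<ge> 1 \<Longrightarrow> len (P (i * c + c)) (P (i * c)) \<le> enat c" by blast
        \<comment> \<open>The shift \<open>Suc k0\<close> is in the stable range and at least 1,
          where \<open>c\<close> bounds the length from above. In \<open>H n\<close> itself the
          shift is 0, and there \<open>c\<close> is a lower bound because the chain is
          strict.\<close>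
        have "enat e = ?H (n + Suc k0)" by (intro e[symmetric]) simp
        also have "\<dots> = len (P (Suc k0 * c + c)) (P (Suc k0 * c))"
          using c(1)[of "Suc k0"] c(1)[of "Suc (Suc k0)"] by (simp add: add.commute)
        also have "\<dots> \<le> enat c" by (rule c(2)) simp
        also have "\<dots> \<le> len (P (0 + c)) (P 0)" by (rule len_chain_ge[of P, OF sP strict])
        also have "\<dots> = ?H n" using c(1)[of 0] c(1)[of 1] by simp
        finally show ?thesis by simp
      qed
    qed
  qed
qed

end

section \<open>Hilbert polynomials\<close>

text \<open>The argument \<open>n\<close> belongs to the power \<open>n + 1\<close> of the ideal, so
  values of the Hilbert function at \<open>Suc n\<close> are compared with this polynomial at
  \<open>n\<close>.\<close>

definition hilbert_poly :: "nat \<Rightarrow> (nat \<Rightarrow> int) \<Rightarrow> nat \<Rightarrow> int" where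
  "hilbert_poly d e n = (\<Sum>i\<le>d. (- 1) ^ i * e i * int ((n + d - i) choose (d - i)))"

lemma hilbert_poly_cong: "(\<And>i. i \<le> d \<Longrightarrow> e i = e' i) \<Longrightarrow> hilbert_poly d e n = hilbert_poly d e' n"
  unfolding hilbert_poly_def by (intro sum.cong) auto

lemma hilbert_poly_diff: "hilbert_poly d (\<lambda>i. e i - e' i) n = hilbert_poly d e n - hilbert_poly d e' n"
  unfolding hilbert_poly_def by (simp add: sum_subtractf algebra_simps)

text \<open>Pascal's rule in each term; the last coefficient is constant and cancels. This is why
  division by a superficial element preserves every coefficient but the last.\<close>

lemma hilbert_poly_step:
  "hilbert_poly (Suc d) e (Suc n) - hilbert_poly (Suc d) e n = hilbert_poly d e (Suc n)"
proof -
  have "(Suc n + Suc d - i) choose (Suc d - i)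
      = ((n + Suc d - i) choose (Suc d - i)) + ((Suc n + d - i) choose (d - i))" if "i \<le> d" for i
  proof -
    have "Suc n + Suc d - i = Suc (n + Suc d - i)" "Suc d - i = Suc (d - i)" "n + Suc d - i = Suc n + d - i"
      using that by auto
    then show ?thesis by simp
  qed
  then have "(- 1) ^ i * e i * int ((Suc n + Suc d - i) choose (Suc d - i))
      - (- 1) ^ i * e i * int ((n + Suc d - i) choose (Suc d - i))
      = (- 1) ^ i * e i * int ((Suc n + d - i) choose (d - i))" if "i \<le> d" for i
    using that by (simp add: algebra_simps)
  then have "(\<Sum>i\<le>d. (- 1) ^ i * e i * int ((Suc n + Suc d - i) choose (Suc d - i))
      - (- 1) ^ i * e i * int ((n + Suc d - i) choose (Suc d - i))) = hilbert_poly d e (Suc n)"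
    unfolding hilbert_poly_def by (intro sum.cong) auto
  then show ?thesis unfolding hilbert_poly_def[of "Suc d"] by (simp add: sum_subtractf)
qed

lemma hilbert_poly_Suc: "hilbert_poly (Suc d) (e(Suc d := c)) n
    = hilbert_poly (Suc d) (e(Suc d := 0)) n + (- 1) ^ Suc d * c"
  unfolding hilbert_poly_def by simp

text \<open>Differences lower the degree, so by induction all coefficients but the last vanish, and
  a constant remains.\<close>

lemma hilbert_poly_eventually_zero:
  "\<forall>n\<ge>n0. hilbert_poly d e n = 0 \<Longrightarrow> i \<le> d \<Longrightarrow> e i = 0"
proof (induction d arbitrary: n0 i)
  case 0
  then show ?case unfolding hilbert_poly_def by (auto dest: spec[of _ n0])
next
  case (Suc d)
  have "hilbert_poly d e n = 0" if n: "n \<ge> Suc n0" for n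
  proof -
    obtain m where "n = Suc m" using n by (cases n) auto
    then show ?thesis using hilbert_poly_step[of d e m] Suc.prems(1) n by simp
  qed
  then have low: "\<And>j. j \<le> d \<Longrightarrow> e j = 0" using Suc.IH[of "Suc n0"] by blast
  have "hilbert_poly (Suc d) e n0 = (- 1) ^ Suc d * e (Suc d)"
    unfolding hilbert_poly_def using low by simp
  then have "e (Suc d) = 0" using Suc.prems(1) by simp
  then show ?case using low Suc.prems(2) le_Suc_eq by metis
qed

text \<open>Needed because \<open>hilbert_coeff\<close> is given by a definite description.\<close>

lemma hilbert_coeffs_unique:
  assumes "is_hilbert_coeffs A I M e" "is_hilbert_coeffs A I M e'"
  shows "e = e'"
proof -
  obtain d where d: "module_dim A M = enat d" "\<forall>i>d. e i = 0"
    and ev: "\<forall>\<^sub>F n in sequentially. \<exists>l. module_length A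
      (quotient_module M (ideal_times_module A (ideal_power A I (n + 1)) M)) = enat l \<and> int l = hilbert_poly d e n"
    using assms(1) unfolding is_hilbert_coeffs_def hilbert_poly_def by blast
  obtain d' where d': "module_dim A M = enat d'" "\<forall>i>d'. e' i = 0"
    and ev': "\<forall>\<^sub>F n in sequentially. \<exists>l. module_length A
      (quotient_module M (ideal_times_module A (ideal_power A I (n + 1)) M)) = enat l \<and> int l = hilbert_poly d' e' n"
    using assms(2) unfolding is_hilbert_coeffs_def hilbert_poly_def by blast
  have dd: "d' = d" using d(1) d'(1) by simp
  have "\<forall>\<^sub>F n in sequentially. hilbert_poly d (\<lambda>i. e i - e' i) n = 0"
    using ev ev' by eventually_elim (auto simp: hilbert_poly_diff dd)
  then obtain n0 where "\<forall>n\<ge>n0. hilbert_poly d (\<lambda>i. e i - e' i) n = 0"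
    unfolding eventually_sequentially by blast
  then have "e i - e' i = 0" if "i \<le> d" for i using that by (rule hilbert_poly_eventually_zero)
  then show ?thesis using d(2) d'(2) dd by (metis eq_iff_diff_eq_0 ext not_le)
qed

text \<open>With \<open>D = E - b\<close> the positive deficits are at most
  \<open>D - 1, D - 2, ..., 1\<close>. For negative \<open>D\<close> there are none, and the
  right-hand side is still nonnegative.\<close>

lemma sum_deficit_le:
  fixes E b :: int and H :: "nat \<Rightarrow> int"
  assumes "\<And>k. E \<le> H k \<or> int k + b + 1 \<le> H k"
  shows "2 * (\<Sum>k<n. E - H k) \<le> (E - b) * (E - b - 1)"
proof -
  define D where "D = E - b"
  have le: "(\<Sum>k<n. E - H k) \<le> (\<Sum>k<n. max 0 (D - 1 - int k))"
  proof (rule sum_mono)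
    show "E - H k \<le> max 0 (D - 1 - int k)" for k using assms[of k] unfolding D_def by auto
  qed
  have "2 * (\<Sum>k<n. max 0 (D - 1 - int k)) \<le> D * (D - 1)"
  proof (cases "D \<ge> 0")
    case True
    \<comment> \<open>The invariant adds twice the part of the triangle not yet summed, so that the
      total stays constant.\<close>
    have "2 * (\<Sum>k<n. max 0 (D - 1 - int k)) + max 0 (D - int n) * (max 0 (D - int n) - 1) = D * (D - 1)"
    proof (induction n)
      case 0
      then show ?case using True by simp
    next
      case (Suc n)
      show ?case
      proof (cases "D - int n \<ge> 1")
        case True
        then have "max 0 (D - int n) = D - int n" "max 0 (D - int (Suc n)) = D - int n - 1"
          "max 0 (D - 1 - int n) = D - int n - 1" by auto
        then show ?thesis using Suc by (simp add: algebra_simps)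
      next
        case False
        then have "max 0 (D - int n) = 0" "max 0 (D - int (Suc n)) = 0" "max 0 (D - 1 - int n) = 0" by auto
        then show ?thesis using Suc by simp
      qed
    qed
    moreover have "max 0 (D - int n) * (max 0 (D - int n) - 1) \<ge> 0"
      by (cases "D - int n \<ge> 1") auto
    ultimately show ?thesis by linarith
  next
    case False
    then have "(\<Sum>k<n. max 0 (D - 1 - int k)) = 0" by (intro sum.neutral) auto
    moreover have "0 \<le> D * (D - 1)" using False by (intro mult_nonpos_nonpos) auto
    ultimately show ?thesis by simp
  qed
  then show ?thesis using le unfolding D_def by linarith
qed

section \<open>Induction on the dimension\<close>

context primary_module
begin

definition hf :: "'c set \<Rightarrow> nat \<Rightarrow> nat" where
  "hf U n = the_enat (len (F U n) (carrier M))"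

lemma hf: "sm U \<Longrightarrow> len (F U n) (carrier M) = enat (hf U n)"
  unfolding hf_def using len_F_finite[of U n] by auto

lemma len_F_step:
  assumes U: "sm U"
  shows "hf U n \<le> hf U (Suc n)" "len (F U (Suc n)) (F U n) = enat (hf U (Suc n) - hf U n)"
proof -
  have "len (F U (Suc n)) (carrier M) = len (F U (Suc n)) (F U n) + len (F U n) (carrier M)"
    by (rule len_add[OF sm_F[OF U] sm_F[OF U] sm_carrier_set F_antimono sm_subset[OF sm_F[OF U]]]) simp
  then have e: "enat (hf U (Suc n)) = len (F U (Suc n)) (F U n) + enat (hf U n)" unfolding hf[OF U] .
  then obtain l where l: "len (F U (Suc n)) (F U n) = enat l" by (cases "len (F U (Suc n)) (F U n)") auto
  then show "hf U n \<le> hf U (Suc n)" "len (F U (Suc n)) (F U n) = enat (hf U (Suc n) - hf U n)"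
    using e by auto
qed

lemma hf_0: "sm U \<Longrightarrow> hf U 0 = 0"
  unfolding hf_def F_0 by (simp add: len_self zero_enat_def)

text \<open>The increments \<open>H k\<close> telescope to the Hilbert function, so comparison with
  the polynomial in degree \<open>n0\<close> writes \<open>e1\<close> as the finite sum of all
  \<open>e0 - int (H k)\<close> with \<open>k < Suc n0\<close>.\<close>

lemma dimension_one_bound:
  assumes U: "sm U" and b: "b \<ge> 2" and Ib: "act I (carrier M) \<subseteq> pw \<mm> b (carrier M)"
    and e: "\<forall>n\<ge>n0. int (hf U (Suc n)) = e0 * (int n + 1) - e1"
  shows "2 * e1 \<le> (e0 - int b) * (e0 - int b - 1)"
proof -
  define H where "H k = hf U (Suc k) - hf U k" for k
  have H: "int (H k) = int (hf U (Suc k)) - int (hf U k)" for k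
    unfolding H_def using len_F_step(1)[OF U, of k] by (simp add: of_nat_diff)
  have Hlen: "len (F U (Suc k)) (F U k) = enat (H k)" for k
    unfolding H_def by (rule len_F_step(2)[OF U])
  \<comment> \<open>The threshold is \<open>Suc n0\<close> and not \<open>n0\<close>, because
    \<open>H k\<close> also involves \<open>hf U k\<close>, for which the polynomial must already be
    valid.\<close>
  have He: "int (H k) = e0" if k: "k \<ge> Suc n0" for k
  proof -
    obtain m where m: "k = Suc m" using k by (cases k) auto
    have "int (hf U (Suc k)) = e0 * (int k + 1) - e1" "int (hf U k) = e0 * (int m + 1) - e1"
      using e k m by auto
    then show ?thesis unfolding H m by (simp add: algebra_simps)
  qed
  have e0: "e0 = int (H (Suc n0))" using He[of "Suc n0"] by simp
  have Hc: "H k = H (Suc n0)" if "k \<ge> Suc n0" for k using He[OF that] e0 by simp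
  have Hle: "len (F U (Suc k)) (F U k) = enat (H (Suc n0))" if "k \<ge> Suc n0" for k
    unfolding Hlen Hc[OF that] ..
  have "enat (H (Suc n0)) \<le> enat (H k) \<or> enat (k + b + 1) \<le> enat (H k)" for k
    using hilbert_function_ge[OF U b Ib Hle, of "Suc n0" k] unfolding Hlen by simp
  then have alt: "e0 \<le> int (H k) \<or> int k + int b + 1 \<le> int (H k)" for k
    unfolding e0 enat_ord_simps by (metis of_nat_1 of_nat_add of_nat_le_iff)
  have tele: "(\<Sum>k<n. int (H k)) = int (hf U n)" for n
    by (induction n) (simp_all add: hf_0[OF U] H)
  have "e1 = (\<Sum>k<Suc n0. e0 - int (H k))"
    using e[rule_format, of n0] tele[of "Suc n0"] by (simp add: sum_subtractf algebra_simps)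
  then show ?thesis using sum_deficit_le[of e0 "\<lambda>k. int (H k)" "int b" "Suc n0", OF alt] by simp
qed

text \<open>Induction on the number \<open>j\<close> of elements still to be divided out;
  \<open>i\<close> of them already have been, and \<open>i + j = d\<close> brings the final quotient
  to finite length. Existence of the polynomial and the bound are proved together, since the bound
  speaks of the coefficients just constructed.\<close>

lemma hilbert_coefficients_exist:
  assumes b: "b \<ge> 2" and Ib: "act I (carrier M) \<subseteq> pw \<mm> b (carrier M)"
    and dim: "module_dim R M = enat d"
  shows "dp \<mm> j U \<Longrightarrow> rseq i U \<Longrightarrow> i + j = d \<Longrightarrow>
    \<exists>e n0. (\<forall>k>j. e k = 0) \<and> (\<forall>n\<ge>n0. int (hf U (Suc n)) = hilbert_poly j e n) \<and>
      (j \<ge> 1 \<longrightarrow> 2 * e 1 \<le> (e 0 - int b) * (e 0 - int b - 1))"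
proof (induction j arbitrary: i U)
  case 0
  have U: "sm U" using sm_rseq[OF 0(2)] .
  obtain K where K: "pw \<mm> K (carrier M) \<subseteq> U" using rseq_finite_colength[of d U] 0 dim by auto
  have "F U (Suc n) = U" if "n \<ge> K" for n
  proof (rule join_absorb2[OF sm_pwI U])
    have "pw I (Suc n) (carrier M) \<subseteq> pw I K (carrier M)"
      using that by (intro pw_antimono I_subset sm_carrier_set) simp
    also have "\<dots> \<subseteq> pw \<mm> K (carrier M)" by (rule pw_mono1[OF I_le_\<mm> \<mm>_subset sm_carrier_set])
    finally show "pw I (Suc n) (carrier M) \<subseteq> U" using K by blast
  qed
  then have c: "hf U (Suc n) = the_enat (len U (carrier M))" if "n \<ge> K" for n
    unfolding hf_def using that by simp
  show ?case
    by (rule exI[of _ "\<lambda>k. if k = 0 then int (the_enat (len U (carrier M))) else 0"], rule exI[of _ K])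
      (use c in \<open>simp add: hilbert_poly_def\<close>)
next
  case (Suc j)
  have U: "sm U" using sm_rseq[OF Suc.prems(2)] .
  obtain x n1 where x: "x \<in> I" "reg U x" "dp \<mm> j (quot U x)" and n1: "\<forall>n\<ge>n1. colon (F U (Suc n)) x \<subseteq> F U n"
    using superficial_element[OF U Suc.prems(1)] by blast
  have xc: "x \<in> carrier R" using x(1) I_subset by blast
  have sq: "sm (quot U x)" by (rule sm_quot[OF U xc])
  have "rseq (Suc i) (quot U x)" using Suc.prems(2) x I_le_\<mm> by auto
  then obtain e' n2 where e': "\<forall>k>j. e' k = 0" "\<forall>n\<ge>n2. int (hf (quot U x) (Suc n)) = hilbert_poly j e' n"
    "j \<ge> 1 \<longrightarrow> 2 * e' 1 \<le> (e' 0 - int b) * (e' 0 - int b - 1)"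
    using Suc.IH[OF x(3), of "Suc i"] Suc.prems(3) by auto
  have diff: "int (hf U (Suc n)) = int (hf U n) + int (hf (quot U x) (Suc n))" if "n \<ge> n1" for n
  proof -
    have "enat (hf U (Suc n)) = enat (hf U n) + enat (hf (quot U x) (Suc n))"
      using len_superficial[OF U x(1)] n1 that unfolding hf[OF U] hf[OF sq] by blast
    then show ?thesis by simp
  qed
  define N where "N = max n1 n2"
  let ?p = "hilbert_poly (Suc j) (e'(Suc j := 0))"
  \<comment> \<open>The constant of integration: Hilbert function and polynomial have equal
    differences from \<open>N\<close> on, so \<open>\<gamma>\<close>, up to sign, is the new last
    coefficient.\<close>
  define \<gamma> where "\<gamma> = int (hf U (Suc N)) - ?p N"
  have const: "int (hf U (Suc n)) - ?p n = \<gamma>" if "n \<ge> N" for n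
    using that
  proof (induction n rule: dec_induct)
    case base
    show ?case unfolding \<gamma>_def by (rule refl)
  next
    case (step n)
    have "?p (Suc n) - ?p n = hilbert_poly j e' (Suc n)"
      unfolding hilbert_poly_step by (rule hilbert_poly_cong) simp
    moreover have "int (hf U (Suc (Suc n))) - int (hf U (Suc n)) = hilbert_poly j e' (Suc n)"
      using diff[of "Suc n"] e'(2) step.hyps unfolding N_def by simp
    ultimately show ?case using step.IH by linarith
  qed
  define e where "e = e'(Suc j := (- 1) ^ Suc j * \<gamma>)"
  have sq1: "(- 1) ^ Suc j * ((- 1) ^ Suc j * \<gamma>) = \<gamma>"
    by (rule left_minus_one_mult_self)
  have poly: "int (hf U (Suc n)) = hilbert_poly (Suc j) e n" if "n \<ge> N" for n
    using const[OF that] sq1 hilbert_poly_Suc[of j e' "(- 1) ^ Suc j * \<gamma>" n] unfolding e_def by linarith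
  \<comment> \<open>For \<open>j = 0\<close> the coefficient \<open>e 1\<close> is the new constant
    itself, and the one-dimensional bound applies. For larger \<open>j\<close> the update at
    \<open>Suc j\<close> leaves \<open>e 0\<close> and \<open>e 1\<close> untouched.\<close>
  have bound: "2 * e 1 \<le> (e 0 - int b) * (e 0 - int b - 1)"
  proof (cases j)
    case 0
    have "int (hf U (Suc n)) = e 0 * (int n + 1) - e 1" if "n \<ge> N" for n
      using poly[OF that] unfolding hilbert_poly_def 0 by (simp add: algebra_simps)
    then show ?thesis by (intro dimension_one_bound[OF U b Ib, of N]) blast
  next
    case (Suc j')
    then show ?thesis using e'(3) unfolding e_def by simp
  qed
  have "\<forall>k>Suc j. e k = 0" using e'(1) unfolding e_def by simp
  then show ?case using poly bound by blast
qed

lemma dp_Suc_imp: "dp \<mm> (Suc k) U \<Longrightarrow> sm U \<Longrightarrow> dp \<mm> k U"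
proof (induction k arbitrary: U)
  case 0
  then show ?case using dp_proper[OF 0(1,2) \<mm>_subset] by simp
next
  case (Suc k)
  obtain x where x: "x \<in> \<mm>" "reg U x" "dp \<mm> (Suc k) (quot U x)"
    using Suc.prems(1) unfolding dp.simps(2)[of \<mm> "Suc k"] by blast
  then have "dp \<mm> k (quot U x)" using Suc.IH sm_quot[OF Suc.prems(2)] \<mm>_subset by blast
  then show ?case using x by auto
qed

lemma dp_le: "dp \<mm> l U \<Longrightarrow> sm U \<Longrightarrow> k \<le> l \<Longrightarrow> dp \<mm> k U"
  by (induction l) (auto simp: le_Suc_eq simp del: dp.simps dest: dp_Suc_imp)

text \<open>The depth is finite by \<open>depth_bounded\<close>, and a finite supremum in
  \<open>enat\<close> is attained. Positive dimension excludes the empty set of lengths, whose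
  supremum is 0.\<close>

lemma cohen_macaulay_dp:
  assumes cm: "cohen_macaulay R \<mm> M" and pos: "module_dim R M > 0"
  shows "\<exists>d. d \<ge> 1 \<and> module_dim R M = enat d \<and> dp \<mm> d {\<zero>\<^bsub>M\<^esub>}"
proof -
  let ?S = "{enat (length xs) | xs. set xs \<subseteq> \<mm> \<and> regular_sequence R M xs}"
  have sup: "Sup ?S = module_dim R M" using cm unfolding cohen_macaulay_def depth_def .
  have dpS: "dp \<mm> l {\<zero>\<^bsub>M\<^esub>}" if "enat l \<in> ?S" for l using that regular_sequence_dp by auto
  obtain k where k: "\<not> dp \<mm> k {\<zero>\<^bsub>M\<^esub>}" using depth_bounded[OF sm_zero_set] by blast
  have "s \<le> enat k" if s: "s \<in> ?S" for s
  proof -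
    obtain l where l: "s = enat l" using s by blast
    have "dp \<mm> l {\<zero>\<^bsub>M\<^esub>}" using dpS[of l] s unfolding l .
    then have "l \<le> k" using dp_le[OF _ sm_zero_set, of l k] k by (metis nat_le_linear)
    then show ?thesis unfolding l by simp
  qed
  then have "module_dim R M \<le> enat k" unfolding sup[symmetric] by (rule Sup_least)
  then obtain d where d: "module_dim R M = enat d" by (metis enat_ile)
  have ne: "?S \<noteq> {}"
  proof
    assume empty: "?S = {}"
    have "module_dim R M = Sup {}" using sup unfolding empty by (rule sym)
    then show False using pos by (simp add: bot_enat_def)
  qed
  have "Sup ?S = enat d" unfolding sup by (rule d)
  then have "enat d \<in> ?S" by (rule enat_Sup_attained[OF ne])
  moreover have "d \<ge> 1" using pos d by (cases d) (auto simp: zero_enat_def)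
  ultimately show ?thesis using d dpS by blast
qed

lemma hilbert_coeff_bound:
  assumes cm: "cohen_macaulay R \<mm> M" and pos: "module_dim R M > 0" and b: "b \<ge> 2"
    and Ib: "act I (carrier M) \<subseteq> pw \<mm> b (carrier M)"
  shows "2 * hilbert_coeff R 1 I M \<le> (hilbert_coeff R 0 I M - int b) * (hilbert_coeff R 0 I M - int b - 1)"
proof -
  obtain d where d: "d \<ge> 1" "module_dim R M = enat d" "dp \<mm> d {\<zero>\<^bsub>M\<^esub>}"
    using cohen_macaulay_dp[OF cm pos] by blast
  obtain e n0 where e: "\<forall>k>d. e k = 0" "\<forall>n\<ge>n0. int (hf {\<zero>\<^bsub>M\<^esub>} (Suc n)) = hilbert_poly d e n"
    "d \<ge> 1 \<longrightarrow> 2 * e 1 \<le> (e 0 - int b) * (e 0 - int b - 1)"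
    using hilbert_coefficients_exist[OF b Ib d(2) d(3), of 0] by auto
  have len: "module_length R (quotient_module M (ideal_times_module R (ideal_power R I (n + 1)) M))
      = enat (hf {\<zero>\<^bsub>M\<^esub>} (Suc n))" for n
  proof -
    have "ideal_times_module R (ideal_power R I (n + 1)) M = F {\<zero>\<^bsub>M\<^esub>} (Suc n)"
      using ideal_power_times_module[OF ideal_I, of "n + 1"] join_zero[OF sm_pwI, of "Suc n"] by simp
    then show ?thesis
      by (simp only: module_length_quotient[OF sm_F[OF sm_zero_set]] hf[OF sm_zero_set])
  qed
  have "is_hilbert_coeffs R I M e"
    unfolding is_hilbert_coeffs_def
  proof (intro exI[of _ d] conjI d(2) e(1))
    show "\<forall>\<^sub>F n in sequentially. \<exists>l. module_length R
        (quotient_module M (ideal_times_module R (ideal_power R I (n + 1)) M)) = enat l \<and>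
        int l = (\<Sum>i\<le>d. (- 1) ^ i * e i * int ((n + d - i) choose (d - i)))"
      unfolding eventually_sequentially len hilbert_poly_def[symmetric] using e(2) by blast
  qed
  then have "(THE e. is_hilbert_coeffs R I M e) = e"
    using hilbert_coeffs_unique by (intro the_equality) auto
  then show ?thesis unfolding hilbert_coeff_def using e(3) d(1) by simp
qed

end

theorem proposition3p2:
  fixes A :: "('a, 'r) ring_scheme"
    and M :: "('a, 'b, 'm) module_scheme"
    and \<mm> I :: "'a set"
    and b :: nat
  assumes "noetherian_ring A"
    and "local_ring A \<mm>"
    and "infinite (carrier (A Quot \<mm>))"
    and "fin_gen_module A M"
    and "cohen_macaulay A \<mm> M"
    and "module_dim A M > 0"
    and "primary_to A \<mm> I"
    and "b \<ge> 2"
    and "ideal_times_module A I M \<subseteq> ideal_times_module A (ideal_power A \<mm> b) M"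
  shows "real_of_int (hilbert_coeff A 1 I M) \<le> (real_of_int (hilbert_coeff A 0 I M) - real b) gchoose 2"
proof -
  interpret primary_module A M \<mm> I
    using assms(1-4,7) unfolding fin_gen_module_def
    by (intro primary_module.intro primary_module_axioms.intro noetherian_local.intro
        noetherian_local_axioms.intro noetherian_module.intro noetherian_module_axioms.intro) blast+
  let ?e0 = "hilbert_coeff A 0 I M" and ?e1 = "hilbert_coeff A 1 I M"
  have "act I (carrier M) \<subseteq> pw \<mm> b (carrier M)"
    using assms(9) ideal_power_times_module[OF ideal_\<mm>, of b] ideal_times_module_eq[of I] by simp
  then have "2 * ?e1 \<le> (?e0 - int b) * (?e0 - int b - 1)"
    by (rule hilbert_coeff_bound[OF assms(5,6,8)])
  then have "real_of_int (2 * ?e1) \<le> real_of_int ((?e0 - int b) * (?e0 - int b - 1))"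
    by (simp only: of_int_le_iff)
  then have "2 * real_of_int ?e1 \<le> (real_of_int ?e0 - real b) * (real_of_int ?e0 - real b - 1)"
    by simp
  \<comment> \<open>The identity holds for every real \<open>x\<close>, so the doubled integer
    inequality transfers also when \<open>e\<^sub>0 < b\<close>.\<close>
  moreover have gchoose_2: "x gchoose 2 = x * (x - 1) / 2" for x :: real
    by (simp add: gbinomial_prod_rev numeral_2_eq_2)
  ultimately show ?thesis unfolding gchoose_2 by simp
qed

end
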